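(* Consider the DSCMD-N iteration described in the context, and suppose that the network, stochastic-subgradient, noise and mirror-map assumptions listed in the context hold. If $\{\alpha_t\}_{t\ge 0}$ and $\{r_t\}_{t\ge 0}$ are positive non-increasing sequences, then for every $l\in\mathcal V$ and every integer $T\ge 1$, with $\hat x_l^T=\frac1T\sum_{t=1}^T x_l^t$, $$\mathbb E[F(\hat x_l^T)]-F(x^* )\le \frac{C_1}{T}+\frac{C_2}{T\alpha_T}+\frac{C_3}{T}\sum_{t=0}^T\alpha_t+\frac{C_4}{T}\sum_{t=0}^T r_t+\frac{C_5}{T}\sum_{t=0}^T\frac{r_t}{\alpha_t}+\frac{C_6}{T}\sum_{t=0}^T\frac{r_t^2}{\alpha_t},$$ where, with $\omega=\left(1-\frac{\theta}{4N^2}\right)^{-2}$ and $\gamma=\left(1-\frac{\theta}{4N^2}\right)^{1/B}$, $$C_1=\frac{2N\omega}{1-\gamma}\big[(N+1)G_f+NG_\chi\big]\sum_{j=1}^N\|x_j^0\|,\qquad C_2=ND_{\Phi,\mathcal X}^2,$$ $$C_3=\Big(\big(4N+\tfrac{2N^2\omega}{1-\gamma}\big)\big[(N+1)G_f+NG_\chi\big]+NG_\chi\Big)\frac{G_f+G_\chi}{\sigma_\Phi}+\frac{NG_f^2}{2\sigma_\Phi},$$ $$C_4=\big(4N+\tfrac{2N^2\omega}{1-\gamma}\big)\big[(N+1)G_f+NG_\chi\big]N\sqrt\nu+(G_f+G_\chi)N^2\sqrt\nu,$$ $$C_5=\sqrt{\tfrac{2}{\sigma_\Phi}}\,D_{\Phi,\mathcal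 X}L_\Phi N\sqrt\nu,\qquad C_6=NL_\Phi\nu.$$
   Context: Problem. $\mathcal V=\{1,\dots,N\}$ is a set of agents; $\mathcal X\subseteq\mathbb R^n$ is nonempty, convex and compact; $f_i,\chi_i:\mathbb R^n\to\mathbb R$ ($i\in\mathcal V$) are convex, possibly nonsmooth; $F_i=f_i+\chi_i$, $F=\sum_{i=1}^N F_i$. The problem is to minimize $F$ over $\mathcal X$; $\mathcal X^*$ is the set of minimizers and $x^*\in\mathcal X^*$. $\|\cdot\|$ is the Euclidean norm. $G_\chi=\max_{i\in\mathcal V}\sup\{\|g\|:g\in\partial\chi_i(x),\,x\in\mathcal X\}$. Mirror map. $\Phi:\mathbb R^n\to\mathbb R$ is continuously differentiable and $\sigma_\Phi$-strongly convex ($\sigma_\Phi>0$): $\Phi(x)\ge\Phi(y)+\langle\nabla\Phi(y),x-y\rangle+\frac{\sigma_\Phi}{2}\|x-y\|^2$. Its Bregman divergence is $D_\Phi(x,y)=\Phi(x)-\Phi(y)-\langle\nabla\Phi(y),x-y\rangle$, and $D_{\Phi,\mathcal X}^2=\sup_{x,y\in\mathcal X}D_\Phi(x,y)$ with $D_{\Phi,\mathcal X}\ge 0$. DSCMD-N. Starting from deterministic $x_i^0\in\mathcal X$, with stepsizes $\alpha_t>0$ and noise magnitudes $r_t>0$, for $t=0,1,2,\dots$ and $i\in\mathcal V$: $$y_i^t=\sum_{j=1}^N[P^t]_{ij}(x_j^t+r_t\xi_{ij}^t),\qquad x_i^{t+1}=\arg\min_{x\in\mathcal X}\Big\{\langle\tilde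 g_i^t,x\rangle+\frac1{\alpha_t}D_\Phi(x,y_i^t)+\chi_i(x)\Big\}.$$ Here $P^t$ is an $N\times N$ weight matrix, $\xi_{ij}^t$ is a random vector in $\mathbb R^n$, and $\tilde g_i^t=\tilde g_i(y_i^t)$ is a stochastic subgradient of $f_i$ queried at $y_i^t$. $\mathcal F_t$ is the $\sigma$-algebra of the history up to time $t$ ($\mathcal F_{-1}$ trivial); all processes are adapted, the noises and stochastic subgradients of time $t$ being $\mathcal F_t$-measurable. Network assumption. Each $P^t$ is doubly stochastic with nonnegative entries; $E^t=\{(i,j):[P^t]_{ij}>0\}$; there is an integer $B\ge1$ such that the graph $(\mathcal V,\bigcup_{t=sB+1}^{(s+1)B}E^t)$ is strongly connected for every $s\ge0$; there is $\theta\in(0,1)$ with $[P^t]_{ii}\ge\theta$ for all $i,t$ and $[P^t]_{ij}\ge\theta$ whenever $(j,i)\in E^t$. Stochastic-subgradient assumption. There is $G_f\ge0$ such that at any $x\in\mathcal X$, $\mathbb E[\tilde g_i(x)\mid\mathcal F_{t-1}]=g_i(x)\in\partial f_i(x)$ and $\mathbb E[\|\tilde g_i(x)\|^2\mid\mathcal F_{t-1}]\le G_f^2$; the same holds at the query points: conditionally on $\mathcal F_{t-1}$ and the time-$t$ noises, $\tilde g_i^t$ has mean $g_i(y_i^t)\in\partial f_i(y_i^t)$ and second moment (of the norm) at most $G_f^2$. Noise assumption. At each time $t$, the noise on link $(i,j)$ is independent of the noise on link $(i',j')$ for $i\ne i'$, $j\neq j'$; and $\mathbb E[\|\xi_{ij}^t\|^2\mid\mathcal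 F_{t-1}]\le\nu$ for all $i,j\in\mathcal V$ and $t$. Mirror-map assumption. $\|\nabla\Phi(x)-\nabla\Phi(y)\|\le L_\Phi\|x-y\|$ for all $x,y\in\mathbb R^n$; and $D_\Phi(a,\sum_{i=1}^N\nu_ib_i)\le\sum_{i=1}^N\nu_iD_\Phi(a,b_i)$ for all $a,b_1,\dots,b_N\in\mathbb R^n$ and $\nu_i\in[0,1]$ with $\sum_i\nu_i=1$. *)

theory Defs
  imports "HOL-Probability.Probability"
begin

section \<open>Convex analysis\<close>

definition subdifferential :: "('a::real_inner \<Rightarrow> real) \<Rightarrow> 'a \<Rightarrow> 'a set" where
  "subdifferential f x = {g. \<forall>y. f y \<ge> f x + g \<bullet> (y - x)}"

text \<open>For finite convex functions on a nonempty compact set the supremum is over a nonempty bounded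
  set of reals, so \<^const>\<open>Sup\<close> has its usual meaning.\<close>

definition subgradient_bound :: "('v::finite \<Rightarrow> 'a::real_inner \<Rightarrow> real) \<Rightarrow> 'a set \<Rightarrow> real" where
  "subgradient_bound h X = Max (range (\<lambda>i. Sup {norm g | g x. x \<in> X \<and> g \<in> subdifferential (h i) x}))"

text \<open>In the following, \<open>d\<Phi>\<close> is the gradient of \<open>\<Phi>\<close>; this is enforced by \<open>mirror_map\<close>.\<close>

definition mirror_map :: "('a::real_inner \<Rightarrow> real) \<Rightarrow> ('a \<Rightarrow> 'a) \<Rightarrow> real \<Rightarrow> bool" where
  "mirror_map \<Phi> d\<Phi> \<sigma> \<longleftrightarrow>
     (\<forall>x. GDERIV \<Phi> x :> d\<Phi> x) \<and> continuous_on UNIV d\<Phi> \<and> \<sigma> > 0 \<and>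
     (\<forall>x y. \<Phi> x \<ge> \<Phi> y + d\<Phi> y \<bullet> (x - y) + \<sigma> / 2 * (norm (x - y))\<^sup>2)"

definition bregman :: "('a::real_inner \<Rightarrow> real) \<Rightarrow> ('a \<Rightarrow> 'a) \<Rightarrow> 'a \<Rightarrow> 'a \<Rightarrow> real" where
  "bregman \<Phi> d\<Phi> x y = \<Phi> x - \<Phi> y - d\<Phi> y \<bullet> (x - y)"

text \<open>The square root of the supremal divergence, that is, \<open>D\<^bsub>\<Phi>,X\<^esub>\<close> and not its square.\<close>

definition bregman_diameter :: "('a::real_inner \<Rightarrow> real) \<Rightarrow> ('a \<Rightarrow> 'a) \<Rightarrow> 'a set \<Rightarrow> real" where
  "bregman_diameter \<Phi> d\<Phi> X = sqrt (SUP (x, y) \<in> X \<times> X. bregman \<Phi> d\<Phi> x y)"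

text \<open>The last two arguments are the Lipschitz constant of the gradient and, as a type token, the
  index set of the convex combinations.\<close>

definition mirror_map_assumption ::
  "('a::real_inner \<Rightarrow> real) \<Rightarrow> ('a \<Rightarrow> 'a) \<Rightarrow> real \<Rightarrow> 'v::finite itself \<Rightarrow> bool" where
  "mirror_map_assumption \<Phi> d\<Phi> L (_ :: 'v itself) \<longleftrightarrow>
     (\<forall>x y. norm (d\<Phi> x - d\<Phi> y) \<le> L * norm (x - y)) \<and>
     (\<forall>a (b :: 'v \<Rightarrow> 'a) c. (\<forall>i. c i \<in> {0..1}) \<and> (\<Sum>i\<in>UNIV. c i) = 1 \<longrightarrow>
        bregman \<Phi> d\<Phi> a (\<Sum>i\<in>UNIV. c i *\<^sub>R b i) \<le> (\<Sum>i\<in>UNIV. c i * bregman \<Phi> d\<Phi> a (b i)))"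


section \<open>Network\<close>

definition doubly_stochastic :: "real ^ 'v ^ 'v \<Rightarrow> bool" where
  "doubly_stochastic A \<longleftrightarrow>
     (\<forall>i j. A $ i $ j \<ge> 0) \<and> (\<forall>i. (\<Sum>j\<in>UNIV. A $ i $ j) = 1) \<and> (\<forall>j. (\<Sum>i\<in>UNIV. A $ i $ j) = 1)"

definition edges :: "real ^ 'v ^ 'v \<Rightarrow> ('v \<times> 'v) set" where
  "edges A = {(i, j). A $ i $ j > 0}"

definition strongly_connected_graph :: "('v \<times> 'v) set \<Rightarrow> bool" where
  "strongly_connected_graph E \<longleftrightarrow> (\<forall>i j. (i, j) \<in> E\<^sup>*)"

definition network_assumption :: "(nat \<Rightarrow> real ^ 'v ^ 'v) \<Rightarrow> nat \<Rightarrow> real \<Rightarrow> bool" where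
  "network_assumption P B \<theta> \<longleftrightarrow>
     (\<forall>t. doubly_stochastic (P t)) \<and>
     B \<ge> 1 \<and> (\<forall>s. strongly_connected_graph (\<Union>t\<in>{s * B + 1..(s + 1) * B}. edges (P t))) \<and>
     0 < \<theta> \<and> \<theta> < 1 \<and> (\<forall>t i. P t $ i $ i \<ge> \<theta>) \<and>
     (\<forall>t i j. (j, i) \<in> edges (P t) \<longrightarrow> P t $ i $ j \<ge> \<theta>)"


section \<open>Stochastic iteration\<close>

text \<open>The filtration is indexed by the naturals; \<open>past M F t\<close> is the member of index \<open>t - 1\<close>, where
  index \<open>-1\<close> means the trivial \<open>\<sigma>\<close>-algebra.\<close>

definition past :: "'w measure \<Rightarrow> (nat \<Rightarrow> 'w measure) \<Rightarrow> nat \<Rightarrow> 'w measure" where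
  "past M F t = (case t of 0 \<Rightarrow> sigma (space M) {} | Suc s \<Rightarrow> F s)"

definition past_and_noise ::
  "'w measure \<Rightarrow> (nat \<Rightarrow> 'w measure) \<Rightarrow> (nat \<Rightarrow> 'v \<Rightarrow> 'v \<Rightarrow> 'w \<Rightarrow> 'a::topological_space) \<Rightarrow> nat \<Rightarrow> 'w measure"
where
  "past_and_noise M F \<xi> t =
     sigma (space M) (sets (past M F t) \<union> {\<xi> t i j -` A \<inter> space M | i j A. A \<in> sets borel})"

text \<open>\<open>gs t i z\<close> is the stochastic subgradient returned to agent \<open>i\<close> at time \<open>t\<close> for the query
  point \<open>z\<close>, and \<open>y t i\<close> is the (random) query point used by the algorithm.\<close>

definition dscmd_n ::
  "'w measure \<Rightarrow> (real ^ 'n) set \<Rightarrow> (real ^ 'n \<Rightarrow> real) \<Rightarrow> (real ^ 'n \<Rightarrow> real ^ 'n) \<Rightarrow>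
   ('v \<Rightarrow> real ^ 'n \<Rightarrow> real) \<Rightarrow> (nat \<Rightarrow> real ^ 'v ^ 'v) \<Rightarrow> (nat \<Rightarrow> real) \<Rightarrow> (nat \<Rightarrow> real) \<Rightarrow>
   (nat \<Rightarrow> 'v \<Rightarrow> 'v \<Rightarrow> 'w \<Rightarrow> real ^ 'n) \<Rightarrow> (nat \<Rightarrow> 'v \<Rightarrow> real ^ 'n \<Rightarrow> 'w \<Rightarrow> real ^ 'n) \<Rightarrow>
   ('v \<Rightarrow> real ^ 'n) \<Rightarrow> (nat \<Rightarrow> 'v \<Rightarrow> 'w \<Rightarrow> real ^ 'n) \<Rightarrow> (nat \<Rightarrow> 'v \<Rightarrow> 'w \<Rightarrow> real ^ 'n) \<Rightarrow> bool"
where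
  "dscmd_n M X \<Phi> d\<Phi> h P \<alpha> r \<xi> gs x0 x y \<longleftrightarrow>
     (\<forall>i. x0 i \<in> X) \<and>
     (\<forall>w\<in>space M. \<forall>i. x 0 i w = x0 i) \<and>
     (\<forall>w\<in>space M. \<forall>t i. y t i w = (\<Sum>j\<in>UNIV. P t $ i $ j *\<^sub>R (x t j w + r t *\<^sub>R \<xi> t i j w))) \<and>
     (\<forall>w\<in>space M. \<forall>t i.
        is_arg_min (\<lambda>z. gs t i (y t i w) w \<bullet> z + 1 / \<alpha> t * bregman \<Phi> d\<Phi> z (y t i w) + h i z)
          (\<lambda>z. z \<in> X) (x (Suc t) i w))"

text \<open>The iterate of index \<open>t + 1\<close> is produced from the data of time \<open>t\<close> and so belongs to the
  history up to time \<open>t\<close>.\<close>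

definition adapted_history ::
  "'w measure \<Rightarrow> (nat \<Rightarrow> 'w measure) \<Rightarrow> (real ^ 'n) set \<Rightarrow>
   (nat \<Rightarrow> 'v \<Rightarrow> 'v \<Rightarrow> 'w \<Rightarrow> real ^ 'n) \<Rightarrow> (nat \<Rightarrow> 'v \<Rightarrow> real ^ 'n \<Rightarrow> 'w \<Rightarrow> real ^ 'n) \<Rightarrow>
   (nat \<Rightarrow> 'v \<Rightarrow> 'w \<Rightarrow> real ^ 'n) \<Rightarrow> (nat \<Rightarrow> 'v \<Rightarrow> 'w \<Rightarrow> real ^ 'n) \<Rightarrow> bool"
where
  "adapted_history M F X \<xi> gs x y \<longleftrightarrow>
     filtration (space M) F \<and> (\<forall>t. subalgebra M (F t)) \<and>
     (\<forall>t i j. \<xi> t i j \<in> borel_measurable (F t)) \<and>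
     (\<forall>t i. \<forall>z\<in>X. gs t i z \<in> borel_measurable (F t)) \<and>
     (\<forall>t i. (\<lambda>w. gs t i (y t i w) w) \<in> borel_measurable (F t)) \<and>
     (\<forall>t i. y t i \<in> borel_measurable (F t)) \<and>
     (\<forall>t i. x (Suc t) i \<in> borel_measurable (F t))"

text \<open>\<open>E[Z | H] = m\<close> (stated per coordinate) and \<open>E[|Z|^2 | H] \<le> c\<close>, almost surely. The second
  moment is taken in \<^typ>\<open>ennreal\<close>: \<^const>\<open>real_cond_exp\<close> of a non-integrable function would be
  a junk value that satisfies the bound. Together with the moment bound, each coordinate of \<open>Z\<close> is
  integrable, so that its \<^const>\<open>real_cond_exp\<close> is the conditional expectation.\<close>

definition cond_mean_is :: "'w measure \<Rightarrow> 'w measure \<Rightarrow> ('w \<Rightarrow> real ^ 'n) \<Rightarrow> ('w \<Rightarrow> real ^ 'n) \<Rightarrow> bool" where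
  "cond_mean_is M H Z m \<longleftrightarrow> (\<forall>k. AE w in M. real_cond_exp M H (\<lambda>w. Z w $ k) w = m w $ k)"

definition cond_second_moment_le :: "'w measure \<Rightarrow> 'w measure \<Rightarrow> ('w \<Rightarrow> real ^ 'n) \<Rightarrow> real \<Rightarrow> bool" where
  "cond_second_moment_le M H Z c \<longleftrightarrow>
     (AE w in M. nn_cond_exp M H (\<lambda>w. ennreal ((norm (Z w))\<^sup>2)) w \<le> ennreal c)"

definition stochastic_subgradient_assumption ::
  "'w measure \<Rightarrow> (nat \<Rightarrow> 'w measure) \<Rightarrow> (real ^ 'n) set \<Rightarrow> ('v \<Rightarrow> real ^ 'n \<Rightarrow> real) \<Rightarrow>
   (nat \<Rightarrow> 'v \<Rightarrow> 'v \<Rightarrow> 'w \<Rightarrow> real ^ 'n) \<Rightarrow> (nat \<Rightarrow> 'v \<Rightarrow> real ^ 'n \<Rightarrow> 'w \<Rightarrow> real ^ 'n) \<Rightarrow>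
   (nat \<Rightarrow> 'v \<Rightarrow> 'w \<Rightarrow> real ^ 'n) \<Rightarrow> ('v \<Rightarrow> real ^ 'n \<Rightarrow> real ^ 'n) \<Rightarrow> real \<Rightarrow> bool"
where
  "stochastic_subgradient_assumption M F X f \<xi> gs y g Gf \<longleftrightarrow>
     Gf \<ge> 0 \<and>
     (\<forall>t i. \<forall>z\<in>X. g i z \<in> subdifferential (f i) z \<and>
        cond_mean_is M (past M F t) (gs t i z) (\<lambda>_. g i z) \<and>
        cond_second_moment_le M (past M F t) (gs t i z) (Gf\<^sup>2)) \<and>
     (\<forall>t i. (AE w in M. g i (y t i w) \<in> subdifferential (f i) (y t i w)) \<and>
        cond_mean_is M (past_and_noise M F \<xi> t) (\<lambda>w. gs t i (y t i w) w) (\<lambda>w. g i (y t i w)) \<and>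
        cond_second_moment_le M (past_and_noise M F \<xi> t) (\<lambda>w. gs t i (y t i w) w) (Gf\<^sup>2))"

text \<open>Nonnegativity of \<open>\<nu>\<close> is implicit in a bound on a second moment, but \<^const>\<open>ennreal\<close> truncates
  negative reals to \<open>0\<close>.\<close>

definition noise_assumption ::
  "'w measure \<Rightarrow> (nat \<Rightarrow> 'w measure) \<Rightarrow> (nat \<Rightarrow> 'v \<Rightarrow> 'v \<Rightarrow> 'w \<Rightarrow> real ^ 'n) \<Rightarrow> real \<Rightarrow> bool"
where
  "noise_assumption M F \<xi> \<nu> \<longleftrightarrow>
     \<nu> \<ge> 0 \<and>
     (\<forall>t i j i' j'. i \<noteq> i' \<and> j \<noteq> j' \<longrightarrow>
        prob_space.indep_var M borel (\<xi> t i j) borel (\<xi> t i' j')) \<and>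
     (\<forall>t i j. cond_second_moment_le M (past M F t) (\<xi> t i j) \<nu>)"

end

theory Submission
  imports Defs
begin

text \<open>Since \<open>a\<close> ranges over the whole space, convexity of \<open>b \<mapsto> D(a, b)\<close> forces the gradient of \<open>\<Phi>\<close> to be
  affine as soon as there are two agents, so that \<open>D\<close> is symmetric. This matters because the query points
  may leave \<open>X\<close>: the distance from \<open>y\<close> to the next iterate cannot be bounded by \<open>\<alpha> (G\<^sub>f + G\<^sub>\<chi>) / \<sigma>\<close>, and the
  noise enters the disagreement of the agents with the factor \<open>L / \<sigma>\<close>, which is absent from the claimed
  constants. Two effects compensate for it. First, averaging decreases the potential \<open>\<Sum>\<^sub>i D(x\<^sup>*, x\<^sub>i)\<close> by
  \<open>\<sigma> / 2\<close> times the variance that it destroys, which pays for the disagreement of the agents. Secondly, symmetry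
  improves the first-order effect of the noise on the potential from \<open>C\<^sub>5\<close> to \<open>C\<^sub>5 sqrt (\<sigma> / L)\<close>; if
  \<open>L > 4 \<sigma>\<close>, the half of \<open>C\<^sub>5\<close> that is left absorbs the factor \<open>L / \<sigma>\<close> while the step sizes are small. While
  they are large, the \<open>C\<^sub>3\<close> term alone exceeds the trivial bound on the gap.\<close>

section \<open>Convex analysis and mirror maps\<close>

text \<open>The form of the constants dictates the accounting. The claimed factor \<omega> / (1 -
  \<gamma>) suggests geometric decay of matrix products, but that would charge every displacement of
  an iterate, with its factor L / \<sigma>, to the disagreement. Here disagreement is paid by
  destroyed variance: over 2 B rounds, connectivity makes noiseless averaging lose at least the
  fraction 2 \<theta> / N^2 of its dispersion, and Young's inequality trades the root of the
  dispersion against this loss, which enters the one-step inequality with weight \<sigma> / (2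
  \<alpha>). Of the claimed factor one then needs \<omega> / (1 - \<gamma>) \<ge> 4 N^2 B /
  \<theta>. Displacements still occur, because the iterates deviate from noiseless averaging inside
  a window; but there L / \<sigma> comes with N^3 where the claimed constants offer N^5, a slack
  that covers ratios up to 4. Hence the case distinction at L = 4 \<sigma>. A single agent has no
  symmetry to exploit, but no disagreement either, and its plain first-order noise effect is exactly
  the C_5 term.\<close>

lemma convex_subdifferential_nonempty:
  fixes f :: "'a::euclidean_space \<Rightarrow> real"
  assumes "convex_on UNIV f"
  shows "subdifferential f x \<noteq> {}"
proof -
  let ?S = "{x} \<times> {..<f x}" and ?E = "epigraph UNIV f"
  have "convex ?E"
    using assms by (simp add: convex_epigraph)
  moreover have "convex ?S"
    by (intro convex_Times) auto
  moreover have "?S \<noteq> {}" "?E \<noteq> {}" "?S \<inter> ?E = {}"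
    by (auto simp: epigraph_def intro: lt_ex)
  ultimately obtain a b where a: "a \<noteq> 0" "\<forall>z\<in>?S. a \<bullet> z \<le> b" "\<forall>z\<in>?E. a \<bullet> z \<ge> b"
    using separating_hyperplane_sets by metis
  obtain p q where pq: "a = (p, q)"
    by (cases a)
  have sep: "p \<bullet> x + q * s \<le> p \<bullet> y + q * t" if "s < f x" "f y \<le> t" for s t y
  proof -
    have "a \<bullet> (x, s) \<le> b" "a \<bullet> (y, t) \<ge> b"
      using a that by (auto simp: epigraph_def)
    then show ?thesis
      by (simp add: pq inner_prod_def)
  qed
  have "q \<ge> 0"
    using sep[of "f x - 1" x "f x"] by (simp add: algebra_simps)
  \<comment> \<open>A vertical hyperplane is impossible because \<open>f\<close> is finite
    everywhere: a step from \<open>x\<close> by \<open>-p\<close> would cross it. The slope of the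
    hyperplane is then a subgradient.\<close>
  moreover have "q \<noteq> 0"
  proof
    assume "q = 0"
    then have "p \<bullet> x \<le> p \<bullet> (x - p)"
      using sep[of "f x - 1" "x - p" "f (x - p)"] by simp
    then have "p \<bullet> p \<le> 0"
      by (simp add: inner_diff_right)
    then show False
      using a(1) pq \<open>q = 0\<close> by (metis inner_gt_zero_iff not_le zero_prod_def)
  qed
  ultimately have "q > 0"
    by simp
  have "f y \<ge> f x + (- p /\<^sub>R q) \<bullet> (y - x)" for y
  proof (rule field_le_epsilon)
    fix e :: real
    assume "e > 0"
    have "p \<bullet> x + q * (f x - e) \<le> p \<bullet> y + q * f y"
      using sep \<open>e > 0\<close> by simp
    then show "f x + (- p /\<^sub>R q) \<bullet> (y - x) \<le> f y + e"
      using \<open>q > 0\<close> by (simp add: inner_diff_right field_simps)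
  qed
  then have "- p /\<^sub>R q \<in> subdifferential f x"
    by (simp add: subdifferential_def)
  then show ?thesis
    by blast
qed

text \<open>Testing the subgradient inequality at \<open>x + sgn g\<close> gives norm g \<le> h (x +
  sgn g) - h x, and \<open>h\<close> is bounded on the compact unit neighbourhood of
  \<open>X\<close>.\<close>

lemma subdifferential_norm_bdd_above:
  fixes h :: "'a::euclidean_space \<Rightarrow> real"
  assumes "convex_on UNIV h" and "compact X"
  shows "bdd_above {norm g | g x. x \<in> X \<and> g \<in> subdifferential h x}"
proof -
  have cont: "continuous_on UNIV h"
    using assms(1) by (simp add: convex_on_continuous)
  let ?Y = "{x + y | x y. x \<in> X \<and> y \<in> cball 0 1}"
  have "compact ?Y"
    using assms(2) by (intro compact_sums) auto
  then have "bounded (h ` ?Y)" "bounded (h ` X)"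
    using cont assms(2) by (meson compact_continuous_image compact_imp_bounded continuous_on_subset subset_UNIV)+
  then obtain a b where "\<forall>v\<in>h ` ?Y. norm v \<le> a" and "\<forall>v\<in>h ` X. norm v \<le> b"
    unfolding bounded_iff by blast
  then have a: "norm (h y) \<le> a" if "y \<in> ?Y" for y
    using imageI[OF that, of h] by blast
  have b: "norm (h x) \<le> b" if "x \<in> X" for x
    using \<open>\<forall>v\<in>h ` X. norm v \<le> b\<close> imageI[OF that, of h] by blast
  show ?thesis
  proof (rule bdd_aboveI[where M = "a + b"], clarify)
    fix g x
    assume "x \<in> X" and g: "g \<in> subdifferential h x"
    have "x + sgn g \<in> ?Y"
      using \<open>x \<in> X\<close> by (force simp: norm_sgn)
    moreover have "h (x + sgn g) \<ge> h x + g \<bullet> sgn g"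
      using g unfolding subdifferential_def by (auto dest: spec[of _ "x + sgn g"])
    moreover have "g \<bullet> sgn g = norm g"
      by (cases "g = 0") (simp_all add: sgn_div_norm dot_square_norm power2_eq_square)
    ultimately show "norm g \<le> a + b"
      using a[of "x + sgn g"] b[OF \<open>x \<in> X\<close>] unfolding real_norm_def by linarith
  qed
qed

context
  fixes h :: "'v::finite \<Rightarrow> 'a::euclidean_space \<Rightarrow> real" and X :: "'a set"
  assumes h: "\<And>i. convex_on UNIV (h i)" and X: "compact X"
begin

lemma subgradient_norm_le_bound:
  assumes "x \<in> X" and "g \<in> subdifferential (h i) x"
  shows "norm g \<le> subgradient_bound h X"
proof -
  let ?s = "\<lambda>i. Sup {norm g | g x. x \<in> X \<and> g \<in> subdifferential (h i) x}"
  have "norm g \<le> ?s i"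
    using assms by (intro cSup_upper subdifferential_norm_bdd_above h X) auto
  also have "\<dots> \<le> Max (range ?s)"
    by (intro Max_ge) auto
  finally show ?thesis
    by (simp add: subgradient_bound_def)
qed

lemma diff_le_subgradient_bound:
  assumes "x \<in> X"
  shows "h i x - h i y \<le> subgradient_bound h X * norm (x - y)"
proof -
  obtain g where g: "g \<in> subdifferential (h i) x"
    using convex_subdifferential_nonempty[OF h] by blast
  then have "h i x - h i y \<le> g \<bullet> (x - y)"
    unfolding subdifferential_def by (auto simp: inner_diff_right algebra_simps)
  also have "\<dots> \<le> norm g * norm (x - y)"
    by (rule norm_cauchy_schwarz)
  also have "\<dots> \<le> subgradient_bound h X * norm (x - y)"
    using subgradient_norm_le_bound[OF assms g] by (simp add: mult_right_mono)
  finally show ?thesis .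
qed

lemma subgradient_bound_nonneg:
  assumes "X \<noteq> {}"
  shows "subgradient_bound h X \<ge> 0"
proof -
  obtain x where "x \<in> X"
    using assms by blast
  moreover obtain g where "g \<in> subdifferential (h undefined) x"
    using convex_subdifferential_nonempty[OF h] by blast
  ultimately show ?thesis
    using subgradient_norm_le_bound norm_ge_zero order_trans by blast
qed

end

section \<open>Bregman divergences and the proximal step\<close>

lemma bregman_three_point:
  "(d\<Phi> x - d\<Phi> y) \<bullet> (z - x) = bregman \<Phi> d\<Phi> z y - bregman \<Phi> d\<Phi> z x - bregman \<Phi> d\<Phi> x y"
  by (simp add: bregman_def inner_diff_left inner_diff_right)

lemma bregman_add_swap:
  "bregman \<Phi> d\<Phi> x y + bregman \<Phi> d\<Phi> y x = (d\<Phi> x - d\<Phi> y) \<bullet> (x - y)"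
  by (simp add: bregman_def inner_diff_left inner_diff_right)

locale smooth_mirror_map =
  fixes \<Phi> :: "'a::euclidean_space \<Rightarrow> real" and d\<Phi> :: "'a \<Rightarrow> 'a" and \<sigma> L :: real
  assumes mirror: "mirror_map \<Phi> d\<Phi> \<sigma>"
    and gradient_lipschitz: "norm (d\<Phi> x - d\<Phi> y) \<le> L * norm (x - y)"
begin

abbreviation "D \<equiv> bregman \<Phi> d\<Phi>"

lemma sigma_pos: "\<sigma> > 0"
  using mirror by (simp add: mirror_map_def)

lemma bregman_ge: "D x y \<ge> \<sigma> / 2 * (norm (x - y))\<^sup>2"
  using mirror unfolding mirror_map_def bregman_def by (smt (verit))

lemma bregman_nonneg: "D x y \<ge> 0"
  using bregman_ge[of x y] sigma_pos by (smt (verit) divide_nonneg_nonneg mult_nonneg_nonneg zero_le_power2)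

text \<open>Adding the reverse divergence turns \<open>D\<close> into an inner product with a
  gradient difference. This gives \<open>L\<close> where the sharp constant is \<open>L / 2\<close>;
  the claimed \<open>C6 = N * L * \<nu>\<close> leaves room for it.\<close>

lemma bregman_le: "D x y \<le> L * (norm (x - y))\<^sup>2"
proof -
  have "D x y \<le> (d\<Phi> x - d\<Phi> y) \<bullet> (x - y)"
    using bregman_add_swap[of \<Phi> d\<Phi> x y] bregman_nonneg[of y x] by simp
  also have "\<dots> \<le> norm (d\<Phi> x - d\<Phi> y) * norm (x - y)"
    by (rule norm_cauchy_schwarz)
  also have "\<dots> \<le> L * (norm (x - y))\<^sup>2"
    using mult_right_mono[OF gradient_lipschitz[of x y], of "norm (x - y)"]
    by (simp add: power2_eq_square)
  finally show ?thesis .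
qed

lemma sigma_le_L: "\<sigma> \<le> L"
proof -
  obtain b :: 'a where "b \<in> Basis"
    using nonempty_Basis by blast
  then have b: "norm (b - 0) = 1"
    by simp
  have "(d\<Phi> b - d\<Phi> 0) \<bullet> (b - 0) \<ge> \<sigma>"
    using bregman_ge[of b 0] bregman_ge[of 0 b] b bregman_add_swap[of \<Phi> d\<Phi> b 0] by simp
  moreover have "(d\<Phi> b - d\<Phi> 0) \<bullet> (b - 0) \<le> norm (d\<Phi> b - d\<Phi> 0) * norm (b - 0)"
    by (rule norm_cauchy_schwarz)
  ultimately show ?thesis
    using gradient_lipschitz[of b 0] b by simp
qed

lemma L_pos: "L > 0"
  using sigma_pos sigma_le_L by simp

lemma continuous_gradient: "continuous_on A d\<Phi>"
  using mirror continuous_on_subset unfolding mirror_map_def by blast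

lemma continuous_mirror: "continuous_on A \<Phi>"
proof -
  have "isCont \<Phi> x" for x
    using mirror unfolding mirror_map_def gderiv_def
    using has_derivative_continuous by blast
  then show ?thesis
    by (simp add: continuous_at_imp_continuous_on)
qed

text \<open>First-order optimality along the segment from \<open>u\<close> to \<open>z\<close>:
  compare \<open>u\<close> with the point at fraction \<open>t\<close>, divide by \<open>t\<close>
  and let \<open>t\<close> tend to 0. As \<open>h\<close> need not be differentiable, its increment
  is bounded by the chord; the three-point identity turns the gradient term into
  divergences.\<close>

lemma prox_optimality:
  assumes "convex X" and "convex_on UNIV h" and "\<alpha> > 0"
    and min: "is_arg_min (\<lambda>z. s \<bullet> z + 1 / \<alpha> * D z y + h z) (\<lambda>z. z \<in> X) u"
    and "z \<in> X"
  shows "h u - h z \<le> s \<bullet> (z - u) + 1 / \<alpha> * (D z y - D z u - D u y)"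
proof -
  let ?d = "z - u"
  have "u \<in> X"
    using min by (simp add: is_arg_min_def)
  have step: "0 \<le> s \<bullet> ?d + 1 / \<alpha> * ((d\<Phi> u - d\<Phi> y) \<bullet> ?d + L * t * (norm ?d)\<^sup>2) + (h z - h u)"
    if t: "0 < t" "t \<le> 1" for t :: real
  proof -
    let ?v = "u + t *\<^sub>R ?d"
    have v: "?v = (1 - t) *\<^sub>R u + t *\<^sub>R z"
      by (simp add: algebra_simps)
    have "?v \<in> X"
      unfolding v using t assms(1) \<open>u \<in> X\<close> \<open>z \<in> X\<close> by (intro convexD) auto
    then have 1: "s \<bullet> u + 1 / \<alpha> * D u y + h u \<le> s \<bullet> ?v + 1 / \<alpha> * D ?v y + h ?v"
      using min by (auto simp: is_arg_min_linorder)
    have 2: "h ?v \<le> (1 - t) * h u + t * h z"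
      unfolding v using assms(2) t by (intro convex_onD) auto
    \<comment> \<open>Nonnegativity of \<open>D u ?v\<close> bounds the increment by the gradient at
      \<open>?v\<close>. Moving that gradient back to \<open>u\<close> costs an error of second
      order in \<open>t\<close>, by the Lipschitz bound.\<close>
    have "D ?v y - D u y \<le> t * ((d\<Phi> ?v - d\<Phi> y) \<bullet> ?d)"
      using bregman_nonneg[of u ?v] by (simp add: bregman_def algebra_simps inner_diff_left inner_diff_right)
    also have "(d\<Phi> ?v - d\<Phi> y) \<bullet> ?d \<le> (d\<Phi> u - d\<Phi> y) \<bullet> ?d + L * t * (norm ?d)\<^sup>2"
    proof -
      have "(d\<Phi> ?v - d\<Phi> u) \<bullet> ?d \<le> norm (d\<Phi> ?v - d\<Phi> u) * norm ?d"
        by (rule norm_cauchy_schwarz)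
      also have "\<dots> \<le> L * norm (?v - u) * norm ?d"
        by (intro mult_right_mono gradient_lipschitz) simp
      also have "\<dots> = L * t * (norm ?d)\<^sup>2"
        using t by (simp add: power2_eq_square)
      finally show ?thesis
        by (simp add: inner_diff_left)
    qed
    finally have 3: "D ?v y - D u y \<le> t * ((d\<Phi> u - d\<Phi> y) \<bullet> ?d + L * t * (norm ?d)\<^sup>2)"
      using t by (simp add: mult_left_mono)
    have "0 \<le> t * (s \<bullet> ?d) + 1 / \<alpha> * (D ?v y - D u y) + t * (h z - h u)"
      using 1 2 by (simp add: inner_add_right right_diff_distrib left_diff_distrib)
    also have "\<dots> \<le> t * (s \<bullet> ?d + 1 / \<alpha> * ((d\<Phi> u - d\<Phi> y) \<bullet> ?d + L * t * (norm ?d)\<^sup>2) + (h z - h u))"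
      using mult_left_mono[OF 3, of "1 / \<alpha>"] \<open>\<alpha> > 0\<close> by (simp add: algebra_simps)
    finally show ?thesis
      using t by (simp add: zero_le_mult_iff)
  qed
  have "((\<lambda>t. s \<bullet> ?d + 1 / \<alpha> * ((d\<Phi> u - d\<Phi> y) \<bullet> ?d + L * t * (norm ?d)\<^sup>2) + (h z - h u)) \<longlongrightarrow>
      s \<bullet> ?d + 1 / \<alpha> * ((d\<Phi> u - d\<Phi> y) \<bullet> ?d + L * 0 * (norm ?d)\<^sup>2) + (h z - h u)) (at_right 0)"
    by (intro tendsto_intros)
  moreover have "\<forall>\<^sub>F t in at_right 0. 0 \<le>
      s \<bullet> ?d + 1 / \<alpha> * ((d\<Phi> u - d\<Phi> y) \<bullet> ?d + L * t * (norm ?d)\<^sup>2) + (h z - h u)"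
    using eventually_at_right_real[OF zero_less_one]
    by eventually_elim (rule step; simp)
  ultimately have "0 \<le> s \<bullet> ?d + 1 / \<alpha> * ((d\<Phi> u - d\<Phi> y) \<bullet> ?d + L * 0 * (norm ?d)\<^sup>2) + (h z - h u)"
    by (rule tendsto_lowerbound) simp
  then show ?thesis
    using bregman_three_point[of d\<Phi> u y z \<Phi>] by simp
qed

text \<open>The comparison point is some \<open>p\<close> in \<open>X\<close> rather than
  \<open>y\<close>, which may lie outside \<open>X\<close>. Strong monotonicity of
  \<open>d\<Phi>\<close> between \<open>u\<close> and \<open>p\<close> is played against the
  optimality of \<open>u\<close>; splitting the gradient difference at \<open>y\<close> costs
  \<open>L * norm (y - p)\<close>, and this is where the ratio \<open>L / \<sigma>\<close>
  originates.\<close>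

lemma prox_displacement_le:
  assumes "convex X" and "convex_on UNIV h" and "\<alpha> > 0"
    and "is_arg_min (\<lambda>z. s \<bullet> z + 1 / \<alpha> * D z y + h z) (\<lambda>z. z \<in> X) u"
    and "p \<in> X" and h: "h p - h u \<le> H * norm (p - u)"
  and "H \<ge> 0"
  shows "\<sigma> * norm (u - p) \<le> \<alpha> * (norm s + H) + L * norm (y - p)"
proof (cases "u = p")
  case True
  then show ?thesis
    using \<open>\<alpha> > 0\<close> \<open>H \<ge> 0\<close> L_pos by simp
next
  case False
  have "\<alpha> * (h u - h p) \<le> \<alpha> * (s \<bullet> (p - u)) + (d\<Phi> u - d\<Phi> y) \<bullet> (p - u)"
    using mult_left_mono[OF prox_optimality[OF assms(1-5)], of \<alpha>] \<open>\<alpha> > 0\<close>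
      bregman_three_point[of d\<Phi> u y p \<Phi>] by (simp add: distrib_left)
  then have "(d\<Phi> u - d\<Phi> y) \<bullet> (u - p) \<le> \<alpha> * (s \<bullet> (p - u) + (h p - h u))"
    by (simp add: algebra_simps inner_diff_left inner_diff_right)
  also have "\<dots> \<le> \<alpha> * (norm s * norm (u - p) + H * norm (u - p))"
    using \<open>\<alpha> > 0\<close> norm_cauchy_schwarz[of s "p - u"] h
    by (intro mult_left_mono add_mono) (auto simp: norm_minus_commute)
  finally have "(d\<Phi> u - d\<Phi> y) \<bullet> (u - p) \<le> \<alpha> * (norm s + H) * norm (u - p)"
    by (simp add: algebra_simps)
  moreover have "(d\<Phi> y - d\<Phi> p) \<bullet> (u - p) \<le> L * norm (y - p) * norm (u - p)"
    using norm_cauchy_schwarz mult_right_mono[OF gradient_lipschitz] norm_ge_zero order_trans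
    by metis
  moreover have "\<sigma> * norm (u - p) * norm (u - p) \<le> (d\<Phi> u - d\<Phi> p) \<bullet> (u - p)"
    using bregman_ge[of u p] bregman_ge[of p u] bregman_add_swap[of \<Phi> d\<Phi> u p]
    by (simp add: power2_eq_square norm_minus_commute)
  ultimately have "\<sigma> * norm (u - p) * norm (u - p) \<le>
      (\<alpha> * (norm s + H) + L * norm (y - p)) * norm (u - p)"
    by (simp add: inner_diff_left distrib_right)
  then show ?thesis
    using False by simp
qed

text \<open>Along a segment the gradient is affine, so \<open>\<Phi>\<close> is a quadratic
  polynomial there. Hence \<open>D x y\<close> is half of
  \<open>(d\<Phi> x - d\<Phi> y) \<bullet> (x - y)\<close>, which is symmetric in \<open>x\<close>
  and \<open>y\<close>.\<close>

lemma bregman_commute_of_affine: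
  assumes affine: "\<And>u v s. 0 \<le> s \<Longrightarrow> s \<le> 1 \<Longrightarrow> d\<Phi> (s *\<^sub>R u + (1 - s) *\<^sub>R v) = s *\<^sub>R d\<Phi> u + (1 - s) *\<^sub>R d\<Phi> v"
  shows "D x y = D y x"
proof -
  have half: "D x y = (d\<Phi> x - d\<Phi> y) \<bullet> (x - y) / 2" for x y
  proof -
    let ?d = "x - y" and ?w = "d\<Phi> x - d\<Phi> y"
    let ?k = "\<lambda>s. \<Phi> (y + s *\<^sub>R ?d) - s * (d\<Phi> y \<bullet> ?d) - s\<^sup>2 / 2 * (?w \<bullet> ?d)"
    have deriv: "(?k has_real_derivative 0) (at s within {0..1})" if "s \<in> {0..1}" for s
    proof -
      have "(\<Phi> has_derivative (\<lambda>v. d\<Phi> (y + s *\<^sub>R ?d) \<bullet> v)) (at (y + s *\<^sub>R ?d))"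
        using mirror unfolding mirror_map_def gderiv_def by (auto simp: inner_commute)
      moreover have "((\<lambda>s. y + s *\<^sub>R ?d) has_derivative (\<lambda>h. h *\<^sub>R ?d)) (at s within {0..1})"
        by (auto intro!: derivative_eq_intros)
      ultimately have "((\<lambda>s. \<Phi> (y + s *\<^sub>R ?d)) has_derivative (\<lambda>h. d\<Phi> (y + s *\<^sub>R ?d) \<bullet> (h *\<^sub>R ?d))) (at s within {0..1})"
        by (rule has_derivative_compose[rotated])
      then have "((\<lambda>s. \<Phi> (y + s *\<^sub>R ?d)) has_real_derivative (d\<Phi> (y + s *\<^sub>R ?d) \<bullet> ?d)) (at s within {0..1})"
        by (simp add: has_field_derivative_def mult_commute_abs)
      moreover have "d\<Phi> (y + s *\<^sub>R ?d) \<bullet> ?d = d\<Phi> y \<bullet> ?d + s * (?w \<bullet> ?d)"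
      proof -
        have "y + s *\<^sub>R ?d = s *\<^sub>R x + (1 - s) *\<^sub>R y"
          by (simp add: algebra_simps)
        then have "d\<Phi> (y + s *\<^sub>R ?d) = d\<Phi> y + s *\<^sub>R ?w"
          using affine[of s x y] that by (simp add: algebra_simps)
        then show ?thesis
          by (simp only: inner_add_left inner_scaleR_left)
      qed
      ultimately show ?thesis
        by (auto intro!: derivative_eq_intros)
    qed
    obtain c where c: "\<forall>s\<in>{0..1}. ?k s = c"
      using has_field_derivative_zero_constant[OF convex_real_interval(5) deriv] by blast
    have "?k 1 = ?k 0"
      using c[rule_format, of 0] c[rule_format, of 1] by simp
    then show ?thesis
      by (simp add: bregman_def)
  qed
  show ?thesis
    unfolding half[of x y] half[of y x] by (simp add: inner_diff_left inner_diff_right)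
qed

text \<open>The convexity defect is an affine function of \<open>a\<close> with linear part
  \<open>w\<close>, since the terms \<open>\<Phi> a\<close> cancel. An affine function that is
  nonnegative on the whole space is constant, so \<open>w = 0\<close>.\<close>

lemma gradient_affine_of_convex_bregman:
  assumes "\<And>a. D a (s *\<^sub>R u + (1 - s) *\<^sub>R v) \<le> s * D a u + (1 - s) * D a v"
  shows "d\<Phi> (s *\<^sub>R u + (1 - s) *\<^sub>R v) = s *\<^sub>R d\<Phi> u + (1 - s) *\<^sub>R d\<Phi> v"
proof -
  define m where "m = s *\<^sub>R u + (1 - s) *\<^sub>R v"
  define w where "w = d\<Phi> m - (s *\<^sub>R d\<Phi> u + (1 - s) *\<^sub>R d\<Phi> v)"
  define k where "k a = s * D a u + (1 - s) * D a v - D a m" for a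
  have k: "k a = k 0 + w \<bullet> a" for a
    by (simp add: k_def w_def bregman_def inner_diff_left inner_diff_right inner_add_left algebra_simps)
  have "k a \<ge> 0" for a
    using assms[of a] by (simp add: k_def m_def)
  moreover have "k (- ((k 0 + 1) / (w \<bullet> w)) *\<^sub>R w) = -1" if "w \<noteq> 0"
    using that by (subst k) simp
  ultimately have "w = 0"
    by (metis neg_0_le_iff_le not_one_le_zero)
  then show ?thesis
    by (simp add: w_def m_def)
qed

end

text \<open>The assumed convexity concerns combinations indexed by the agents; placing the points on
  two distinct agents encodes any combination of two points.\<close>

lemma (in smooth_mirror_map) bregman_commute:
  assumes "mirror_map_assumption \<Phi> d\<Phi> L TYPE('v::finite)" and "CARD('v) \<ge> 2"
  shows "D x y = D y x"
proof (rule bregman_commute_of_affine, rule gradient_affine_of_convex_bregman)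
  fix u v a :: 'a and s :: real
  assume s: "0 \<le> s" "s \<le> 1"
  obtain i j :: 'v where "i \<noteq> j"
    using assms(2) card_le_Suc0_iff_eq[of "UNIV :: 'v set"] by auto
  let ?c = "\<lambda>k. if k = i then s else if k = j then 1 - s else 0"
  let ?b = "\<lambda>k. if k = i then u else v"
  have split: "(\<Sum>k\<in>UNIV. if k = i then p else if k = j then q else 0) = p + q"
    for p q :: "'z::comm_monoid_add"
  proof -
    have "(\<Sum>k\<in>UNIV. if k = i then p else if k = j then q else 0) =
        (\<Sum>k\<in>{i, j}. if k = i then p else if k = j then q else 0)"
      by (rule sum.mono_neutral_right) auto
    then show ?thesis
      using \<open>i \<noteq> j\<close> by simp
  qed
  have "(\<forall>k. ?c k \<in> {0..1}) \<and> (\<Sum>k\<in>UNIV. ?c k) = 1"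
    using s by (simp add: split)
  then have "D a (\<Sum>k\<in>UNIV. ?c k *\<^sub>R ?b k) \<le> (\<Sum>k\<in>UNIV. ?c k * D a (?b k))"
    by (rule assms(1)[unfolded mirror_map_assumption_def, THEN conjunct2, rule_format])
  moreover have "(\<Sum>k\<in>UNIV. ?c k *\<^sub>R ?b k) = s *\<^sub>R u + (1 - s) *\<^sub>R v"
    using \<open>i \<noteq> j\<close> by (subst split[symmetric]) (auto intro!: sum.cong)
  moreover have "(\<Sum>k\<in>UNIV. ?c k * D a (?b k)) = s * D a u + (1 - s) * D a v"
    using \<open>i \<noteq> j\<close> by (subst split[symmetric]) (auto intro!: sum.cong)
  ultimately show "D a (s *\<^sub>R u + (1 - s) *\<^sub>R v) \<le> s * D a u + (1 - s) * D a v"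
    by simp
qed

section \<open>Perturbing and averaging the second argument of the divergence\<close>

context smooth_mirror_map
begin

lemma bregman_perturb_le:
  "D a (p + v) \<le> D a p + L * norm v * norm (a - p) + L * (norm v)\<^sup>2"
proof -
  have "D a (p + v) = D a p + D p (p + v) - (d\<Phi> (p + v) - d\<Phi> p) \<bullet> (a - p)"
    by (simp add: bregman_def inner_diff_left inner_diff_right inner_add_right)
  moreover have "- ((d\<Phi> (p + v) - d\<Phi> p) \<bullet> (a - p)) \<le> norm (d\<Phi> (p + v) - d\<Phi> p) * norm (a - p)"
    by (metis norm_cauchy_schwarz inner_minus_left norm_minus_cancel)
  moreover have "norm (d\<Phi> (p + v) - d\<Phi> p) * norm (a - p) \<le> L * norm v * norm (a - p)"
    using gradient_lipschitz[of "p + v" p] by (simp add: mult_right_mono)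
  moreover have "D p (p + v) \<le> L * (norm v)\<^sup>2"
    using bregman_le[of p "p + v"] by simp
  ultimately show ?thesis
    by linarith
qed

text \<open>Cocoercivity: the gradient step of length \<open>1 / L\<close> from \<open>x\<close>
  minimises a quadratic upper bound of \<open>D z y\<close>, and the divergence is still nonnegative
  there. Symmetry enters through the sharp constant \<open>L / 2\<close> in that upper
  bound.\<close>

lemma gradient_cocoercive:
  assumes sym: "\<And>x y. D x y = D y x"
  shows "(norm (d\<Phi> x - d\<Phi> y))\<^sup>2 \<le> 2 * L * D x y"
proof -
  have le: "D x y \<le> L / 2 * (norm (x - y))\<^sup>2" for x y
  proof -
    have "2 * D x y = (d\<Phi> x - d\<Phi> y) \<bullet> (x - y)"
      using bregman_add_swap[of \<Phi> d\<Phi> x y] sym[of x y] by simp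
    also have "\<dots> \<le> norm (d\<Phi> x - d\<Phi> y) * norm (x - y)"
      by (rule norm_cauchy_schwarz)
    also have "\<dots> \<le> L * (norm (x - y))\<^sup>2"
      using mult_right_mono[OF gradient_lipschitz[of x y], of "norm (x - y)"]
      by (simp add: power2_eq_square)
    finally show ?thesis
      by simp
  qed
  define w where "w = d\<Phi> x - d\<Phi> y"
  define z where "z = x - w /\<^sub>R L"
  have "0 \<le> D z y"
    by (rule bregman_nonneg)
  also have "D z y = D z x + D x y + w \<bullet> (z - x)"
    using bregman_three_point[of d\<Phi> x y z \<Phi>] by (simp add: w_def)
  also have "\<dots> \<le> L / 2 * (norm (z - x))\<^sup>2 + D x y + w \<bullet> (z - x)"
    using le[of z x] by simp
  also have "\<dots> = D x y - (norm w)\<^sup>2 / (2 * L)"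
    using L_pos by (simp add: z_def dot_square_norm field_simps power2_eq_square)
  finally show ?thesis
    using L_pos by (simp add: w_def field_simps)
qed

text \<open>Symmetry moves the perturbed point into the first argument, so that the first-order term
  carries the gradient difference between \<open>p\<close> and \<open>a\<close>, independent of
  \<open>v\<close>. Cocoercivity bounds it by \<open>sqrt (2 * L) * R\<close>, against
  \<open>L * sqrt (2 / \<sigma>) * R\<close> from the Lipschitz bound.\<close>

lemma bregman_perturb_le_sqrt:
  assumes sym: "\<And>x y. D x y = D y x" and "D a p \<le> R\<^sup>2" and "R \<ge> 0"
  shows "D a (p + v) \<le> D a p + sqrt (2 * L) * R * norm v + L * (norm v)\<^sup>2"
proof -
  have "D a (p + v) = D p a + D (p + v) p + (d\<Phi> p - d\<Phi> a) \<bullet> v"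
    using bregman_three_point[of d\<Phi> p a "p + v" \<Phi>] sym[of a "p + v"] by simp
  moreover have "D (p + v) p \<le> L * (norm v)\<^sup>2"
    using bregman_le[of "p + v" p] by simp
  moreover have "(d\<Phi> p - d\<Phi> a) \<bullet> v \<le> norm (d\<Phi> p - d\<Phi> a) * norm v"
    by (rule norm_cauchy_schwarz)
  moreover have "norm (d\<Phi> p - d\<Phi> a) \<le> sqrt (2 * L) * R"
  proof (rule power2_le_imp_le)
    have "(norm (d\<Phi> p - d\<Phi> a))\<^sup>2 \<le> 2 * L * D p a"
      by (rule gradient_cocoercive[OF sym])
    also have "\<dots> \<le> 2 * L * R\<^sup>2"
      using assms(2) L_pos sym[of p a] by simp
    also have "\<dots> = (sqrt (2 * L) * R)\<^sup>2"
      using L_pos by (simp add: power_mult_distrib)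
    finally show "(norm (d\<Phi> p - d\<Phi> a))\<^sup>2 \<le> (sqrt (2 * L) * R)\<^sup>2" .
  qed (use assms L_pos in simp)
  ultimately show ?thesis
    using mult_right_mono[of "norm (d\<Phi> p - d\<Phi> a)" "sqrt (2 * L) * R" "norm v"] sym[of a p]
    by (smt (verit) norm_ge_zero)
qed

text \<open>When every \<open>D a (b j)\<close> is expanded around the mean \<open>p\<close>, the
  linear terms cancel in the weighted sum. Beside \<open>D a p\<close> there remains the mean
  divergence from the points to \<open>p\<close>, which is at least \<sigma> / 2 times their
  variance.\<close>

lemma bregman_average_le:
  fixes b :: "'i \<Rightarrow> 'a"
  assumes sym: "\<And>x y. D x y = D y x" and "finite I" and c: "\<And>j. j \<in> I \<Longrightarrow> c j \<ge> 0" "sum c I = 1"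
  defines "p \<equiv> \<Sum>j\<in>I. c j *\<^sub>R b j"
  shows "D a p + \<sigma> / 2 * (\<Sum>j\<in>I. c j * (norm (b j - p))\<^sup>2) \<le> (\<Sum>j\<in>I. c j * D a (b j))"
proof -
  have "D a (b j) = D (b j) p + D a p + (d\<Phi> p - d\<Phi> a) \<bullet> (b j - p)" for j
    using bregman_three_point[of d\<Phi> p a "b j" \<Phi>] sym[of a p] sym[of a "b j"] by simp
  then have "(\<Sum>j\<in>I. c j * D a (b j)) =
      (\<Sum>j\<in>I. c j * D (b j) p) + sum c I * D a p + (d\<Phi> p - d\<Phi> a) \<bullet> (\<Sum>j\<in>I. c j *\<^sub>R (b j - p))"
    by (simp add: distrib_left sum.distrib sum_distrib_right inner_sum_right)
  also have "(\<Sum>j\<in>I. c j *\<^sub>R (b j - p)) = 0"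
    using c(2) by (simp add: scaleR_diff_right sum_subtractf p_def scaleR_sum_left[symmetric])
  finally have "(\<Sum>j\<in>I. c j * D a (b j)) = (\<Sum>j\<in>I. c j * D (b j) p) + D a p"
    using c(2) by simp
  moreover have "(\<Sum>j\<in>I. c j * (\<sigma> / 2 * (norm (b j - p))\<^sup>2)) \<le> (\<Sum>j\<in>I. c j * D (b j) p)"
    using c(1) bregman_ge by (intro sum_mono mult_left_mono)
  ultimately show ?thesis
    by (simp add: sum_distrib_left mult.left_commute)
qed

end

section \<open>Averaging with doubly stochastic matrices\<close>

definition mix :: "real ^ 'v ^ 'v \<Rightarrow> ('v::finite \<Rightarrow> 'a::real_vector) \<Rightarrow> 'v \<Rightarrow> 'a" where
  "mix A x i = (\<Sum>j\<in>UNIV. A $ i $ j *\<^sub>R x j)"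

definition energy :: "('v::finite \<Rightarrow> 'a::real_normed_vector) \<Rightarrow> real" where
  "energy x = (\<Sum>i\<in>UNIV. (norm (x i))\<^sup>2)"

definition average :: "('v::finite \<Rightarrow> 'a::real_vector) \<Rightarrow> 'a" where
  "average x = (1 / real CARD('v)) *\<^sub>R (\<Sum>i\<in>UNIV. x i)"

definition dispersion :: "('v::finite \<Rightarrow> 'a::real_normed_vector) \<Rightarrow> real" where
  "dispersion x = energy (\<lambda>i. x i - average x)"

text \<open>For doubly stochastic \<open>A\<close> this is both the sum of the row variances and the
  loss of dispersion; see \<open>energy_drop_eq\<close> and \<open>dispersion_mix\<close>.\<close>

definition energy_drop :: "real ^ 'v ^ 'v \<Rightarrow> ('v::finite \<Rightarrow> 'a::real_normed_vector) \<Rightarrow> real" where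
  "energy_drop A x = energy x - energy (mix A x)"

lemma mix_add: "mix A (\<lambda>i. x i + y i) = (\<lambda>i. mix A x i + mix A y i)"
  by (simp add: mix_def fun_eq_iff scaleR_add_right sum.distrib)

lemma mix_diff: "mix A (\<lambda>i. x i - y i) = (\<lambda>i. mix A x i - mix A y i)"
  by (simp add: mix_def fun_eq_iff scaleR_diff_right sum_subtractf)

lemma energy_nonneg: "energy x \<ge> 0"
  by (simp add: energy_def sum_nonneg)

lemma dispersion_nonneg: "dispersion x \<ge> 0"
  by (simp add: dispersion_def energy_nonneg)

lemma sqrt_energy: "sqrt (energy x) = L2_set (\<lambda>i. norm (x i)) UNIV"
  by (simp add: energy_def L2_set_def)

lemma sqrt_energy_triangle: "sqrt (energy (\<lambda>i. x i + y i)) \<le> sqrt (energy x) + sqrt (energy y)"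
proof -
  have "L2_set (\<lambda>i. norm (x i + y i)) UNIV \<le> L2_set (\<lambda>i. norm (x i) + norm (y i)) UNIV"
    by (intro L2_set_mono norm_triangle_ineq) auto
  also have "\<dots> \<le> L2_set (\<lambda>i. norm (x i)) UNIV + L2_set (\<lambda>i. norm (y i)) UNIV"
    by (rule L2_set_triangle_ineq)
  finally show ?thesis
    by (simp add: sqrt_energy)
qed

lemma sqrt_energy_le_sum: "sqrt (energy x) \<le> (\<Sum>i\<in>UNIV. norm (x i))"
  unfolding sqrt_energy by (rule L2_set_le_sum) simp

lemma average_add: "average (\<lambda>i. x i + y i) = average x + average y"
  by (simp add: average_def sum.distrib scaleR_add_right)

lemma sum_eq_average: "(\<Sum>i\<in>UNIV. x i) = real CARD('v) *\<^sub>R average (x :: 'v::finite \<Rightarrow> 'a::real_vector)"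
  by (simp add: average_def)

lemma sqrt_dispersion_triangle:
  "sqrt (dispersion (\<lambda>i. x i + y i)) \<le> sqrt (dispersion x) + sqrt (dispersion y)"
  unfolding dispersion_def average_add
  using sqrt_energy_triangle[of "\<lambda>i. x i - average x" "\<lambda>i. y i - average y"]
  by (simp add: algebra_simps)

lemma energy_shift:
  fixes x :: "'v::finite \<Rightarrow> 'a::real_inner"
  shows "energy (\<lambda>i. x i - c) = dispersion x + real CARD('v) * (norm (average x - c))\<^sup>2"
proof -
  have "(norm (x i - c))\<^sup>2 = (norm (x i - average x))\<^sup>2 + 2 * ((x i - average x) \<bullet> (average x - c)) +
      (norm (average x - c))\<^sup>2" for i
    unfolding power2_norm_eq_inner by (simp add: inner_diff_left inner_diff_right inner_commute)
  then have "energy (\<lambda>i. x i - c) = dispersion x +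
      2 * ((\<Sum>i\<in>UNIV. x i - average x) \<bullet> (average x - c)) + real CARD('v) * (norm (average x - c))\<^sup>2"
    by (simp add: energy_def dispersion_def sum.distrib sum_distrib_left inner_sum_left)
  also have "(\<Sum>i\<in>UNIV. x i - average x) = 0"
    by (simp add: sum_subtractf sum_eq_average sum_constant_scaleR)
  finally show ?thesis
    by simp
qed

lemma energy_eq: 
  fixes x :: "'v::finite \<Rightarrow> 'a::real_inner"
  shows "energy x = dispersion x + real CARD('v) * (norm (average x))\<^sup>2"
  using energy_shift[of x 0] by simp

lemma dispersion_le_energy_shift:
  fixes x :: "'v::finite \<Rightarrow> 'a::real_inner"
  shows "dispersion x \<le> energy (\<lambda>i. x i - c)"
  by (simp add: energy_shift)

lemma dispersion_le_energy:
  fixes x :: "'v::finite \<Rightarrow> 'a::real_inner"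
  shows "dispersion x \<le> energy x"
  using dispersion_le_energy_shift[of x 0] by simp

text \<open>The deviation of agent \<open>l\<close> is minus the sum of the other deviations, so by
  Cauchy-Schwarz its square is at most the fraction \<open>(?N - 1) / ?N\<close> of the dispersion.
  Hence the energy about \<open>x l\<close> is at most \<open>?N\<close> times the dispersion, and
  Cauchy-Schwarz over the agents yields the factor \<open>?N\<close>.\<close>

lemma sum_dist_le_dispersion:
  fixes x :: "'v::finite \<Rightarrow> 'a::real_inner"
  shows "(\<Sum>j\<in>UNIV. norm (x l - x j)) \<le> real CARD('v) * sqrt (dispersion x)"
proof -
  let ?N = "real CARD('v)"
  have N: "?N \<ge> 1"
    by (simp add: Suc_leI)
  let ?d = "\<lambda>i. x i - average x"
  have "(\<Sum>i\<in>UNIV. ?d i) = 0"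
    by (simp add: sum_subtractf sum_eq_average sum_constant_scaleR)
  then have l: "?d l = - (\<Sum>i\<in>UNIV - {l}. ?d i)"
    by (simp add: sum_diff1)
  have "norm (?d l) \<le> (\<Sum>i\<in>UNIV - {l}. norm (?d i))"
    unfolding l norm_minus_cancel by (rule norm_sum)
  then have "(norm (?d l))\<^sup>2 \<le> (\<Sum>i\<in>UNIV - {l}. norm (?d i))\<^sup>2"
    by (simp add: power_mono)
  also have "\<dots> \<le> (\<Sum>i\<in>UNIV - {l}. (norm (?d i))\<^sup>2) * real (card (UNIV - {l}))"
    by (rule sum_squared_le_sum_of_squares)
  also have "\<dots> = (?N - 1) * (dispersion x - (norm (?d l))\<^sup>2)"
    using N by (simp add: mult.commute dispersion_def energy_def sum_diff1 card_Diff_singleton)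
  finally have "?N * (norm (?d l))\<^sup>2 \<le> (?N - 1) * dispersion x"
    by (simp add: algebra_simps)
  then have "energy (\<lambda>i. x i - x l) \<le> ?N * dispersion x"
    unfolding energy_shift by (simp add: algebra_simps norm_minus_commute)
  then have "?N * energy (\<lambda>i. x i - x l) \<le> ?N * (?N * dispersion x)"
    using N by (intro mult_left_mono) auto
  moreover have "(\<Sum>j\<in>UNIV. norm (x l - x j))\<^sup>2 \<le> ?N * energy (\<lambda>i. x i - x l)"
    using sum_squared_le_sum_of_squares[of "\<lambda>j. norm (x l - x j)" UNIV]
    by (simp add: energy_def norm_minus_commute mult.commute)
  ultimately have "(\<Sum>j\<in>UNIV. norm (x l - x j))\<^sup>2 \<le> ?N * (?N * dispersion x)"
    by linarith
  also have "\<dots> = (?N * sqrt (dispersion x))\<^sup>2"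
    by (simp add: power_mult_distrib dispersion_nonneg) (simp add: power2_eq_square)
  finally show ?thesis
    by (rule power2_le_imp_le) (simp add: dispersion_nonneg)
qed

context
  fixes A :: "real ^ 'v ^ 'v"
  assumes A: "doubly_stochastic A"
begin

lemma doubly_stochasticD:
  "A $ i $ j \<ge> 0" "(\<Sum>j\<in>UNIV. A $ i $ j) = 1" "(\<Sum>i\<in>UNIV. A $ i $ j) = 1"
  using A by (auto simp: doubly_stochastic_def)

lemma average_mix: "average (mix A x) = average x"
proof -
  have "(\<Sum>i\<in>UNIV. mix A x i) = (\<Sum>j\<in>UNIV. (\<Sum>i\<in>UNIV. A $ i $ j) *\<^sub>R x j)"
    unfolding mix_def scaleR_sum_left by (rule sum.swap)
  then show ?thesis
    by (simp add: average_def doubly_stochasticD)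
qed

lemma mix_const: "mix A (\<lambda>_. c) i = c"
  by (simp add: mix_def scaleR_sum_left[symmetric] doubly_stochasticD)

lemma sum_mix_rows: "(\<Sum>i\<in>UNIV. \<Sum>j\<in>UNIV. A $ i $ j * u j) = (\<Sum>j\<in>UNIV. u j)"
proof -
  have "(\<Sum>i\<in>UNIV. \<Sum>j\<in>UNIV. A $ i $ j * u j) = (\<Sum>j\<in>UNIV. (\<Sum>i\<in>UNIV. A $ i $ j) * u j)"
    unfolding sum_distrib_right by (rule sum.swap)
  then show ?thesis
    by (simp add: doubly_stochasticD)
qed

lemma row_variance:
  fixes x :: "'v \<Rightarrow> 'a::real_inner"
  shows "(\<Sum>j\<in>UNIV. A $ i $ j * (norm (x j - mix A x i))\<^sup>2) =
    (\<Sum>j\<in>UNIV. A $ i $ j * (norm (x j))\<^sup>2) - (norm (mix A x i))\<^sup>2"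
proof -
  let ?p = "mix A x i"
  have "(\<Sum>j\<in>UNIV. A $ i $ j * (norm (x j - ?p))\<^sup>2) =
      (\<Sum>j\<in>UNIV. A $ i $ j * (norm (x j))\<^sup>2 - 2 * ((A $ i $ j *\<^sub>R x j) \<bullet> ?p) + A $ i $ j * (norm ?p)\<^sup>2)"
    unfolding power2_norm_eq_inner
    by (intro sum.cong) (auto simp: inner_diff_left inner_diff_right inner_commute algebra_simps)
  also have "\<dots> = (\<Sum>j\<in>UNIV. A $ i $ j * (norm (x j))\<^sup>2) - 2 * (?p \<bullet> ?p) + (norm ?p)\<^sup>2"
    by (simp add: sum.distrib sum_subtractf sum_distrib_left[symmetric] sum_distrib_right[symmetric]
        inner_sum_left[symmetric] doubly_stochasticD)
      (simp add: mix_def inner_sum_left sum_distrib_left)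
  finally show ?thesis
    by (simp add: power2_norm_eq_inner)
qed

lemma energy_drop_eq:
  fixes x :: "'v \<Rightarrow> 'a::real_inner"
  shows "energy_drop A x = (\<Sum>i\<in>UNIV. \<Sum>j\<in>UNIV. A $ i $ j * (norm (x j - mix A x i))\<^sup>2)"
  unfolding row_variance sum_subtractf sum_mix_rows by (simp add: energy_drop_def energy_def)

lemma energy_drop_nonneg: "energy_drop A (x :: 'v \<Rightarrow> 'a::real_inner) \<ge> 0"
  unfolding energy_drop_eq by (intro sum_nonneg mult_nonneg_nonneg doubly_stochasticD) auto

lemma energy_mix_le: "energy (mix A x) \<le> energy (x :: 'v \<Rightarrow> 'a::real_inner)"
  using energy_drop_nonneg[of x] by (simp add: energy_drop_def)

text \<open>As a sum of row variances the drop is a nonnegative quadratic form, so the parallelogram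
  inequality applies term by term.\<close>

lemma energy_drop_add_le:
  fixes x y :: "'v \<Rightarrow> 'a::real_inner"
  shows "energy_drop A (\<lambda>i. x i + y i) \<le> 2 * energy_drop A x + 2 * energy_drop A y"
proof -
  have par: "(norm (a + b))\<^sup>2 \<le> 2 * (norm a)\<^sup>2 + 2 * (norm b)\<^sup>2" for a b :: 'a
    using zero_le_power2[of "norm (a - b)"]
    unfolding power2_norm_eq_inner by (simp add: inner_diff_left inner_diff_right inner_add_left inner_add_right inner_commute)
  have "A $ i $ j * (norm (x j + y j - mix A (\<lambda>i. x i + y i) i))\<^sup>2 \<le>
      2 * (A $ i $ j * (norm (x j - mix A x i))\<^sup>2) + 2 * (A $ i $ j * (norm (y j - mix A y i))\<^sup>2)" for i j
    using mult_left_mono[OF par[of "x j - mix A x i" "y j - mix A y i"], of "A $ i $ j"]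
    by (simp add: doubly_stochasticD mix_add algebra_simps)
  then show ?thesis
    unfolding energy_drop_eq sum_distrib_left sum.distrib[symmetric] by (intro sum_mono)
qed

lemma dispersion_mix:
  fixes x :: "'v \<Rightarrow> 'a::real_inner"
  shows "dispersion (mix A x) = dispersion x - energy_drop A x"
  using energy_eq[of x] energy_eq[of "mix A x"] by (simp add: energy_drop_def average_mix)

end

section \<open>Cuts of the network and the loss of variance\<close>

lemma sum_squares_le_square_sum:
  fixes g :: "'i \<Rightarrow> real"
  assumes "finite I" and "\<And>i. i \<in> I \<Longrightarrow> g i \<ge> 0"
  shows "(\<Sum>i\<in>I. (g i)\<^sup>2) \<le> (\<Sum>i\<in>I. g i)\<^sup>2"
proof -
  have "(g i)\<^sup>2 \<le> g i * sum g I" if "i \<in> I" for i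
    using member_le_sum[OF that, of g] assms that by (simp add: power2_eq_square mult_left_mono)
  then have "(\<Sum>i\<in>I. (g i)\<^sup>2) \<le> (\<Sum>i\<in>I. g i * sum g I)"
    by (rule sum_mono)
  then show ?thesis
    by (simp add: sum_distrib_right power2_eq_square)
qed

definition weighted_network :: "real ^ 'v ^ 'v \<Rightarrow> real \<Rightarrow> bool" where
  "weighted_network A \<theta> \<longleftrightarrow> doubly_stochastic A \<and> 0 < \<theta> \<and> (\<forall>i. A $ i $ i \<ge> \<theta>) \<and>
     (\<forall>i j. (j, i) \<in> edges A \<longrightarrow> A $ i $ j \<ge> \<theta>)"

definition crossed :: "real ^ 'v ^ 'v \<Rightarrow> 'v set \<Rightarrow> bool" where
  "crossed A S \<longleftrightarrow> (\<exists>p q. (p, q) \<in> edges A \<and> (p \<in> S) \<noteq> (q \<in> S))"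

context
  fixes A :: "real ^ 'v ^ 'v" and \<theta> :: real
  assumes net: "weighted_network A \<theta>"
begin

lemma network_doubly_stochastic: "doubly_stochastic A"
  using net by (simp add: weighted_network_def)

text \<open>The endpoint \<open>p\<close> of a crossing edge puts weight at least \<theta> on both
  sides of the cut: on its own side by its self-weight, on the other by the edge. Two such weights
  with sum 1 have product at least \<theta> / 2, because the larger one is at least 1 / 2.\<close>

lemma crossed_row:
  assumes "crossed A S"
  shows "\<exists>l. (\<Sum>j\<in>S. A $ l $ j) * (\<Sum>j\<in>- S. A $ l $ j) \<ge> \<theta> / 2"
proof -
  obtain p q where pq: "(p, q) \<in> edges A" "(p \<in> S) \<noteq> (q \<in> S)"
    using assms by (auto simp: crossed_def)
  have "A $ q $ p \<ge> \<theta>" "\<theta> > 0"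
    using net pq(1) by (auto simp: weighted_network_def)
  \<comment> \<open>The network assumption bounds the transposed entry, so every edge also exists in
    reverse.\<close>
  then have "(q, p) \<in> edges A"
    by (simp add: edges_def)
  then have pos: "A $ p $ q \<ge> \<theta>" "A $ p $ p \<ge> \<theta>"
    using net by (auto simp: weighted_network_def)
  let ?a = "\<Sum>j\<in>S. A $ p $ j" and ?b = "\<Sum>j\<in>- S. A $ p $ j"
  have ge: "A $ p $ j \<le> (\<Sum>j\<in>U. A $ p $ j)" if "j \<in> U" for j U
    using doubly_stochasticD(1)[OF network_doubly_stochastic] that by (intro member_le_sum) auto
  have "?a \<ge> \<theta>" "?b \<ge> \<theta>"
    using ge[of p S] ge[of q S] ge[of p "- S"] ge[of q "- S"] pos pq(2) by (cases "p \<in> S"; force)+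
  moreover have "?a + ?b = 1"
    using sum.subset_diff[of S UNIV "\<lambda>j. A $ p $ j"] doubly_stochasticD(2)[OF network_doubly_stochastic, of p]
    by (simp add: Compl_eq_Diff_UNIV)
  moreover have "\<theta> / 2 \<le> a * b" if "a \<ge> \<theta>" "b \<ge> \<theta>" "a + b = 1" for a b :: real
  proof (cases "a \<ge> 1 / 2")
    case True
    then have "1 / 2 * \<theta> \<le> a * b"
      using that \<open>\<theta> > 0\<close> by (intro mult_mono) auto
    then show ?thesis by simp
  next
    case False
    then have "\<theta> * (1 / 2) \<le> a * b"
      using that \<open>\<theta> > 0\<close> by (intro mult_mono) auto
    then show ?thesis by simp
  qed
  ultimately show ?thesis
    by blast
qed

lemma energy_drop_pairs:
  fixes u :: "'v \<Rightarrow> real"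
  shows "energy_drop A u = (\<Sum>l\<in>UNIV. \<Sum>j\<in>UNIV. \<Sum>k\<in>UNIV. A $ l $ j * A $ l $ k * (u j - u k)\<^sup>2) / 2"
proof -
  have "(\<Sum>j\<in>UNIV. \<Sum>k\<in>UNIV. A $ l $ j * A $ l $ k * (u j - u k)\<^sup>2) =
      2 * ((\<Sum>j\<in>UNIV. A $ l $ j * (u j)\<^sup>2) - (mix A u l)\<^sup>2)" for l
  proof -
    have "(\<Sum>j\<in>UNIV. \<Sum>k\<in>UNIV. A $ l $ j * A $ l $ k * (u j - u k)\<^sup>2) =
        (\<Sum>j\<in>UNIV. \<Sum>k\<in>UNIV. (A $ l $ j * (u j)\<^sup>2) * A $ l $ k + A $ l $ j * (A $ l $ k * (u k)\<^sup>2)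
          - 2 * ((A $ l $ j * u j) * (A $ l $ k * u k)))"
      by (intro sum.cong refl) (simp add: power2_eq_square algebra_simps)
    also have "\<dots> = (\<Sum>j\<in>UNIV. A $ l $ j * (u j)\<^sup>2) + (\<Sum>k\<in>UNIV. A $ l $ k * (u k)\<^sup>2)
          - 2 * ((\<Sum>j\<in>UNIV. A $ l $ j * u j) * (\<Sum>k\<in>UNIV. A $ l $ k * u k))"
      by (simp add: sum.distrib sum_subtractf sum_distrib_left[symmetric] sum_distrib_right[symmetric]
          doubly_stochasticD[OF network_doubly_stochastic])
    finally show ?thesis
      by (simp add: mix_def power2_eq_square)
  qed
  then show ?thesis
    by (simp add: sum_distrib_left[symmetric] sum_subtractf sum_mix_rows[OF network_doubly_stochastic] energy_drop_def energy_def)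
qed

text \<open>By \<open>energy_drop_pairs\<close> the drop is half a weighted sum of squared
  differences over ordered pairs. By \<open>sep\<close> each squared difference pays for all cuts
  that separate its pair; after exchanging the sums, every cut \<open>d\<close> collects
  \<open>(gap d)\<^sup>2\<close> times a total pair weight of at least \<theta>.\<close>

lemma energy_drop_ge_cuts:
  fixes u :: "'v \<Rightarrow> real" and gap :: "'d \<Rightarrow> real"
  assumes "finite K" and cross: "\<And>d. d \<in> K \<Longrightarrow> crossed A (S d)"
    and sep: "\<And>j k. (\<Sum>d\<in>{d \<in> K. (j \<in> S d) \<noteq> (k \<in> S d)}. (gap d)\<^sup>2) \<le> (u j - u k)\<^sup>2"
  shows "\<theta> / 2 * (\<Sum>d\<in>K. (gap d)\<^sup>2) \<le> energy_drop A u"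
proof -
  let ?w = "\<lambda>l j k. A $ l $ j * A $ l $ k"
  have w: "?w l j k \<ge> 0" for l j k
    using doubly_stochasticD(1)[OF network_doubly_stochastic] by simp
  have cut: "\<theta> \<le> (\<Sum>l\<in>UNIV. \<Sum>j\<in>UNIV. \<Sum>k\<in>UNIV. if (j \<in> S d) \<noteq> (k \<in> S d) then ?w l j k else 0)"
    if d: "d \<in> K" for d
  proof -
    \<comment> \<open>A separated pair counts in both orders; this factor 2 compensates the 1 / 2 of
      \<open>crossed_row\<close>.\<close>
    have row: "(\<Sum>j\<in>UNIV. \<Sum>k\<in>UNIV. if (j \<in> S d) \<noteq> (k \<in> S d) then ?w l j k else 0) =
        2 * ((\<Sum>j\<in>S d. A $ l $ j) * (\<Sum>j\<in>- S d. A $ l $ j))" for l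
    proof -
      have "(\<Sum>k\<in>UNIV. if (j \<in> S d) \<noteq> (k \<in> S d) then ?w l j k else 0) =
          (if j \<in> S d then A $ l $ j * (\<Sum>k\<in>- S d. A $ l $ k) else A $ l $ j * (\<Sum>k\<in>S d. A $ l $ k))" for j
      proof -
        have "(\<Sum>k\<in>UNIV. if (j \<in> S d) \<noteq> (k \<in> S d) then ?w l j k else 0) =
            (\<Sum>k\<in>{k. (j \<in> S d) \<noteq> (k \<in> S d)}. ?w l j k)"
          by (simp add: sum.inter_filter[symmetric])
        also have "{k. (j \<in> S d) \<noteq> (k \<in> S d)} = (if j \<in> S d then - S d else S d)"
          by auto
        finally show ?thesis
          by (simp add: sum_distrib_left)
      qed
      then have "(\<Sum>j\<in>UNIV. \<Sum>k\<in>UNIV. if (j \<in> S d) \<noteq> (k \<in> S d) then ?w l j k else 0) =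
          (\<Sum>j\<in>S d. A $ l $ j * (\<Sum>k\<in>- S d. A $ l $ k)) + (\<Sum>j\<in>- S d. A $ l $ j * (\<Sum>k\<in>S d. A $ l $ k))"
        by (simp add: sum.If_cases Compl_eq)
      then show ?thesis
        by (simp add: sum_distrib_right[symmetric] mult.commute)
    qed
    obtain l where "\<theta> / 2 \<le> (\<Sum>j\<in>S d. A $ l $ j) * (\<Sum>j\<in>- S d. A $ l $ j)"
      using crossed_row[OF cross[OF d]] by blast
    then have "\<theta> \<le> (\<Sum>j\<in>UNIV. \<Sum>k\<in>UNIV. if (j \<in> S d) \<noteq> (k \<in> S d) then ?w l j k else 0)"
      unfolding row by simp
    also have "\<dots> \<le> (\<Sum>l\<in>UNIV. \<Sum>j\<in>UNIV. \<Sum>k\<in>UNIV. if (j \<in> S d) \<noteq> (k \<in> S d) then ?w l j k else 0)"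
      using w by (intro member_le_sum[where f = "\<lambda>l. \<Sum>j\<in>UNIV. \<Sum>k\<in>UNIV. if (j \<in> S d) \<noteq> (k \<in> S d) then ?w l j k else 0"]) (auto intro!: sum_nonneg)
    finally show ?thesis .
  qed
  have "\<theta> * (\<Sum>d\<in>K. (gap d)\<^sup>2) = (\<Sum>d\<in>K. (gap d)\<^sup>2 * \<theta>)"
    by (simp add: sum_distrib_left mult.commute)
  also have "\<dots> \<le> (\<Sum>d\<in>K. (gap d)\<^sup>2 *
      (\<Sum>l\<in>UNIV. \<Sum>j\<in>UNIV. \<Sum>k\<in>UNIV. if (j \<in> S d) \<noteq> (k \<in> S d) then ?w l j k else 0))"
    by (intro sum_mono mult_left_mono cut) auto
  also have "\<dots> = (\<Sum>l\<in>UNIV. \<Sum>j\<in>UNIV. \<Sum>k\<in>UNIV. \<Sum>d\<in>K. (gap d)\<^sup>2 *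
      (if (j \<in> S d) \<noteq> (k \<in> S d) then ?w l j k else 0))"
    unfolding sum_distrib_left
    by (subst sum.swap, rule sum.cong[OF refl], subst sum.swap, rule sum.cong[OF refl], rule sum.swap)
  also have "\<dots> = (\<Sum>l\<in>UNIV. \<Sum>j\<in>UNIV. \<Sum>k\<in>UNIV. ?w l j k *
      (\<Sum>d\<in>{d \<in> K. (j \<in> S d) \<noteq> (k \<in> S d)}. (gap d)\<^sup>2))"
    unfolding sum.inter_filter[OF \<open>finite K\<close>] sum_distrib_left
    by (intro sum.cong refl) (simp add: mult.commute)
  also have "\<dots> \<le> (\<Sum>l\<in>UNIV. \<Sum>j\<in>UNIV. \<Sum>k\<in>UNIV. ?w l j k * (u j - u k)\<^sup>2)"
    by (intro sum_mono mult_left_mono sep w)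
  finally show ?thesis
    unfolding energy_drop_pairs by simp
qed

text \<open>Without a crossing edge, all weights between \<open>S\<close> and its complement vanish,
  so every agent averages values of its own side only.\<close>

lemma mix_preserves_bounds:
  fixes u :: "'v \<Rightarrow> real"
  assumes "\<not> crossed A S" and low: "\<And>i. i \<in> S \<Longrightarrow> u i \<le> a" and high: "\<And>i. i \<notin> S \<Longrightarrow> u i \<ge> b"
  shows "i \<in> S \<Longrightarrow> mix A u i \<le> a" and "i \<notin> S \<Longrightarrow> mix A u i \<ge> b"
proof -
  have zero: "A $ i $ j = 0" if "(i \<in> S) \<noteq> (j \<in> S)" for i j
    using assms(1) that doubly_stochasticD(1)[OF network_doubly_stochastic, of i j] unfolding crossed_def edges_def
    by (force simp: less_le)
  have const: "(\<Sum>j\<in>UNIV. A $ i $ j * c) = c" for i c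
    by (simp add: sum_distrib_right[symmetric] doubly_stochasticD[OF network_doubly_stochastic])
  show "mix A u i \<le> a" if "i \<in> S"
  proof -
    have "A $ i $ j * u j \<le> A $ i $ j * a" for j
      using low[of j] zero[of i j] that doubly_stochasticD(1)[OF network_doubly_stochastic, of i j]
      by (cases "j \<in> S") (auto simp: mult_left_mono)
    then have "(\<Sum>j\<in>UNIV. A $ i $ j * u j) \<le> (\<Sum>j\<in>UNIV. A $ i $ j * a)"
      by (rule sum_mono)
    then show ?thesis
      by (simp add: const mix_def)
  qed
  show "mix A u i \<ge> b" if "i \<notin> S"
  proof -
    have "A $ i $ j * b \<le> A $ i $ j * u j" for j
      using high[of j] zero[of i j] that doubly_stochasticD(1)[OF network_doubly_stochastic, of i j]
      by (cases "j \<in> S") (auto simp: mult_left_mono)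
    then have "(\<Sum>j\<in>UNIV. A $ i $ j * b) \<le> (\<Sum>j\<in>UNIV. A $ i $ j * u j)"
      by (rule sum_mono)
    then show ?thesis
      by (simp add: const mix_def)
  qed
qed

end

text \<open>Noiseless averaging started from \<open>x\<close> at time \<open>b\<close>: the
  reference process with which the true iterates are compared.\<close>

primrec consensus :: "(nat \<Rightarrow> real ^ 'v ^ 'v) \<Rightarrow> nat \<Rightarrow> ('v::finite \<Rightarrow> 'a::real_vector) \<Rightarrow> nat \<Rightarrow> 'v \<Rightarrow> 'a" where
  "consensus P b x 0 = x"
| "consensus P b x (Suc k) = mix (P (b + k)) (consensus P b x k)"

lemma strongly_connected_crossed:
  assumes "strongly_connected_graph (\<Union>t\<in>I. edges (P t))" and "p \<in> S" "q \<notin> S"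
  shows "\<exists>t\<in>I. crossed (P t) S"
proof (rule ccontr)
  assume no: "\<not> ?thesis"
  have "(p, q) \<in> (\<Union>t\<in>I. edges (P t))\<^sup>*"
    using assms(1) by (simp add: strongly_connected_graph_def)
  then have "q \<in> S"
    using assms(2) no by (induction rule: rtrancl_induct) (auto simp: crossed_def)
  then show False
    using assms(3) by simp
qed

context
  fixes P :: "nat \<Rightarrow> real ^ 'v ^ 'v" and \<theta> :: real
  assumes net: "\<And>t. weighted_network (P t) \<theta>"
begin

text \<open>Sort the values of \<open>x\<close>. The level cut between two consecutive values keeps both sides apart until
  the first time an edge crosses it, and at that time the squared gap is lost up to the factor \<open>\<theta>/2\<close>.\<close>

lemma real_dispersion_contraction:
  fixes x :: "'v \<Rightarrow> real"
  assumes conn: "strongly_connected_graph (\<Union>t\<in>{b..<b + B}. edges (P t))"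
  shows "2 * \<theta> / (real CARD('v))\<^sup>2 * dispersion x \<le> (\<Sum>k<B. energy_drop (P (b + k)) (consensus P b x k))"
proof -
  let ?N = "real CARD('v)"
  have N: "?N \<ge> 1"
    by (simp add: Suc_leI)
  have \<theta>: "\<theta> > 0"
    using net by (simp add: weighted_network_def)
  define xs where "xs = sorted_list_of_set (range x)"
  define z where "z d = xs ! d" for d
  define m where "m = length xs - 1"
  have set_xs: "set xs = range x" and sorted: "sorted xs" and strict: "sorted_wrt (<) xs"
    by (auto simp: xs_def)
  have len: "length xs = card (range x)"
    by (simp add: xs_def)
  then have "length xs > 0"
    by (simp add: card_gt_0_iff)
  have len_N: "length xs \<le> CARD('v)"
    unfolding len by (rule card_image_le) simp
  have z_mono: "z d \<le> z e" if "d \<le> e" "e \<le> m" for d e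
    using sorted_nth_mono[OF sorted, of d e] that \<open>length xs > 0\<close> unfolding z_def m_def by linarith
  have z_less: "z d < z (Suc d)" if "d < m" for d
    using sorted_wrt_nth_less[OF strict, of d "Suc d"] that by (simp add: z_def m_def)
  have z_in: "\<exists>i. x i = z d" if "d \<le> m" for d
  proof -
    have "z d \<in> set xs"
      using that \<open>length xs > 0\<close> unfolding z_def m_def by (intro nth_mem) linarith
    then show ?thesis
      by (auto simp: set_xs)
  qed
  have x_in: "\<exists>e\<le>m. x i = z e" for i
  proof -
    have "x i \<in> set xs"
      by (simp add: set_xs)
    then obtain e where "e < length xs" "xs ! e = x i"
      by (auto simp: in_set_conv_nth)
    then show ?thesis
      by (intro exI[of _ e]) (simp add: z_def m_def)
  qed
  define S where "S d = {i. x i \<le> z d}" for d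
  define gap where "gap d = z (Suc d) - z d" for d
  have gap: "gap d \<ge> 0" if "d < m" for d
    using z_less[OF that] by (simp add: gap_def)
  have notS: "x i \<ge> z (Suc d)" if "d < m" "i \<notin> S d" for i d
  proof -
    obtain e where e: "e \<le> m" "x i = z e"
      using x_in by blast
    then have "\<not> e \<le> d"
      using that z_mono[of e d] by (auto simp: S_def)
    then show ?thesis
      using e z_mono[of "Suc d" e] by simp
  qed
  have ex: "\<exists>k<B. crossed (P (b + k)) (S d)" if "d < m" for d
  proof -
    have "d \<le> m" "Suc d \<le> m"
      using that by auto
    then obtain i j where "x i = z d" "x j = z (Suc d)"
      using z_in by blast
    then have "i \<in> S d" "j \<notin> S d"
      using z_less[OF that] by (auto simp: S_def)
    then obtain t where "t \<in> {b..<b + B}" "crossed (P t) (S d)"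
      using strongly_connected_crossed[OF conn] by blast
    then show ?thesis
      by (intro exI[of _ "t - b"]) auto
  qed
  define first where "first d = (LEAST k. crossed (P (b + k)) (S d))" for d
  have first: "first d < B" "crossed (P (b + first d)) (S d)" if "d < m" for d
    using ex[OF that] LeastI[of "\<lambda>k. crossed (P (b + k)) (S d)"] Least_le[of "\<lambda>k. crossed (P (b + k)) (S d)"]
    unfolding first_def by (meson le_less_trans)+
  have bounds: "(i \<in> S d \<longrightarrow> consensus P b x k i \<le> z d) \<and> (i \<notin> S d \<longrightarrow> consensus P b x k i \<ge> z (Suc d))"
    if "d < m" "k \<le> first d" for d k i
    using that(2)
  proof (induction k arbitrary: i)
    case 0
    then show ?case
      using notS[OF that(1)] by (auto simp: S_def)
  next
    case (Suc k)
    have "\<not> crossed (P (b + k)) (S d)"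
      using Suc.prems not_less_Least unfolding first_def by (metis Suc_le_lessD)
    then show ?case
      using mix_preserves_bounds[OF net, of "b + k" "S d" "consensus P b x k" "z d" "z (Suc d)"] Suc
      by auto
  qed
  \<comment> \<open>At time \<open>k\<close> only those cuts are charged that are crossed for the
    first time; for them the original level bounds still hold just before the mixing.\<close>
  have step: "\<theta> / 2 * (\<Sum>d\<in>{d \<in> {..<m}. first d = k}. (gap d)\<^sup>2) \<le> energy_drop (P (b + k)) (consensus P b x k)" for k
  proof (rule energy_drop_ge_cuts[OF net])
    let ?K = "{d \<in> {..<m}. first d = k}" and ?u = "consensus P b x k"
    show "finite ?K"
      by simp
    show "crossed (P (b + k)) (S d)" if "d \<in> ?K" for d
      using first that by auto
    have le: "(\<Sum>d\<in>{d \<in> ?K. i \<in> S d \<and> j \<notin> S d}. (gap d)\<^sup>2) \<le> (?u i - ?u j)\<^sup>2" for i j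
    proof (cases "{d \<in> ?K. i \<in> S d \<and> j \<notin> S d} = {}")
      case True
      then show ?thesis
        by (simp only: sum.empty zero_le_power2)
    next
      case False
      let ?E = "{d \<in> ?K. i \<in> S d \<and> j \<notin> S d}"
      define a e where "a = Min ?E" and "e = Max ?E"
      have fin: "finite ?E"
        by simp
      have a: "a \<in> ?E" and e: "e \<in> ?E"
        unfolding a_def e_def using Min_in[OF fin False] Max_in[OF fin False] by blast+
      \<comment> \<open>All cuts between \<open>i\<close> and \<open>j\<close> lie between the
        lowest \<open>a\<close> and the highest \<open>e\<close>. Agent \<open>i\<close> is still at
        most \<open>z a\<close> and agent \<open>j\<close> at least \<open>z (Suc e)\<close>, so
        their distance covers every gap in between.\<close>
      have sub: "?E \<subseteq> {a..<Suc e}"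
        unfolding a_def e_def using Min_le[OF fin] Max_ge[OF fin] by (auto simp: less_Suc_eq_le)
      have "a \<le> e"
        unfolding a_def using Min_le[OF fin e] .
      have "e < m"
        using e by simp
      have "sum gap ?E \<le> sum gap {a..<Suc e}"
        using sub gap \<open>e < m\<close> by (intro sum_mono2) auto
      also have "\<dots> = z (Suc e) - z a"
        unfolding gap_def using \<open>a \<le> e\<close> by (subst sum_Suc_diff') auto
      also have "\<dots> \<le> ?u j - ?u i"
        using bounds[of a k i] bounds[of e k j] a e by auto
      finally have "sum gap ?E \<le> ?u j - ?u i" .
      moreover have "sum gap ?E \<ge> 0"
        using gap by (intro sum_nonneg) auto
      ultimately have "(sum gap ?E)\<^sup>2 \<le> (?u j - ?u i)\<^sup>2"
        by (intro power_mono)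
      moreover have "(\<Sum>d\<in>?E. (gap d)\<^sup>2) \<le> (sum gap ?E)\<^sup>2"
        using gap by (intro sum_squares_le_square_sum) auto
      ultimately show ?thesis
        by (simp add: power2_commute)
    qed
    show "(\<Sum>d\<in>{d \<in> ?K. (i \<in> S d) \<noteq> (j \<in> S d)}. (gap d)\<^sup>2) \<le> (?u i - ?u j)\<^sup>2" for i j
    proof (cases "x i \<le> x j")
      case True
      then have "{d \<in> ?K. (i \<in> S d) \<noteq> (j \<in> S d)} = {d \<in> ?K. i \<in> S d \<and> j \<notin> S d}"
        by (auto simp: S_def)
      then show ?thesis
        using le[of i j] by simp
    next
      case False
      then have "{d \<in> ?K. (i \<in> S d) \<noteq> (j \<in> S d)} = {d \<in> ?K. j \<in> S d \<and> i \<notin> S d}"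
        by (auto simp: S_def)
      then show ?thesis
        using le[of j i] by (simp add: power2_commute)
    qed
  qed
  have "(\<Sum>d<m. (gap d)\<^sup>2) = (\<Sum>k<B. \<Sum>d\<in>{d \<in> {..<m}. first d = k}. (gap d)\<^sup>2)"
    using first by (intro sum.group[symmetric]) auto
  then have drops: "\<theta> / 2 * (\<Sum>d<m. (gap d)\<^sup>2) \<le> (\<Sum>k<B. energy_drop (P (b + k)) (consensus P b x k))"
    using step by (simp add: sum_distrib_left sum_mono)
  define R where "R = z m - z 0"
  have "sum gap {..<m} = R"
    unfolding gap_def R_def by (rule sum_lessThan_telescope)
  then have "R\<^sup>2 \<le> (\<Sum>d<m. (gap d)\<^sup>2) * real m"
    using sum_squared_le_sum_of_squares[of gap "{..<m}"] by simp
  also have "\<dots> \<le> (\<Sum>d<m. (gap d)\<^sup>2) * ?N"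
    using len_N by (intro mult_left_mono) (auto simp: m_def intro: sum_nonneg)
  finally have R: "R\<^sup>2 \<le> (\<Sum>d<m. (gap d)\<^sup>2) * ?N" .
  \<comment> \<open>Values in an interval of length \<open>R\<close> have energy at most
    \<open>?N * R\<^sup>2 / 4\<close> about its midpoint. Since \<open>R\<^sup>2\<close> is at most
    \<open>?N\<close> times the sum of the squared gaps, the factor \<theta> / 2 of
    \<open>drops\<close> becomes \<open>2 * \<theta> / ?N\<^sup>2\<close>.\<close>
  let ?c = "(z 0 + z m) / 2"
  have "\<bar>x i - ?c\<bar> \<le> R / 2" for i
  proof -
    obtain e where e: "e \<le> m" "x i = z e"
      using x_in by blast
    then show ?thesis
      using z_mono[of 0 e] z_mono[of e m] by (simp add: R_def abs_if field_simps)
  qed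
  then have "(norm (x i - ?c))\<^sup>2 \<le> (R / 2)\<^sup>2" for i
    by (metis abs_ge_zero power_mono real_norm_def)
  then have "energy (\<lambda>i. x i - ?c) \<le> (\<Sum>i\<in>(UNIV :: 'v set). (R / 2)\<^sup>2)"
    unfolding energy_def by (rule sum_mono)
  then have "dispersion x \<le> ?N * R\<^sup>2 / 4"
    using dispersion_le_energy_shift[of x ?c] by (simp add: power_divide)
  also have "\<dots> \<le> ?N * ((\<Sum>d<m. (gap d)\<^sup>2) * ?N) / 4"
    using R by (simp add: mult_left_mono)
  finally have "2 * \<theta> / ?N\<^sup>2 * dispersion x \<le> 2 * \<theta> / ?N\<^sup>2 * (?N * ((\<Sum>d<m. (gap d)\<^sup>2) * ?N) / 4)"
    using \<theta> by (intro mult_left_mono) auto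
  also have "\<dots> = \<theta> / 2 * (\<Sum>d<m. (gap d)\<^sup>2)"
    using N by (simp add: power2_eq_square)
  finally show ?thesis
    using drops by simp
qed

end

section \<open>Vector-valued averaging and windows of rounds\<close>

lemma energy_components:
  fixes x :: "'v::finite \<Rightarrow> real ^ 'n"
  shows "energy x = (\<Sum>k\<in>UNIV. energy (\<lambda>i. x i $ k))"
  unfolding energy_def power2_norm_eq_inner inner_vec_def
  by (subst sum.swap) simp

lemma mix_component: "mix A x i $ k = mix A (\<lambda>i. x i $ k) i"
  by (simp add: mix_def)

lemma average_component: "average x $ k = average (\<lambda>i. x i $ k)"
  by (simp add: average_def)

lemma dispersion_components:
  fixes x :: "'v::finite \<Rightarrow> real ^ 'n"
  shows "dispersion x = (\<Sum>k\<in>UNIV. dispersion (\<lambda>i. x i $ k))"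
  unfolding dispersion_def energy_components[of "\<lambda>i. x i - average x"]
  by (simp add: average_component)

lemma energy_drop_components:
  fixes x :: "'v::finite \<Rightarrow> real ^ 'n"
  shows "energy_drop A x = (\<Sum>k\<in>UNIV. energy_drop A (\<lambda>i. x i $ k))"
  unfolding energy_drop_def energy_components[of x] energy_components[of "mix A x"]
  by (simp add: mix_component sum_subtractf)

lemma consensus_component:
  "consensus P b x t i $ k = consensus P b (\<lambda>i. x i $ k) t i"
  by (induction t arbitrary: i) (simp_all add: mix_component)

lemma consensus_add: "consensus P b x (j + k) = consensus P (b + j) (consensus P b x j) k"
  by (induction k) (simp_all add: add.assoc)

lemma sum_lessThan_add:
  fixes g :: "nat \<Rightarrow> 'a::comm_monoid_add"
  shows "(\<Sum>k<m + n. g k) = (\<Sum>k<m. g k) + (\<Sum>k<n. g (m + k))"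
  by (induction n) (simp_all add: add.assoc)

context
  fixes P :: "nat \<Rightarrow> real ^ 'v ^ 'v" and \<theta> :: real
  assumes net: "\<And>t. weighted_network (P t) \<theta>"
begin

text \<open>Mixing acts on every coordinate separately, and dispersion and drop are sums over the
  coordinates. The sorted levels and their cuts may thus differ from one coordinate to
  another.\<close>

lemma dispersion_contraction:
  fixes x :: "'v \<Rightarrow> real ^ 'n"
  assumes "strongly_connected_graph (\<Union>t\<in>{b..<b + B}. edges (P t))"
  shows "2 * \<theta> / (real CARD('v))\<^sup>2 * dispersion x \<le> (\<Sum>k<B. energy_drop (P (b + k)) (consensus P b x k))"
proof -
  have "2 * \<theta> / (real CARD('v))\<^sup>2 * dispersion x =
      (\<Sum>k\<in>UNIV. 2 * \<theta> / (real CARD('v))\<^sup>2 * dispersion (\<lambda>i. x i $ k))"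
    by (simp add: dispersion_components sum_distrib_left)
  also have "\<dots> \<le> (\<Sum>k\<in>UNIV. \<Sum>t<B. energy_drop (P (b + t)) (consensus P b (\<lambda>i. x i $ k) t))"
    by (intro sum_mono real_dispersion_contraction net assms)
  also have "\<dots> = (\<Sum>t<B. energy_drop (P (b + t)) (consensus P b x t))"
    by (subst sum.swap) (simp only: energy_drop_components[of _ "consensus _ _ _ _"] consensus_component)
  finally show ?thesis .
qed

lemma sum_drop_consensus:
  fixes x :: "'v \<Rightarrow> 'a::real_inner"
  shows "(\<Sum>k<n. energy_drop (P (b + k)) (consensus P b x k)) = dispersion x - dispersion (consensus P b x n)"
  by (induction n) (simp_all add: dispersion_mix[OF network_doubly_stochastic[OF net]])

text \<open>A window of length \<open>2 * B\<close> contains a whole block of the connectivity assumption, wherever it starts.\<close>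

lemma window_contraction:
  fixes x :: "'v \<Rightarrow> real ^ 'n"
  assumes conn: "\<And>s. strongly_connected_graph (\<Union>t\<in>{s * B + 1..(s + 1) * B}. edges (P t))"
    and "B \<ge> 1" and "w \<ge> 1" and c: "2 * \<theta> / (real CARD('v))\<^sup>2 \<le> 1"
  shows "2 * \<theta> / (real CARD('v))\<^sup>2 * dispersion x \<le> (\<Sum>k<2 * B. energy_drop (P (w + k)) (consensus P w x k))"
proof -
  let ?c = "2 * \<theta> / (real CARD('v))\<^sup>2"
  \<comment> \<open>The ceiling of \<open>(w - 1) / B\<close>: as block \<open>s\<close> starts at
    \<open>s * B + 1\<close>, it is the first block that starts at or after \<open>w\<close>, and
    its offset \<open>j\<close> is less than \<open>B\<close>.\<close>
  define s where "s = (w - 1 + (B - 1)) div B"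
  define j where "j = s * B + 1 - w"
  have "s * B + (w - 1 + (B - 1)) mod B = w - 1 + (B - 1)"
    by (simp add: s_def)
  moreover have "(w - 1 + (B - 1)) mod B < B"
    using \<open>B \<ge> 1\<close> by simp
  ultimately have "w \<le> s * B + 1" "s * B + 1 < w + B"
    using \<open>B \<ge> 1\<close> \<open>w \<ge> 1\<close> by linarith+
  then have j: "w + j = s * B + 1" "j + B \<le> 2 * B"
    by (auto simp: j_def)
  let ?d = "\<lambda>k. energy_drop (P (w + k)) (consensus P w x k)" and ?y = "consensus P w x j"
  have d: "?d k \<ge> 0" for k
    by (rule energy_drop_nonneg[OF network_doubly_stochastic[OF net]])
  have "{s * B + 1..(s + 1) * B} = {w + j..<w + j + B}"
    using j by auto
  then have "?c * dispersion ?y \<le> (\<Sum>k<B. energy_drop (P (w + j + k)) (consensus P (w + j) ?y k))"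
    using conn[of s] by (intro dispersion_contraction) simp
  also have "\<dots> = (\<Sum>k<B. ?d (j + k))"
    by (simp add: consensus_add add.assoc)
  finally have "?c * dispersion ?y \<le> (\<Sum>k<B. ?d (j + k))" .
  moreover have "(\<Sum>k<j + B. ?d k) = (\<Sum>k<j. ?d k) + (\<Sum>k<B. ?d (j + k))"
    by (rule sum_lessThan_add)
  moreover have "(\<Sum>k<j + B. ?d k) \<le> (\<Sum>k<2 * B. ?d k)"
    using j(2) d by (intro sum_mono2) auto
  moreover have eq: "(\<Sum>k<j. ?d k) = dispersion x - dispersion ?y"
    by (rule sum_drop_consensus)
  \<comment> \<open>Variance lost before the block starts is counted in full; this is where the
    fraction has to be at most 1.\<close>
  moreover have "?c * (dispersion x - dispersion ?y) \<le> 1 * (dispersion x - dispersion ?y)"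
    unfolding eq[symmetric] using c d by (intro mult_right_mono sum_nonneg)
  moreover have "c * a \<le> t" if "c * b \<le> s2" "tot = s1 + s2" "tot \<le> t" "s1 = a - b" "c * (a - b) \<le> 1 * (a - b)"
    for a b c s1 s2 tot t :: real
    using that unfolding right_diff_distrib by linarith
  ultimately show ?thesis
    by blast
qed

section \<open>Averaging with perturbations\<close>

context
  fixes x :: "nat \<Rightarrow> 'v \<Rightarrow> real ^ 'n" and err :: "nat \<Rightarrow> real"
  defines "err \<equiv> \<lambda>t. \<Sum>i\<in>UNIV. norm (x (Suc t) i - mix (P t) (x t) i)"
begin

text \<open>Energy balance for the deviation from noiseless averaging: mixing only moves energy into
  the accumulated drops, and a perturbation increases the norm by at most \<open>err\<close>. So the
  drops of the deviation are controlled together with its size.\<close>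

lemma perturbation_energy:
  "(\<Sum>k<n. energy_drop (P (w + k)) (\<lambda>i. consensus P w (x w) k i - x (w + k) i)) +
     energy (\<lambda>i. consensus P w (x w) n i - x (w + n) i) \<le> (\<Sum>k<n. err (w + k))\<^sup>2"
proof (induction n)
  case 0
  then show ?case
    by (simp add: energy_def)
next
  case (Suc n)
  let ?\<eta> = "\<lambda>k i. consensus P w (x w) k i - x (w + k) i"
  let ?R = "(\<Sum>k<n. energy_drop (P (w + k)) (?\<eta> k)) + energy (?\<eta> n)"
  let ?H = "\<Sum>k<n. err (w + k)" and ?p = "mix (P (w + n)) (?\<eta> n)"
  have err: "err t \<ge> 0" for t
    by (simp add: err_def sum_nonneg)
  have step: "?\<eta> (Suc n) = (\<lambda>i. ?p i + - (x (Suc (w + n)) i - mix (P (w + n)) (x (w + n)) i))"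
    by (simp add: mix_diff)
  have "sqrt (energy (?\<eta> (Suc n))) \<le> sqrt (energy ?p) +
      sqrt (energy (\<lambda>i. - (x (Suc (w + n)) i - mix (P (w + n)) (x (w + n)) i)))"
    unfolding step by (rule sqrt_energy_triangle)
  also have "\<dots> \<le> sqrt (energy ?p) + err (w + n)"
    using sqrt_energy_le_sum[of "\<lambda>i. - (x (Suc (w + n)) i - mix (P (w + n)) (x (w + n)) i)"]
    by (simp add: err_def norm_minus_commute)
  finally have "energy (?\<eta> (Suc n)) \<le> (sqrt (energy ?p) + err (w + n))\<^sup>2"
    using power_mono[of "sqrt (energy (?\<eta> (Suc n)))" _ 2] by (simp add: energy_nonneg)
  also have "\<dots> = energy ?p + 2 * sqrt (energy ?p) * err (w + n) + (err (w + n))\<^sup>2"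
    by (simp add: power2_sum energy_nonneg)
  also have "sqrt (energy ?p) \<le> ?H"
  proof (rule power2_le_imp_le)
    have "energy ?p \<le> energy (?\<eta> n)"
      by (rule energy_mix_le[OF network_doubly_stochastic[OF net]])
    also have "\<dots> \<le> ?R"
      by (simp add: sum_nonneg energy_drop_nonneg[OF network_doubly_stochastic[OF net]])
    finally show "(sqrt (energy ?p))\<^sup>2 \<le> ?H\<^sup>2"
      using Suc.IH by (simp add: energy_nonneg)
  qed (simp add: err sum_nonneg)
  finally have "energy (?\<eta> (Suc n)) \<le> energy ?p + 2 * ?H * err (w + n) + (err (w + n))\<^sup>2"
    using err by (simp add: mult_right_mono)
  moreover have "energy ?p = energy (?\<eta> n) - energy_drop (P (w + n)) (?\<eta> n)"
    by (simp add: energy_drop_def)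
  ultimately have "(\<Sum>k<Suc n. energy_drop (P (w + k)) (?\<eta> k)) + energy (?\<eta> (Suc n)) \<le>
      ?R + 2 * ?H * err (w + n) + (err (w + n))\<^sup>2"
    by simp
  also have "\<dots> \<le> ?H\<^sup>2 + 2 * ?H * err (w + n) + (err (w + n))\<^sup>2"
    using Suc.IH by simp
  also have "\<dots> = (\<Sum>k<Suc n. err (w + k))\<^sup>2"
    by (simp add: power2_sum)
  finally show ?case .
qed

lemma err_sum_nonneg: "(\<Sum>k<n. err (w + k)) \<ge> 0"
  by (simp add: err_def sum_nonneg)

lemma sqrt_dispersion_shift_le:
  "sqrt (dispersion (x (w + n))) \<le> sqrt (dispersion (x w)) + (\<Sum>k<n. err (w + k))"
proof -
  let ?z = "consensus P w (x w) n"
  let ?\<eta> = "\<lambda>i. consensus P w (x w) n i - x (w + n) i"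
  have "sqrt (dispersion (\<lambda>i. ?z i + - ?\<eta> i)) \<le> sqrt (dispersion ?z) + sqrt (dispersion (\<lambda>i. - ?\<eta> i))"
    by (rule sqrt_dispersion_triangle)
  moreover have "dispersion ?z \<le> dispersion (x w)"
  proof -
    have "(\<Sum>k<n. energy_drop (P (w + k)) (consensus P w (x w) k)) \<ge> 0"
      by (intro sum_nonneg energy_drop_nonneg[OF network_doubly_stochastic[OF net]])
    then show ?thesis
      by (simp add: sum_drop_consensus)
  qed
  moreover have "sqrt (dispersion (\<lambda>i. - ?\<eta> i)) \<le> (\<Sum>k<n. err (w + k))"
  proof (rule real_le_lsqrt)
    have "(\<Sum>k<n. energy_drop (P (w + k)) (\<lambda>i. consensus P w (x w) k i - x (w + k) i)) \<ge> 0"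
      by (intro sum_nonneg energy_drop_nonneg[OF network_doubly_stochastic[OF net]])
    moreover have "dispersion (\<lambda>i. - ?\<eta> i) \<le> energy (\<lambda>i. - ?\<eta> i)"
      by (rule dispersion_le_energy)
    moreover have "energy (\<lambda>i. - ?\<eta> i) = energy ?\<eta>"
      by (simp add: energy_def norm_minus_commute)
    ultimately show "dispersion (\<lambda>i. - ?\<eta> i) \<le> (\<Sum>k<n. err (w + k))\<^sup>2"
      using perturbation_energy[where w = w and n = n] by linarith
  qed (simp_all add: err_sum_nonneg dispersion_nonneg)
  ultimately show ?thesis
    by (simp add: real_sqrt_le_mono order_trans add_mono)
qed

text \<open>Connectivity yields drops of the noiseless process, whereas the one-step inequality
  offers drops of the true iterates. The two processes differ by the deviation, whose own drops
  \<open>perturbation_energy\<close> bounds; the factors 2 come from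
  \<open>energy_drop_add_le\<close>.\<close>

lemma window_dispersion_le:
  assumes conn: "\<And>s. strongly_connected_graph (\<Union>t\<in>{s * B + 1..(s + 1) * B}. edges (P t))"
    and "B \<ge> 1" and "w \<ge> 1" and "2 * \<theta> / (real CARD('v))\<^sup>2 \<le> 1"
  shows "2 * \<theta> / (real CARD('v))\<^sup>2 * dispersion (x w) \<le>
    2 * (\<Sum>k<2 * B. energy_drop (P (w + k)) (x (w + k))) + 2 * (\<Sum>k<2 * B. err (w + k))\<^sup>2"
proof -
  let ?z = "consensus P w (x w)"
  let ?\<eta> = "\<lambda>k i. ?z k i - x (w + k) i"
  have "2 * \<theta> / (real CARD('v))\<^sup>2 * dispersion (x w) \<le> (\<Sum>k<2 * B. energy_drop (P (w + k)) (?z k))"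
    by (rule window_contraction[OF assms])
  also have "\<dots> \<le> (\<Sum>k<2 * B. 2 * energy_drop (P (w + k)) (x (w + k)) + 2 * energy_drop (P (w + k)) (?\<eta> k))"
  proof (rule sum_mono)
    fix k
    show "energy_drop (P (w + k)) (?z k) \<le> 2 * energy_drop (P (w + k)) (x (w + k)) + 2 * energy_drop (P (w + k)) (?\<eta> k)"
      using energy_drop_add_le[OF network_doubly_stochastic[OF net], of "w + k" "x (w + k)" "?\<eta> k"] by simp
  qed
  also have "\<dots> = 2 * (\<Sum>k<2 * B. energy_drop (P (w + k)) (x (w + k))) + 2 * (\<Sum>k<2 * B. energy_drop (P (w + k)) (?\<eta> k))"
    by (simp add: sum.distrib sum_distrib_left)
  also have "(\<Sum>k<2 * B. energy_drop (P (w + k)) (?\<eta> k)) \<le> (\<Sum>k<2 * B. err (w + k))\<^sup>2"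
    using perturbation_energy[where w = w and n = "2 * B"] energy_nonneg[of "?\<eta> (2 * B)"] by linarith
  finally show ?thesis
    by simp
qed

text \<open>The root of the dispersion enters the optimality gap linearly. Young's inequality with a
  free weight \<mu> converts it into drops, for which the potential pays, and a constant of order 1
  / \<mu>.\<close>

lemma window_sqrt_dispersion_le:
  assumes conn: "\<And>s. strongly_connected_graph (\<Union>t\<in>{s * B + 1..(s + 1) * B}. edges (P t))"
    and "B \<ge> 1" and "w \<ge> 1" and "2 * \<theta> / (real CARD('v))\<^sup>2 \<le> 1" and "\<theta> \<le> 1"
    and "\<mu> > 0" and "\<Gamma> \<ge> 0"
  shows "\<Gamma> * sqrt (dispersion (x w)) \<le> \<mu> * (\<Sum>k<2 * B. energy_drop (P (w + k)) (x (w + k))) +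
    \<Gamma>\<^sup>2 * (real CARD('v))\<^sup>2 / (4 * \<theta> * \<mu>) + \<Gamma> * (real CARD('v) / \<theta>) * (\<Sum>k<2 * B. err (w + k))"
proof -
  let ?N = "real CARD('v)" and ?H = "\<Sum>k<2 * B. err (w + k)"
  let ?X = "\<Sum>k<2 * B. energy_drop (P (w + k)) (x (w + k))"
  have \<theta>: "\<theta> > 0"
    using net by (simp add: weighted_network_def)
  have N: "?N > 0"
    by simp
  have X: "?X \<ge> 0"
    by (intro sum_nonneg energy_drop_nonneg[OF network_doubly_stochastic[OF net]])
  have "dispersion (x w) \<le> ?N\<^sup>2 / \<theta> * ?X + ?N\<^sup>2 / \<theta> * ?H\<^sup>2"
    using window_dispersion_le[OF assms(1-4)] \<theta> N by (simp add: field_simps)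
  then have "sqrt (dispersion (x w)) \<le> sqrt (?N\<^sup>2 / \<theta> * ?X + ?N\<^sup>2 / \<theta> * ?H\<^sup>2)"
    by simp
  also have "\<dots> \<le> sqrt (?N\<^sup>2 / \<theta> * ?X) + sqrt (?N\<^sup>2 / \<theta> * ?H\<^sup>2)"
    using \<theta> X by (intro sqrt_add_le_add_sqrt) auto
  \<comment> \<open>This only simplifies the constant: \<open>?N / sqrt \<theta>\<close> is weakened
    to \<open>?N / \<theta>\<close>.\<close>
  also have "sqrt (?N\<^sup>2 / \<theta> * ?H\<^sup>2) \<le> sqrt ((?N / \<theta> * ?H)\<^sup>2)"
  proof (intro real_sqrt_le_mono)
    have "\<theta>\<^sup>2 \<le> \<theta>"
      using \<theta> \<open>\<theta> \<le> 1\<close> by (simp add: power2_eq_square mult_left_le)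
    then have "?N\<^sup>2 / \<theta> \<le> ?N\<^sup>2 / \<theta>\<^sup>2"
      using \<theta> by (intro divide_left_mono) auto
    then show "?N\<^sup>2 / \<theta> * ?H\<^sup>2 \<le> (?N / \<theta> * ?H)\<^sup>2"
      unfolding power_mult_distrib power_divide by (rule mult_right_mono) simp
  qed
  also have "\<dots> = ?N / \<theta> * ?H"
    using \<theta> err_sum_nonneg by (intro real_sqrt_unique) auto
  finally have "sqrt (dispersion (x w)) \<le> sqrt (?N\<^sup>2 / \<theta> * ?X) + ?N / \<theta> * ?H"
    by simp
  then have "\<Gamma> * sqrt (dispersion (x w)) \<le> \<Gamma> * (sqrt (?N\<^sup>2 / \<theta> * ?X) + ?N / \<theta> * ?H)"
    using \<open>\<Gamma> \<ge> 0\<close> by (rule mult_left_mono)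
  then have "\<Gamma> * sqrt (dispersion (x w)) \<le> \<Gamma> * sqrt (?N\<^sup>2 / \<theta> * ?X) + \<Gamma> * (?N / \<theta>) * ?H"
    by (simp only: distrib_left mult.assoc)
  moreover have "\<Gamma> * sqrt (?N\<^sup>2 / \<theta> * ?X) \<le> \<mu> * ?X + \<Gamma>\<^sup>2 * ?N\<^sup>2 / (4 * \<theta> * \<mu>)"
  proof -
    have "0 \<le> (\<mu> * (2 * sqrt ?X) - \<Gamma> * ?N / sqrt \<theta>)\<^sup>2 / (4 * \<mu>)"
      using \<open>\<mu> > 0\<close> by simp
    also have "\<dots> = (4 * \<mu>\<^sup>2 * ?X - 4 * \<mu> * (sqrt ?X * \<Gamma> * ?N / sqrt \<theta>) + \<Gamma>\<^sup>2 * ?N\<^sup>2 / \<theta>) / (4 * \<mu>)"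
      using X \<theta> by (simp add: power2_diff power_mult_distrib power_divide)
    also have "\<dots> = \<mu> * ?X - sqrt ?X * \<Gamma> * ?N / sqrt \<theta> + \<Gamma>\<^sup>2 * ?N\<^sup>2 / (4 * \<theta> * \<mu>)"
      using \<open>\<mu> > 0\<close> by (simp add: add_divide_distrib diff_divide_distrib power2_eq_square)
    finally show ?thesis
      using \<theta> by (simp add: real_sqrt_mult real_sqrt_divide mult_ac)
  qed
  ultimately show ?thesis
    by linarith
qed

end

end

section \<open>From the one-step inequality to the rate\<close>

lemma sum_windows_le:
  fixes g :: "nat \<Rightarrow> real"
  assumes "\<And>t. g t \<ge> 0" and "m \<le> T"
  shows "(\<Sum>w\<in>{a..T - m}. \<Sum>k<m. g (w + k)) \<le> real m * (\<Sum>t\<in>{a..T}. g t)"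
proof -
  have "(\<Sum>w\<in>{a..T - m}. g (w + k)) \<le> (\<Sum>t\<in>{a..T}. g t)" if "k < m" for k
  proof -
    have "(\<Sum>w\<in>{a..T - m}. g (w + k)) = (\<Sum>t\<in>{a + k..T - m + k}. g t)"
      by (simp add: sum.shift_bounds_cl_nat_ivl)
    also have "\<dots> \<le> (\<Sum>t\<in>{a..T}. g t)"
      using assms that by (intro sum_mono2) auto
    finally show ?thesis .
  qed
  then have "(\<Sum>k<m. \<Sum>w\<in>{a..T - m}. g (w + k)) \<le> (\<Sum>k<m. \<Sum>t\<in>{a..T}. g t)"
    by (intro sum_mono) auto
  then show ?thesis
    by (subst sum.swap) simp
qed

text \<open>Abel summation, by induction on the sharper bound
  \<open>(W - w (Suc T)) / \<alpha> T\<close>: as \<open>W - w\<close> is nonnegative, passing to a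
  smaller step size only enlarges it. With a uniform \<open>W\<close> in place of
  \<open>w a\<close>, the sum may start at any index.\<close>

lemma weighted_telescope_le:
  fixes w \<alpha> :: "nat \<Rightarrow> real"
  assumes "\<And>t. \<alpha> t > 0" and "decseq \<alpha>" and "\<And>t. w t \<le> W" and "\<And>t. w t \<ge> 0" and "a \<le> T"
  shows "(\<Sum>t\<in>{a..T}. (w t - w (Suc t)) / \<alpha> t) \<le> W / \<alpha> T"
proof -
  have "(\<Sum>t\<in>{a..T}. (w t - w (Suc t)) / \<alpha> t) \<le> (W - w (Suc T)) / \<alpha> T"
    using \<open>a \<le> T\<close>
  proof (induction T rule: dec_induct)
    case base
    then show ?case
      using assms(1,3) by (simp add: divide_right_mono less_imp_le)
  next
    case (step n)
    have "(\<Sum>t\<in>{a..Suc n}. (w t - w (Suc t)) / \<alpha> t) \<le>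
        (W - w (Suc n)) / \<alpha> n + (w (Suc n) - w (Suc (Suc n))) / \<alpha> (Suc n)"
      using step by simp
    also have "(W - w (Suc n)) / \<alpha> n \<le> (W - w (Suc n)) / \<alpha> (Suc n)"
      using assms(1-3) decseqD[OF assms(2), of n "Suc n"] by (intro divide_left_mono) auto
    finally show ?case
      by (simp add: add_divide_distrib[symmetric] diff_divide_distrib[symmetric])
  qed
  also have "\<dots> \<le> W / \<alpha> T"
    using assms(1,4) by (simp add: divide_right_mono less_imp_le)
  finally show ?thesis .
qed

text \<open>The deterministic skeleton: \<open>Q\<close> is the expected gap, \<open>S\<close> the
  expected root of the dispersion, \<open>v\<close> the size of the noise, \<open>\<Delta>\<close>
  the expected drop, \<open>w\<close> the expected potential and \<open>e\<close> the expected
  displacement; \<open>G\<close> is the sum of the two subgradient bounds and \<open>d\<close>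
  bounds distances in \<open>X\<close>.\<close>

locale rate_recursion =
  fixes Q S v \<Delta> w e \<alpha> :: "nat \<Rightarrow> real" and N \<sigma> L \<theta> G d c :: real and B :: nat
  assumes N: "N \<ge> 2" and \<sigma>: "\<sigma> > 0" and L: "L \<ge> \<sigma>" and \<theta>: "0 < \<theta>" "\<theta> \<le> 1"
    and G: "G \<ge> 0" and d: "d \<ge> 0" and B: "B \<ge> 1"
    and \<alpha>: "\<And>t. \<alpha> t > 0" "decseq \<alpha>" and v: "\<And>t. v t \<ge> 0"
    and c: "c \<le> d * L" "4 * \<sigma> < L \<Longrightarrow> c \<le> d * L / 2"
    and nonneg: "\<And>t. S t \<ge> 0" "\<And>t. \<Delta> t \<ge> 0" "\<And>t. e t \<ge> 0"
    and w: "\<And>t. w t \<ge> 0" "\<And>t. w t \<le> N * (\<sigma> * d\<^sup>2 / 2)"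
    and crude: "\<And>t. Q t \<le> N * G * d"
    and step: "\<And>t. Q t \<le> N * G * S t + N * G * v t + (w t - w (Suc t) - \<sigma> / 2 * \<Delta> t
        + N * c * v t + N * L * (v t)\<^sup>2) / \<alpha> t + \<alpha> t * (N * G\<^sup>2 / (2 * \<sigma>))"
    and e: "\<And>t. e t \<le> N * (\<alpha> t * G + L * v t) / \<sigma>"
    and window: "\<And>t \<mu>. t \<ge> 1 \<Longrightarrow> \<mu> > 0 \<Longrightarrow> N * G * S t \<le> \<mu> * (\<Sum>k<2 * B. \<Delta> (t + k)) +
        (N * G)\<^sup>2 * N\<^sup>2 / (4 * \<theta> * \<mu>) + N * G * (N / \<theta>) * (\<Sum>k<2 * B. e (t + k))"
    and shift: "\<And>t. t \<ge> 1 \<Longrightarrow> S (t + 2 * B) \<le> S t + (\<Sum>k<2 * B. e (t + k))"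
begin

text \<open>What the claimed constants afford per round: \<open>8 * N ^ 4 * B / \<theta>\<close> is
  a lower bound of the factor \<open>4 * N + 2 * N\<^sup>2 * \<omega> / (1 - \<gamma>)\<close> in
  \<open>C3\<close> and \<open>C4\<close>, and it gets multiplied by \<open>N * G\<close>.\<close>

definition budget :: "nat \<Rightarrow> real" where
  "budget t = 8 * N ^ 5 * B * G\<^sup>2 / (\<theta> * \<sigma>) * \<alpha> t + N * G\<^sup>2 / (2 * \<sigma>) * \<alpha> t +
     8 * N ^ 5 * B * G / \<theta> * v t + N * G * v t + N * d * L * v t / \<alpha> t + N * L * (v t)\<^sup>2 / \<alpha> t"

text \<open>Before the step size falls below this threshold, one step of size \<open>\<alpha> t\<close> already pays for the trivial
  bound \<open>crude\<close>; after it, the term \<open>N * d * L * v t / \<alpha> t\<close> dominates the effect of the noise on the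
  disagreement.\<close>

definition large_step :: "nat \<Rightarrow> bool" where
  "large_step t \<longleftrightarrow> \<sigma> * d \<le> G * \<alpha> t * (16 * B * N\<^sup>2 / \<theta>)"

lemma N_powers: "N ^ 3 \<le> N ^ 5 / 4" "N ^ 4 \<le> N ^ 5 / 2"
proof -
  have "N ^ 3 * 2\<^sup>2 \<le> N ^ 3 * N\<^sup>2" "N ^ 4 * 2 \<le> N ^ 4 * N"
    using N by (intro mult_left_mono power_mono; simp)+
  then show "N ^ 3 \<le> N ^ 5 / 4" "N ^ 4 \<le> N ^ 5 / 2"
    by (simp_all add: power_add[symmetric] numeral_eq_Suc)
qed

lemma budget_nonneg: "budget t \<ge> 0"
  unfolding budget_def using N \<sigma> L \<theta> G d v[of t] \<alpha>(1)[of t]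
  by (intro add_nonneg_nonneg mult_nonneg_nonneg divide_nonneg_nonneg) auto

lemma large_step_le_budget:
  assumes "large_step t"
  shows "Q t \<le> budget t"
proof -
  have "d \<le> G * \<alpha> t * (16 * B * N\<^sup>2 / \<theta>) / \<sigma>"
    using assms unfolding large_step_def pos_le_divide_eq[OF \<sigma>] by (simp only: mult.commute[of d])
  then have "N * G * d \<le> N * G * (G * \<alpha> t * (16 * B * N\<^sup>2 / \<theta>) / \<sigma>)"
    using N G by (intro mult_left_mono) auto
  also have "\<dots> = N ^ 3 * (16 * B * G\<^sup>2 * \<alpha> t / (\<theta> * \<sigma>))"
    by (simp add: power2_eq_square power3_eq_cube)
  \<comment> \<open>By \<open>N \<ge> 2\<close>, the 16 of the threshold becomes a 4, below the 8 of
    the budget.\<close>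
  also have "\<dots> \<le> N ^ 5 / 4 * (16 * B * G\<^sup>2 * \<alpha> t / (\<theta> * \<sigma>))"
    using N_powers \<alpha>(1)[of t] \<theta> \<sigma> by (intro mult_right_mono) auto
  also have "\<dots> \<le> 8 * N ^ 5 * B * G\<^sup>2 / (\<theta> * \<sigma>) * \<alpha> t"
    using \<alpha>(1)[of t] \<theta> \<sigma> N by (simp add: divide_right_mono mult_right_mono)
  also have "\<dots> \<le> budget t"
    unfolding budget_def using N \<sigma> L \<theta> G d v[of t] \<alpha>(1)[of t] by simp
  finally show ?thesis
    using crude[of t] by simp
qed

text \<open>The left side is what remains of a step once the drops have cancelled. Through
  \<open>e\<close> it contains noise with the factor \<open>L / \<sigma>\<close>: up to ratio 4 the
  spare powers of \<open>N\<close> absorb it, beyond that the half of the \<open>d * L\<close> term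
  that \<open>c\<close> leaves free.\<close>

lemma noise_le_budget:
  assumes "\<not> large_step t"
  shows "N * G * v t + N * c * v t / \<alpha> t + N * L * (v t)\<^sup>2 / \<alpha> t + \<alpha> t * (N * G\<^sup>2 / (2 * \<sigma>)) +
    4 * B * N ^ 4 * G\<^sup>2 / (\<theta> * \<sigma>) * \<alpha> t + N * G * (1 + 2 * N / \<theta>) * (2 * B) * e t \<le> budget t"
proof -
  have "1 \<le> N / (2 * \<theta>)"
    using N \<theta> by (simp add: field_simps)
  then have "1 + 2 * N / \<theta> \<le> 5 * N / (2 * \<theta>)"
    by (simp add: field_simps)
  then have "N * G * (1 + 2 * N / \<theta>) * (2 * B) * e t \<le> N * G * (5 * N / (2 * \<theta>)) * (2 * B) * (N * (\<alpha> t * G + L * v t) / \<sigma>)"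
    using N G \<theta> nonneg(3)[of t] e[of t] by (intro mult_mono mult_nonneg_nonneg) auto
  also have "\<dots> = N ^ 3 * (5 * B * G\<^sup>2 / (\<theta> * \<sigma>) * \<alpha> t) + 5 * B * N ^ 3 * G * L * v t / (\<theta> * \<sigma>)"
    using \<theta> \<sigma> by (simp add: field_simps power2_eq_square power3_eq_cube)
  finally have 1: "N * G * (1 + 2 * N / \<theta>) * (2 * B) * e t \<le>
      N ^ 3 * (5 * B * G\<^sup>2 / (\<theta> * \<sigma>) * \<alpha> t) + 5 * B * N ^ 3 * G * L * v t / (\<theta> * \<sigma>)" .
  have 2: "N ^ 3 * (5 * B * G\<^sup>2 / (\<theta> * \<sigma>) * \<alpha> t) + 4 * B * N ^ 4 * G\<^sup>2 / (\<theta> * \<sigma>) * \<alpha> t \<le>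
      8 * N ^ 5 * B * G\<^sup>2 / (\<theta> * \<sigma>) * \<alpha> t"
  proof -
    define q where "q = B * G\<^sup>2 / (\<theta> * \<sigma>) * \<alpha> t"
    have q: "q \<ge> 0"
      using \<alpha>(1)[of t] \<theta> \<sigma> by (simp add: q_def)
    have "5 * (N ^ 3 * q) + 4 * (N ^ 4 * q) \<le> 8 * (N ^ 5 * q)"
      using mult_right_mono[OF N_powers(1) q] mult_right_mono[OF N_powers(2) q]
        mult_nonneg_nonneg[OF _ q, of "N ^ 5"] N by simp
    then show ?thesis
      by (simp add: q_def mult_ac)
  qed
  have 3: "5 * B * N ^ 3 * G * L * v t / (\<theta> * \<sigma>) + N * c * v t / \<alpha> t \<le>
      8 * N ^ 5 * B * G / \<theta> * v t + N * d * L * v t / \<alpha> t"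
  proof (cases "4 * \<sigma> < L")
    case False
    have "5 * B * N ^ 3 * G * L * v t / (\<theta> * \<sigma>) = N ^ 3 * (5 * B * G / \<theta> * v t) * (L / \<sigma>)"
      using \<theta> \<sigma> by (simp add: field_simps)
    also have "\<dots> \<le> N ^ 5 / 4 * (5 * B * G / \<theta> * v t) * 4"
      using False N_powers G \<theta> \<sigma> L v[of t] N by (intro mult_mono) (auto simp: field_simps)
    also have "\<dots> \<le> 8 * N ^ 5 * B * G / \<theta> * v t"
      using N G \<theta> v[of t] by (simp add: divide_right_mono mult_right_mono)
    finally have "5 * B * N ^ 3 * G * L * v t / (\<theta> * \<sigma>) \<le> 8 * N ^ 5 * B * G / \<theta> * v t" .
    moreover have "N * c * v t / \<alpha> t \<le> N * (d * L) * v t / \<alpha> t"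
      using c(1) N v[of t] \<alpha>(1)[of t] by (intro divide_right_mono mult_right_mono mult_left_mono) auto
    ultimately show ?thesis
      by simp
  next
    case True
    have "N * c * v t / \<alpha> t \<le> N * (d * L / 2) * v t / \<alpha> t"
      using c(2)[OF True] N v[of t] \<alpha>(1)[of t] by (intro divide_right_mono mult_right_mono mult_left_mono) auto
    moreover have "5 * B * N ^ 3 * G * L * v t / (\<theta> * \<sigma>) \<le> N * (d * L / 2) * v t / \<alpha> t"
    proof -
      \<comment> \<open>The negated threshold, divided by \<open>\<sigma> * \<alpha> t\<close>: it
        provides the constant 8 where the displacement needs 5.\<close>
      have "G * \<alpha> t * (16 * B * N\<^sup>2 / \<theta>) / (\<sigma> * \<alpha> t) \<le> \<sigma> * d / (\<sigma> * \<alpha> t)"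
        using assms \<sigma> \<alpha>(1)[of t] by (intro divide_right_mono) (auto simp: large_step_def)
      then have "G * (16 * B * N\<^sup>2 / \<theta>) / \<sigma> \<le> d / \<alpha> t"
        using \<sigma> \<alpha>(1)[of t] by simp
      then have "N * L * v t / 2 * (G * (16 * B * N\<^sup>2 / \<theta>) / \<sigma>) \<le> N * L * v t / 2 * (d / \<alpha> t)"
        using N L \<sigma> v[of t] by (intro mult_left_mono) auto
      moreover have "N * L * v t / 2 * (G * (16 * B * N\<^sup>2 / \<theta>) / \<sigma>) = 8 * B * N ^ 3 * G * L * v t / (\<theta> * \<sigma>)"
        by (simp add: power2_eq_square power3_eq_cube)
      moreover have "5 * B * N ^ 3 * G * L * v t / (\<theta> * \<sigma>) \<le> 8 * B * N ^ 3 * G * L * v t / (\<theta> * \<sigma>)"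
        using N L G \<theta> \<sigma> v[of t] by (intro divide_right_mono mult_right_mono) auto
      moreover have "N * L * v t / 2 * (d / \<alpha> t) = N * (d * L / 2) * v t / \<alpha> t"
        by simp
      ultimately show ?thesis
        by linarith
    qed
    moreover have "8 * N ^ 5 * B * G / \<theta> * v t \<ge> 0"
      using N G \<theta> v[of t] by simp
    moreover have "N * d * L * v t / \<alpha> t = N * (d * L / 2) * v t / \<alpha> t + N * (d * L / 2) * v t / \<alpha> t"
      by (simp add: mult_ac flip: add_divide_distrib)
    ultimately show ?thesis
      by linarith
  qed
  show ?thesis
    using 1 2 3 unfolding budget_def by (simp add: mult.commute[of "\<alpha> t"])
qed

text \<open>A window bound needs \<open>2 * B\<close> further rounds. The last \<open>2 * B\<close>
  terms are therefore shifted back by that amount at the cost of the displacements, so that every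
  remaining term counts at most twice; \<open>a + 4 * B \<le> Suc T\<close> keeps the shifted
  indices in range.\<close>

lemma sum_disagreement_le:
  assumes "a \<ge> 1" and "a + 4 * B \<le> Suc T"
  shows "(\<Sum>t\<in>{a..T}. N * G * S t) \<le> (\<Sum>t\<in>{a..T}. \<sigma> * \<Delta> t / (2 * \<alpha> t) +
    4 * B * N ^ 4 * G\<^sup>2 / (\<theta> * \<sigma>) * \<alpha> t + N * G * (1 + 2 * N / \<theta>) * (2 * B) * e t)"
proof -
  let ?m = "2 * B" and ?A = "{a..T - 2 * B}"
  define H where "H t = (\<Sum>k<?m. e (t + k))" for t
  have H: "H t \<ge> 0" for t
    unfolding H_def by (intro sum_nonneg nonneg)
  have "{a..T} = ?A \<union> {Suc (T - ?m)..T}"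
    using assms by auto
  then have "(\<Sum>t\<in>{a..T}. S t) = (\<Sum>t\<in>?A. S t) + (\<Sum>t\<in>{Suc (T - ?m)..T}. S t)"
    by (simp add: sum.union_disjoint)
  also have "{Suc (T - ?m)..T} = {Suc (T - 2 * ?m) + ?m..T - ?m + ?m}"
    using assms by auto
  also have "(\<Sum>t\<in>\<dots>. S t) = (\<Sum>t\<in>{Suc (T - 2 * ?m)..T - ?m}. S (t + ?m))"
    by (rule sum.shift_bounds_cl_nat_ivl)
  also have "\<dots> \<le> (\<Sum>t\<in>{Suc (T - 2 * ?m)..T - ?m}. S t + H t)"
    unfolding H_def by (intro sum_mono shift) auto
  also have "\<dots> \<le> (\<Sum>t\<in>?A. S t + H t)"
    using assms nonneg H by (intro sum_mono2) auto
  finally have "(\<Sum>t\<in>{a..T}. S t) \<le> (\<Sum>t\<in>?A. 2 * S t + H t)"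
    by (simp add: sum.distrib sum_distrib_left[symmetric])
  then have "N * G * (\<Sum>t\<in>{a..T}. S t) \<le> N * G * (\<Sum>t\<in>?A. 2 * S t + H t)"
    using N G by (intro mult_left_mono) auto
  then have "(\<Sum>t\<in>{a..T}. N * G * S t) \<le> (\<Sum>t\<in>?A. 2 * (N * G * S t) + N * G * H t)"
    by (simp add: sum_distrib_left distrib_left mult.left_commute)
  also have "\<dots> \<le> (\<Sum>t\<in>?A. (\<Sum>k<?m. \<sigma> * \<Delta> (t + k) / (4 * B * \<alpha> (t + k))) +
      4 * B * N ^ 4 * G\<^sup>2 / (\<theta> * \<sigma>) * \<alpha> t + N * G * (1 + 2 * N / \<theta>) * H t)"
  proof (rule sum_mono)
    fix t
    assume "t \<in> ?A"
    then have "t \<ge> 1"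
      using assms by auto
    \<comment> \<open>Terms count twice and a drop lies in at most \<open>2 * B\<close> windows, so
      that \<open>2 * (2 * B) * ?\<mu>\<close> is exactly the available weight
      \<open>\<sigma> / (2 * \<alpha> t)\<close>.\<close>
    let ?\<mu> = "\<sigma> / (8 * B * \<alpha> t)"
    have \<mu>: "?\<mu> > 0"
      using \<sigma> \<alpha>(1)[of t] B by simp
    have "N * G * S t \<le> ?\<mu> * (\<Sum>k<?m. \<Delta> (t + k)) + (N * G)\<^sup>2 * N\<^sup>2 / (4 * \<theta> * ?\<mu>) + N * G * (N / \<theta>) * H t"
      unfolding H_def using window[OF \<open>t \<ge> 1\<close> \<mu>] .
    moreover have "2 * ((N * G)\<^sup>2 * N\<^sup>2 / (4 * \<theta> * ?\<mu>)) = 4 * B * N ^ 4 * G\<^sup>2 / (\<theta> * \<sigma>) * \<alpha> t"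
      using \<sigma> \<theta> \<alpha>(1)[of t] B by (simp add: field_simps power2_eq_square numeral_eq_Suc)
    \<comment> \<open>Replacing \<open>\<alpha> t\<close> by the smaller
      \<open>\<alpha> (t + k)\<close> charges each drop to its own round.\<close>
    moreover have "2 * (?\<mu> * (\<Sum>k<?m. \<Delta> (t + k))) \<le> (\<Sum>k<?m. \<sigma> * \<Delta> (t + k) / (4 * B * \<alpha> (t + k)))"
    proof -
      have "2 * (?\<mu> * (\<Sum>k<?m. \<Delta> (t + k))) = (\<Sum>k<?m. \<sigma> * \<Delta> (t + k) / (4 * B * \<alpha> t))"
        by (simp add: sum_distrib_left mult.assoc)
      also have "\<dots> \<le> (\<Sum>k<?m. \<sigma> * \<Delta> (t + k) / (4 * B * \<alpha> (t + k)))"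
        using \<alpha>(1) decseqD[OF \<alpha>(2)] \<sigma> nonneg B
        by (intro sum_mono divide_left_mono mult_left_mono mult_nonneg_nonneg mult_pos_pos) auto
      finally show ?thesis .
    qed
    moreover have "N * G * (1 + 2 * N / \<theta>) * H t = N * G * H t + 2 * (N * G * (N / \<theta>) * H t)"
      by (simp add: algebra_simps)
    ultimately show "2 * (N * G * S t) + N * G * H t \<le> (\<Sum>k<?m. \<sigma> * \<Delta> (t + k) / (4 * B * \<alpha> (t + k))) +
        4 * B * N ^ 4 * G\<^sup>2 / (\<theta> * \<sigma>) * \<alpha> t + N * G * (1 + 2 * N / \<theta>) * H t"
      by linarith
  qed
  also have "\<dots> = (\<Sum>t\<in>?A. \<Sum>k<?m. \<sigma> * \<Delta> (t + k) / (4 * B * \<alpha> (t + k))) +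
      (\<Sum>t\<in>?A. 4 * B * N ^ 4 * G\<^sup>2 / (\<theta> * \<sigma>) * \<alpha> t) + N * G * (1 + 2 * N / \<theta>) * (\<Sum>t\<in>?A. H t)"
    by (simp add: sum.distrib sum_distrib_left)
  also have "\<dots> \<le> real ?m * (\<Sum>t\<in>{a..T}. \<sigma> * \<Delta> t / (4 * B * \<alpha> t)) +
      (\<Sum>t\<in>{a..T}. 4 * B * N ^ 4 * G\<^sup>2 / (\<theta> * \<sigma>) * \<alpha> t) +
      N * G * (1 + 2 * N / \<theta>) * (real ?m * (\<Sum>t\<in>{a..T}. e t))"
  proof (intro add_mono mult_left_mono)
    show "(\<Sum>t\<in>?A. \<Sum>k<?m. \<sigma> * \<Delta> (t + k) / (4 * B * \<alpha> (t + k))) \<le> real ?m * (\<Sum>t\<in>{a..T}. \<sigma> * \<Delta> t / (4 * B * \<alpha> t))"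
      using assms \<sigma> \<alpha>(1) nonneg by (intro sum_windows_le) (auto simp: less_imp_le)
    show "(\<Sum>t\<in>?A. H t) \<le> real ?m * (\<Sum>t\<in>{a..T}. e t)"
      unfolding H_def using assms nonneg by (intro sum_windows_le) auto
    show "(\<Sum>t\<in>?A. 4 * B * N ^ 4 * G\<^sup>2 / (\<theta> * \<sigma>) * \<alpha> t) \<le> (\<Sum>t\<in>{a..T}. 4 * B * N ^ 4 * G\<^sup>2 / (\<theta> * \<sigma>) * \<alpha> t)"
      using \<alpha>(1) \<sigma> \<theta> N by (intro sum_mono2) (auto simp: less_imp_le)
  qed (use N G \<theta> in auto)
  also have "\<dots> = (\<Sum>t\<in>{a..T}. \<sigma> * \<Delta> t / (2 * \<alpha> t) +
    4 * B * N ^ 4 * G\<^sup>2 / (\<theta> * \<sigma>) * \<alpha> t + N * G * (1 + 2 * N / \<theta>) * (2 * B) * e t)"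
    using B by (simp add: sum.distrib sum_distrib_left mult.assoc)
  finally show ?thesis .
qed

lemma sum_le_of_small_steps:
  assumes "1 \<le> a" and "a \<le> T" and small: "\<And>t. t \<ge> a \<Longrightarrow> \<not> large_step t"
  shows "(\<Sum>t\<in>{a..T}. Q t) \<le> N * (\<sigma> * d\<^sup>2 / 2) / \<alpha> T + (\<Sum>t\<in>{a..T}. budget t)"
proof (cases "a + 4 * B \<le> Suc T")
  case True
  have "(\<Sum>t\<in>{a..T}. Q t) \<le> (\<Sum>t\<in>{a..T}. N * G * S t + (w t - w (Suc t)) / \<alpha> t +
      (N * G * v t + N * c * v t / \<alpha> t + N * L * (v t)\<^sup>2 / \<alpha> t + \<alpha> t * (N * G\<^sup>2 / (2 * \<sigma>))) - \<sigma> * \<Delta> t / (2 * \<alpha> t))"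
  proof (rule sum_mono)
    fix t
    show "Q t \<le> N * G * S t + (w t - w (Suc t)) / \<alpha> t + (N * G * v t + N * c * v t / \<alpha> t +
        N * L * (v t)\<^sup>2 / \<alpha> t + \<alpha> t * (N * G\<^sup>2 / (2 * \<sigma>))) - \<sigma> * \<Delta> t / (2 * \<alpha> t)"
      using step[of t] by (simp add: add_divide_distrib diff_divide_distrib)
  qed
  also have "\<dots> = (\<Sum>t\<in>{a..T}. N * G * S t) + (\<Sum>t\<in>{a..T}. (w t - w (Suc t)) / \<alpha> t) +
      (\<Sum>t\<in>{a..T}. (N * G * v t + N * c * v t / \<alpha> t + N * L * (v t)\<^sup>2 / \<alpha> t + \<alpha> t * (N * G\<^sup>2 / (2 * \<sigma>))) - \<sigma> * \<Delta> t / (2 * \<alpha> t))"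
    by (simp add: sum.distrib sum_subtractf)
  also have "\<dots> \<le> (\<Sum>t\<in>{a..T}. \<sigma> * \<Delta> t / (2 * \<alpha> t) + 4 * B * N ^ 4 * G\<^sup>2 / (\<theta> * \<sigma>) * \<alpha> t +
        N * G * (1 + 2 * N / \<theta>) * (2 * B) * e t) + N * (\<sigma> * d\<^sup>2 / 2) / \<alpha> T +
      (\<Sum>t\<in>{a..T}. (N * G * v t + N * c * v t / \<alpha> t + N * L * (v t)\<^sup>2 / \<alpha> t + \<alpha> t * (N * G\<^sup>2 / (2 * \<sigma>))) - \<sigma> * \<Delta> t / (2 * \<alpha> t))"
    by (intro add_mono order_refl sum_disagreement_le weighted_telescope_le \<alpha> w assms True)
  also have "\<dots> = N * (\<sigma> * d\<^sup>2 / 2) / \<alpha> T + (\<Sum>t\<in>{a..T}. N * G * v t + N * c * v t / \<alpha> t + N * L * (v t)\<^sup>2 / \<alpha> t +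
      \<alpha> t * (N * G\<^sup>2 / (2 * \<sigma>)) + 4 * B * N ^ 4 * G\<^sup>2 / (\<theta> * \<sigma>) * \<alpha> t + N * G * (1 + 2 * N / \<theta>) * (2 * B) * e t)"
    by (simp add: sum.distrib sum_subtractf)
  also have "\<dots> \<le> N * (\<sigma> * d\<^sup>2 / 2) / \<alpha> T + (\<Sum>t\<in>{a..T}. budget t)"
    using small by (intro add_left_mono sum_mono noise_le_budget) auto
  finally show ?thesis .
next
  case False
  \<comment> \<open>Fewer than \<open>4 * B\<close> rounds remain, too few for the windows. But
    \<open>\<not> large_step T\<close> makes the potential term, with its division by
    \<open>\<alpha> T\<close>, exceed the crude bound for all of them.\<close>
  have "(\<Sum>t\<in>{a..T}. Q t) \<le> (\<Sum>t\<in>{a..T}. N * G * d)"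
    by (intro sum_mono crude)
  also have "\<dots> \<le> real (4 * B) * (N * G * d)"
    using False N G d by (simp only: sum_constant) (intro mult_right_mono, auto)
  also have "\<dots> \<le> N * (\<sigma> * d\<^sup>2 / 2) / \<alpha> T"
  proof -
    have "N * d / 2 * (G * \<alpha> T * (16 * B * N\<^sup>2 / \<theta>)) \<le> N * d / 2 * (\<sigma> * d)"
      using small[OF \<open>a \<le> T\<close>] N d by (intro mult_left_mono) (auto simp: large_step_def)
    moreover have "8 \<le> 16 * N\<^sup>2 / \<theta>"
    proof -
      have "N\<^sup>2 \<ge> 1"
        using N by (simp add: one_le_power)
      then show ?thesis
        using \<theta> by (simp add: field_simps)
    qed
    then have "N * d / 2 * (G * \<alpha> T * B) * 8 \<le> N * d / 2 * (G * \<alpha> T * B) * (16 * N\<^sup>2 / \<theta>)"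
      using N d G \<alpha>(1)[of T] by (intro mult_left_mono) auto
    moreover have "N * d / 2 * (G * \<alpha> T * (16 * B * N\<^sup>2 / \<theta>)) = N * d / 2 * (G * \<alpha> T * B) * (16 * N\<^sup>2 / \<theta>)"
      "N * d / 2 * (G * \<alpha> T * B) * 8 = 4 * B * (N * G * d) * \<alpha> T"
      "N * d / 2 * (\<sigma> * d) = N * (\<sigma> * d\<^sup>2 / 2)"
      by (simp_all add: power2_eq_square)
    ultimately have "4 * B * (N * G * d) * \<alpha> T \<le> N * (\<sigma> * d\<^sup>2 / 2)"
      by linarith
    then show ?thesis
      using \<alpha>(1)[of T] by (simp add: field_simps)
  qed
  also have "\<dots> \<le> N * (\<sigma> * d\<^sup>2 / 2) / \<alpha> T + (\<Sum>t\<in>{a..T}. budget t)"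
    by (simp add: sum_nonneg budget_nonneg)
  finally show ?thesis .
qed

text \<open>As step sizes do not increase, the large ones form an initial segment, and their rounds
  pay for themselves. The telescoping starts afresh after it, at no loss because the bound on the
  potential is uniform in time.\<close>

theorem sum_le_budget:
  "(\<Sum>t\<in>{1..T}. Q t) \<le> N * (\<sigma> * d\<^sup>2 / 2) / \<alpha> T + (\<Sum>t\<in>{1..T}. budget t)"
proof (cases "\<forall>t\<in>{1..T}. large_step t")
  case True
  then have "(\<Sum>t\<in>{1..T}. Q t) \<le> (\<Sum>t\<in>{1..T}. budget t)"
    by (intro sum_mono large_step_le_budget) auto
  moreover have "N * (\<sigma> * d\<^sup>2 / 2) / \<alpha> T \<ge> 0"
    using N \<sigma> \<alpha>(1)[of T] by simp
  ultimately show ?thesis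
    by linarith
next
  case False
  define a where "a = (LEAST t. t \<ge> 1 \<and> \<not> large_step t)"
  obtain t where t: "t \<ge> 1 \<and> \<not> large_step t" "t \<le> T"
    using False by auto
  then have a: "a \<ge> 1 \<and> \<not> large_step a" "a \<le> T"
    unfolding a_def using LeastI[of "\<lambda>t. t \<ge> 1 \<and> \<not> large_step t" t] Least_le[of "\<lambda>t. t \<ge> 1 \<and> \<not> large_step t" t]
    by auto
  have small: "\<not> large_step t" if "t \<ge> a" for t
  proof -
    have "G * \<alpha> t * (16 * B * N\<^sup>2 / \<theta>) \<le> G * \<alpha> a * (16 * B * N\<^sup>2 / \<theta>)"
      using decseqD[OF \<alpha>(2) that] G \<theta> by (intro mult_right_mono mult_left_mono) auto
    then show ?thesis
      using a by (auto simp: large_step_def)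
  qed
  have large: "large_step t" if "1 \<le> t" "t < a" for t
    using not_less_Least[of t "\<lambda>t. t \<ge> 1 \<and> \<not> large_step t"] that unfolding a_def by auto
  have split: "sum g {1..T} = sum g {1..<a} + sum g {a..T}" for g :: "nat \<Rightarrow> real"
    using a sum.atLeastLessThan_concat[of 1 a "Suc T" g] by (simp add: atLeastLessThanSuc_atLeastAtMost)
  have "(\<Sum>t\<in>{1..<a}. Q t) \<le> (\<Sum>t\<in>{1..<a}. budget t)"
    by (intro sum_mono large_step_le_budget large) auto
  moreover have "(\<Sum>t\<in>{a..T}. Q t) \<le> N * (\<sigma> * d\<^sup>2 / 2) / \<alpha> T + (\<Sum>t\<in>{a..T}. budget t)"
    using a small by (intro sum_le_of_small_steps) auto
  ultimately show ?thesis
    by (simp only: split[of Q] split[of budget])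
qed

end

section \<open>The random iteration\<close>

text \<open>Integrating the conditional bound in \<open>ennreal\<close> gives integrability and the
  second moment at once; the first moment follows because a variance is nonnegative.\<close>

lemma (in prob_space) cond_second_moment_bounds:
  fixes Z :: "'a \<Rightarrow> real ^ 'n"
  assumes sub: "subalgebra M H" and [measurable]: "Z \<in> borel_measurable M"
    and bound: "cond_second_moment_le M H Z c" and "c \<ge> 0"
  shows "integrable M (\<lambda>w. (norm (Z w))\<^sup>2)" and "expectation (\<lambda>w. (norm (Z w))\<^sup>2) \<le> c"
    and "integrable M (\<lambda>w. norm (Z w))" and "expectation (\<lambda>w. norm (Z w)) \<le> sqrt c"
proof -
  interpret finite_measure_subalgebra M H
    by unfold_locales (rule sub)
  have "(\<integral>\<^sup>+ w. ennreal ((norm (Z w))\<^sup>2) \<partial>M) =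
      (\<integral>\<^sup>+ w. 1 * nn_cond_exp M H (\<lambda>w. ennreal ((norm (Z w))\<^sup>2)) w \<partial>M)"
    by (subst nn_cond_exp_intg) auto
  also have "\<dots> \<le> (\<integral>\<^sup>+ w. ennreal c \<partial>M)"
    using bound unfolding cond_second_moment_le_def by (intro nn_integral_mono_AE) auto
  finally have le: "(\<integral>\<^sup>+ w. ennreal ((norm (Z w))\<^sup>2) \<partial>M) \<le> ennreal c"
    by (simp add: emeasure_space_1)
  then show int: "integrable M (\<lambda>w. (norm (Z w))\<^sup>2)"
    by (intro integrableI_nonneg) (auto intro: le_less_trans)
  show sq: "expectation (\<lambda>w. (norm (Z w))\<^sup>2) \<le> c"
    using le \<open>c \<ge> 0\<close> by (simp add: nn_integral_eq_integral[OF int] ennreal_le_iff)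
  show int1: "integrable M (\<lambda>w. norm (Z w))"
    by (rule square_integrable_imp_integrable) (use int in auto)
  have "(expectation (\<lambda>w. norm (Z w)))\<^sup>2 \<le> expectation (\<lambda>w. (norm (Z w))\<^sup>2)"
    using variance_eq[OF int1 int] variance_positive[of "\<lambda>w. norm (Z w)"] by simp
  then show "expectation (\<lambda>w. norm (Z w)) \<le> sqrt c"
    using sq by (intro real_le_rsqrt) simp
qed

lemma integrable_mult_of_squares:
  fixes u v :: "'w \<Rightarrow> real"
  assumes [measurable]: "u \<in> borel_measurable M" "v \<in> borel_measurable M"
    and "integrable M (\<lambda>w. (u w)\<^sup>2)" "integrable M (\<lambda>w. (v w)\<^sup>2)"
  shows "integrable M (\<lambda>w. u w * v w)"
proof (rule Bochner_Integration.integrable_bound)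
  show "integrable M (\<lambda>w. (u w)\<^sup>2 + (v w)\<^sup>2)"
    using assms by simp
  have "\<bar>a * b\<bar> \<le> a\<^sup>2 + b\<^sup>2" for a b :: real
    using sum_squares_bound[of "\<bar>a\<bar>" "\<bar>b\<bar>"] mult_nonneg_nonneg[OF abs_ge_zero abs_ge_zero, of a b]
    unfolding abs_mult power2_abs by linarith
  then show "AE w in M. norm (u w * v w) \<le> norm ((u w)\<^sup>2 + (v w)\<^sup>2)"
    by simp
qed simp

lemma borel_measurable_vec_component [measurable]:
  fixes Z :: "'w \<Rightarrow> real ^ 'n"
  assumes "Z \<in> borel_measurable M"
  shows "(\<lambda>w. Z w $ k) \<in> borel_measurable M"
proof -
  have "(\<lambda>z :: real ^ 'n. z $ k) \<in> borel_measurable borel"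
    by (intro borel_measurable_continuous_onI continuous_intros)
  from measurable_compose[OF assms this] show ?thesis .
qed

locale dscmd_run = prob_space M + smooth_mirror_map \<Phi> d\<Phi> \<sigma> L
  for M :: "'w measure" and \<Phi> :: "real ^ 'n \<Rightarrow> real" and d\<Phi> :: "real ^ 'n \<Rightarrow> real ^ 'n" and \<sigma> L :: real +
  fixes F :: "nat \<Rightarrow> 'w measure"
    and X :: "(real ^ 'n) set"
    and f h :: "'v::finite \<Rightarrow> real ^ 'n \<Rightarrow> real"
    and \<theta> Gf \<nu> :: real
    and B :: nat
    and P :: "nat \<Rightarrow> real ^ 'v ^ 'v"
    and \<alpha> r :: "nat \<Rightarrow> real"
    and \<xi> :: "nat \<Rightarrow> 'v \<Rightarrow> 'v \<Rightarrow> 'w \<Rightarrow> real ^ 'n"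
    and gs :: "nat \<Rightarrow> 'v \<Rightarrow> real ^ 'n \<Rightarrow> 'w \<Rightarrow> real ^ 'n"
    and g :: "'v \<Rightarrow> real ^ 'n \<Rightarrow> real ^ 'n"
    and x0 :: "'v \<Rightarrow> real ^ 'n"
    and x y :: "nat \<Rightarrow> 'v \<Rightarrow> 'w \<Rightarrow> real ^ 'n"
    and xs :: "real ^ 'n"
  assumes X: "X \<noteq> {}" "convex X" "compact X"
    and convex_f: "\<And>i. convex_on UNIV (f i)" and convex_h: "\<And>i. convex_on UNIV (h i)"
    and xs: "is_arg_min (\<lambda>z. \<Sum>i\<in>UNIV. f i z + h i z) (\<lambda>z. z \<in> X) xs"
    and run: "dscmd_n M X \<Phi> d\<Phi> h P \<alpha> r \<xi> gs x0 x y"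
    and adapted: "adapted_history M F X \<xi> gs x y"
    and network: "network_assumption P B \<theta>"
    and oracles: "stochastic_subgradient_assumption M F X f \<xi> gs y g Gf"
    and noise: "noise_assumption M F \<xi> \<nu>"
    and mirror_assumption: "mirror_map_assumption \<Phi> d\<Phi> L TYPE('v)"
    and \<alpha>: "\<And>t. \<alpha> t > 0" "decseq \<alpha>"
    and r: "\<And>t. r t > 0" "decseq r"
begin

abbreviation "Gh \<equiv> subgradient_bound h X"
abbreviation "R \<equiv> bregman_diameter \<Phi> d\<Phi> X"
abbreviation "H \<equiv> past_and_noise M F \<xi>"

definition "Fsum z = (\<Sum>i\<in>UNIV. f i z + h i z)"
definition "G = Gf + Gh"
text \<open>Strong convexity turns the bound \<open>R\<^sup>2\<close> on divergences within
  \<open>X\<close> into this bound on distances; \<open>C5\<close> equals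
  \<open>d * L * N * sqrt \<nu>\<close>.\<close>

definition "d = sqrt (2 / \<sigma>) * R"

text \<open>Coefficient of the first-order effect of the noise on the divergence; it gains a factor
  \<open>sqrt (\<sigma> / L)\<close> as soon as there are two agents, because then the divergence is symmetric.\<close>

definition "c = (if CARD('v) \<ge> 2 then sqrt (2 * L) * R else L * d)"
text \<open>The query point is \<open>p + v\<close>, where \<open>p\<close> stays in
  \<open>X\<close> by convexity and \<open>v\<close> is the averaged noise, which may lead out of
  \<open>X\<close>.\<close>

definition "p t i w = mix (P t) (\<lambda>j. x t j w) i"
definition "v t i w = y t i w - p t i w"

text \<open>This is \<open>g\<^sub>i(y\<^sub>i) \<bullet> (y\<^sub>i - x\<^sup>*)\<close> almost surely, but unlike that expression it is known to be measurable.\<close>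

definition "drift t i w = (\<Sum>k\<in>UNIV. (y t i w $ k - xs $ k) *
  real_cond_exp M (H t) (\<lambda>w. gs t i (y t i w) w $ k) w)"

lemma Gf_nonneg: "Gf \<ge> 0"
  using oracles by (simp add: stochastic_subgradient_assumption_def)

lemma Gh_nonneg: "Gh \<ge> 0"
  using subgradient_bound_nonneg convex_h X by blast

lemma \<nu>_nonneg: "\<nu> \<ge> 0"
  using noise by (simp add: noise_assumption_def)

lemma doubly_stochastic_P: "doubly_stochastic (P t)"
  using network by (simp add: network_assumption_def)

lemma weighted_network_P: "weighted_network (P t) \<theta>"
  using network unfolding network_assumption_def weighted_network_def by blast

lemma N_ge_1: "real CARD('v) \<ge> 1"
  by (simp add: Suc_leI)

lemma xs_in_X: "xs \<in> X"
  using xs by (simp add: is_arg_min_def)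

lemma x_in_X:
  assumes "w \<in> space M"
  shows "x t i w \<in> X"
proof (cases t)
  case 0
  then show ?thesis
    using run assms by (simp add: dscmd_n_def)
next
  case (Suc s)
  then show ?thesis
    using run assms unfolding dscmd_n_def is_arg_min_def by blast
qed

lemma p_in_X:
  assumes "w \<in> space M"
  shows "p t i w \<in> X"
  unfolding p_def mix_def
  using X(2) x_in_X[OF assms] doubly_stochasticD[OF doubly_stochastic_P]
  by (intro convex_sum) auto

lemma v_eq:
  assumes "w \<in> space M"
  shows "v t i w = r t *\<^sub>R (\<Sum>j\<in>UNIV. P t $ i $ j *\<^sub>R \<xi> t i j w)"
proof -
  have "y t i w = (\<Sum>j\<in>UNIV. P t $ i $ j *\<^sub>R (x t j w + r t *\<^sub>R \<xi> t i j w))"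
    using run assms by (simp add: dscmd_n_def)
  then show ?thesis
    by (simp add: v_def p_def mix_def scaleR_add_right sum.distrib scaleR_sum_right mult.commute)
qed

lemma prox:
  assumes "w \<in> space M"
  shows "is_arg_min (\<lambda>z. gs t i (y t i w) w \<bullet> z + 1 / \<alpha> t * D z (y t i w) + h i z)
    (\<lambda>z. z \<in> X) (x (Suc t) i w)"
  using run assms unfolding dscmd_n_def by blast

lemma subalgebra_F: "subalgebra M (F t)"
  using adapted by (simp add: adapted_history_def)

lemma space_past: "space (past M F t) = space M"
  using subalgebra_F by (cases t) (auto simp: past_def subalgebra_def)

lemma subalgebra_past: "subalgebra M (past M F t)"
proof (cases t)
  case 0
  then show ?thesis
    by (simp add: past_def subalgebra_def sets.sigma_sets_subset)
next
  case (Suc s)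
  then show ?thesis
    using subalgebra_F by (simp add: past_def)
qed

lemma measurable_\<xi>: "\<xi> t i j \<in> borel_measurable M"
  using adapted measurable_from_subalg[OF subalgebra_F] unfolding adapted_history_def by blast

lemma subalgebra_H: "subalgebra M (H t)" and subalgebra_H_past: "subalgebra (H t) (past M F t)"
  and measurable_\<xi>_H: "\<xi> t i j \<in> borel_measurable (H t)"
proof -
  let ?A = "sets (past M F t) \<union> {\<xi> t i j -` A \<inter> space M | i j A. A \<in> sets borel}"
  have A: "?A \<subseteq> sets M"
    using subalgebra_past[of t] measurable_sets[OF measurable_\<xi>] by (auto simp: subalgebra_def)
  then have "?A \<subseteq> Pow (space M)"
    using sets.space_closed by blast
  then have sets_H: "sets (H t) = sigma_sets (space M) ?A" and space_H: "space (H t) = space M"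
    by (simp_all add: past_and_noise_def sets_measure_of space_measure_of)
  show "subalgebra M (H t)"
    using A by (simp add: subalgebra_def sets_H space_H sets.sigma_sets_subset)
  show "subalgebra (H t) (past M F t)"
    by (auto simp: subalgebra_def sets_H space_H space_past)
  show "\<xi> t i j \<in> borel_measurable (H t)"
    by (rule measurableI) (auto simp: sets_H space_H)
qed

lemma measurable_x: "x t i \<in> borel_measurable M"
  and measurable_x_H: "x t i \<in> borel_measurable (H t)"
proof -
  have *: "x t i \<in> borel_measurable (past M F t)"
  proof (cases t)
    case 0
    have "(\<lambda>_. x0 i) \<in> borel_measurable (past M F t)"
      by simp
    then show ?thesis
      using 0 run by (subst measurable_cong[of _ _ "\<lambda>_. x0 i"]) (auto simp: space_past dscmd_n_def)
  next
    case (Suc s)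
    then show ?thesis
      using adapted by (simp add: past_def adapted_history_def)
  qed
  show "x t i \<in> borel_measurable M"
    by (rule measurable_from_subalg[OF subalgebra_past *])
  show "x t i \<in> borel_measurable (H t)"
    by (rule measurable_from_subalg[OF subalgebra_H_past *])
qed

lemma measurable_y: "y t i \<in> borel_measurable M"
  using adapted measurable_from_subalg[OF subalgebra_F] unfolding adapted_history_def by blast

lemma measurable_y_H: "y t i \<in> borel_measurable (H t)"
proof -
  note [measurable] = measurable_\<xi>_H measurable_x_H
  have "(\<lambda>w. \<Sum>j\<in>UNIV. P t $ i $ j *\<^sub>R (x t j w + r t *\<^sub>R \<xi> t i j w)) \<in> borel_measurable (H t)"
    by measurable
  moreover have "y t i w = (\<Sum>j\<in>UNIV. P t $ i $ j *\<^sub>R (x t j w + r t *\<^sub>R \<xi> t i j w))"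
    if "w \<in> space (H t)" for w
    using run that subalgebra_H[of t] by (simp add: dscmd_n_def subalgebra_def)
  ultimately show ?thesis
    by (simp cong: measurable_cong)
qed

lemma measurable_gs: "(\<lambda>w. gs t i (y t i w) w) \<in> borel_measurable M"
  using adapted measurable_from_subalg[OF subalgebra_F] unfolding adapted_history_def by blast

lemma measurable_p: "p t i \<in> borel_measurable M"
  using measurable_x unfolding p_def mix_def by (intro borel_measurable_sum borel_measurable_scaleR) auto

lemma measurable_v: "v t i \<in> borel_measurable M"
  using measurable_y measurable_p unfolding v_def by (intro borel_measurable_diff) auto

lemma measurable_continuous:
  fixes k :: "real ^ 'n \<Rightarrow> real"
  assumes "continuous_on UNIV k" and "Z \<in> borel_measurable M"
  shows "(\<lambda>w. k (Z w)) \<in> borel_measurable M"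
  using measurable_compose[OF assms(2) borel_measurable_continuous_onI[OF assms(1)]] .

lemma bregman_le_R:
  assumes "a \<in> X" and "b \<in> X"
  shows "D a b \<le> R\<^sup>2" and "R \<ge> 0"
proof -
  let ?S = "(\<lambda>(x, y). D x y) ` (X \<times> X)"
  have "bdd_above ?S"
  proof (rule bdd_aboveI2)
    fix z
    assume "z \<in> X \<times> X"
    then have "norm (fst z - snd z) \<le> diameter X"
      using diameter_bounded_bound[OF compact_imp_bounded[OF X(3)], of "fst z" "snd z"] by (auto simp: dist_norm)
    then have "L * (norm (fst z - snd z))\<^sup>2 \<le> L * (diameter X)\<^sup>2"
      using L_pos by (intro mult_left_mono power_mono) auto
    then show "(case z of (x, y) \<Rightarrow> D x y) \<le> L * (diameter X)\<^sup>2"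
      using bregman_le[of "fst z" "snd z"] by (simp add: case_prod_beta)
  qed
  then have "D a b \<le> Sup ?S"
    using assms by (intro cSup_upper) auto
  moreover have "D a b \<ge> 0"
    by (rule bregman_nonneg)
  ultimately show "D a b \<le> R\<^sup>2" "R \<ge> 0"
    by (auto simp: bregman_diameter_def)
qed

lemma R_nonneg: "R \<ge> 0"
  using bregman_le_R(2)[OF xs_in_X xs_in_X] .

lemma d_nonneg: "d \<ge> 0" and R_square: "R\<^sup>2 = \<sigma> * d\<^sup>2 / 2"
  using R_nonneg sigma_pos by (simp_all add: d_def power_mult_distrib)

lemma dist_le_d:
  assumes "a \<in> X" and "b \<in> X"
  shows "norm (a - b) \<le> d"
proof (rule power2_le_imp_le)
  have "\<sigma> / 2 * (norm (a - b))\<^sup>2 \<le> \<sigma> / 2 * d\<^sup>2"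
    using bregman_ge[of a b] bregman_le_R(1)[OF assms] R_square by simp
  then show "(norm (a - b))\<^sup>2 \<le> d\<^sup>2"
    using sigma_pos by simp
qed (rule d_nonneg)

text \<open>Jensen's inequality by duality: pairing the oracle with its mean \<open>g i z\<close>
  yields \<open>(norm (g i z))\<^sup>2 \<le> Gf * norm (g i z)\<close>. The oracle of time 0 serves,
  as its conditional mean is the constant \<open>g i z\<close>.\<close>

lemma norm_g_le:
  assumes "z \<in> X"
  shows "norm (g i z) \<le> Gf"
proof -
  have meas: "gs 0 i z \<in> borel_measurable M"
    using adapted assms measurable_from_subalg[OF subalgebra_F] unfolding adapted_history_def by blast
  have moment: "cond_second_moment_le M (past M F 0) (gs 0 i z) (Gf\<^sup>2)"
    and mean: "cond_mean_is M (past M F 0) (gs 0 i z) (\<lambda>_. g i z)"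
    using oracles assms unfolding stochastic_subgradient_assumption_def by blast+
  note bounds = cond_second_moment_bounds[OF subalgebra_past meas moment zero_le_power2]
  interpret finite_measure_subalgebra M "past M F 0"
    by unfold_locales (rule subalgebra_past)
  have int: "integrable M (\<lambda>w. gs 0 i z w $ k)" for k
    using component_le_norm_cart[of "gs 0 i z _" k]
    by (intro Bochner_Integration.integrable_bound[OF bounds(3) borel_measurable_vec_component[OF meas]]) simp
  have "expectation (\<lambda>w. gs 0 i z w $ k) = g i z $ k" for k
  proof -
    have "expectation (\<lambda>w. gs 0 i z w $ k) = expectation (real_cond_exp M (past M F 0) (\<lambda>w. gs 0 i z w $ k))"
      using real_cond_exp_int(2)[OF int] by simp
    also have "\<dots> = expectation (\<lambda>w. g i z $ k)"
      using mean borel_measurable_cond_exp2 unfolding cond_mean_is_def by (intro integral_cong_AE) auto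
    finally show ?thesis
      by (simp add: prob_space)
  qed
  then have "g i z \<bullet> g i z = expectation (\<lambda>w. gs 0 i z w \<bullet> g i z)"
    using int by (simp add: inner_vec_def)
  also have "\<dots> \<le> expectation (\<lambda>w. norm (gs 0 i z w) * norm (g i z))"
    using int bounds(3) by (intro integral_mono norm_cauchy_schwarz) (simp_all add: inner_vec_def)
  also have "\<dots> \<le> Gf * norm (g i z)"
    using bounds(4) Gf_nonneg by (simp add: mult_right_mono)
  finally show ?thesis
    by (cases "g i z = 0") (auto simp: dot_square_norm power2_eq_square Gf_nonneg)
qed

text \<open>The subgradient is taken at \<open>a\<close>, so \<open>a\<close> alone has to lie in
  \<open>X\<close>; \<open>b\<close> may be a query point outside.\<close>

lemma f_diff_le:
  assumes "a \<in> X"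
  shows "f i a - f i b \<le> Gf * norm (a - b)"
proof -
  have "g i a \<in> subdifferential (f i) a"
    using oracles assms unfolding stochastic_subgradient_assumption_def by blast
  then have "f i a - f i b \<le> g i a \<bullet> (a - b)"
    unfolding subdifferential_def by (auto simp: inner_diff_right algebra_simps)
  also have "\<dots> \<le> norm (g i a) * norm (a - b)"
    by (rule norm_cauchy_schwarz)
  also have "\<dots> \<le> Gf * norm (a - b)"
    using norm_g_le[OF assms] by (simp add: mult_right_mono)
  finally show ?thesis .
qed

lemma h_diff_le:
  assumes "a \<in> X"
  shows "h i a - h i b \<le> Gh * norm (a - b)"
  using diff_le_subgradient_bound[where h = h, OF convex_h X(3) assms] .

lemma G_nonneg: "G \<ge> 0"
  using Gf_nonneg Gh_nonneg by (simp add: G_def)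

lemma Fsum_diff_le:
  assumes "a \<in> X" and "b \<in> X"
  shows "Fsum a - Fsum b \<le> real CARD('v) * G * d"
proof -
  have "f i a + h i a - (f i b + h i b) \<le> G * d" for i
  proof -
    have "f i a + h i a - (f i b + h i b) \<le> G * norm (a - b)"
      using f_diff_le[OF assms(1), of i b] h_diff_le[OF assms(1), of i b] by (simp add: G_def distrib_right)
    also have "\<dots> \<le> G * d"
      using dist_le_d[OF assms] G_nonneg by (simp add: mult_left_mono)
    finally show ?thesis .
  qed
  then have "(\<Sum>i\<in>UNIV. f i a + h i a - (f i b + h i b)) \<le> (\<Sum>i\<in>(UNIV :: 'v set). G * d)"
    by (rule sum_mono)
  then show ?thesis
    by (simp add: Fsum_def sum_subtractf)
qed

text \<open>For two or more agents, \<open>c\<close> is \<open>sqrt (\<sigma> / L)\<close> times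
  \<open>d * L\<close>, so the bounds amount to \<open>\<sigma> \<le> L\<close> and
  \<open>4 * \<sigma> \<le> L\<close>.\<close>

lemma c_bounds: "c \<ge> 0" "c \<le> d * L" "CARD('v) \<ge> 2 \<Longrightarrow> 4 * \<sigma> < L \<Longrightarrow> c \<le> d * L / 2"
proof -
  have "sqrt (2 * L) \<le> sqrt (2 / \<sigma>) * L"
  proof (rule real_le_lsqrt)
    have "2 * L * \<sigma> \<le> 2 * L * L"
      using sigma_le_L L_pos by simp
    then show "2 * L \<le> (sqrt (2 / \<sigma>) * L)\<^sup>2"
      using sigma_pos by (simp add: power_mult_distrib field_simps power2_eq_square)
  qed (use L_pos sigma_pos in auto)
  from mult_right_mono[OF this R_nonneg] show "c \<le> d * L"
    by (simp add: c_def d_def mult_ac)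
  show "c \<ge> 0"
    using L_pos R_nonneg d_nonneg by (simp add: c_def)
  assume "CARD('v) \<ge> 2" "4 * \<sigma> < L"
  have "sqrt (2 * L) \<le> sqrt (2 / \<sigma>) * L / 2"
  proof (rule real_le_lsqrt)
    have "2 * L * (4 * \<sigma>) \<le> 2 * L * L"
      using \<open>4 * \<sigma> < L\<close> L_pos by simp
    then show "2 * L \<le> (sqrt (2 / \<sigma>) * L / 2)\<^sup>2"
      using sigma_pos by (simp add: power_mult_distrib power_divide field_simps power2_eq_square)
  qed (use L_pos sigma_pos in auto)
  from mult_right_mono[OF this R_nonneg] show "c \<le> d * L / 2"
    using \<open>CARD('v) \<ge> 2\<close> by (simp add: c_def d_def mult_ac)
qed

end

section \<open>One step along a sample path\<close>

context dscmd_run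
begin

text \<open>The distance from the query point to the next iterate occurs twice: paired with the
  oracle and, by the triangle inequality, in the increment of \<open>h i\<close>. Young's inequality
  charges both to the divergence between these two points that the proximal step gains, so this
  distance, which noise can make large, never has to be bounded.\<close>

lemma step_agent:
  assumes w: "w \<in> space M" and sub: "g i (y t i w) \<in> subdifferential (f i) (y t i w)"
    and mean: "\<And>k. real_cond_exp M (H t) (\<lambda>w. gs t i (y t i w) w $ k) w = g i (y t i w) $ k"
  shows "f i (x t l w) + h i (x t l w) - (f i xs + h i xs) \<le>
    G * norm (x t l w - y t i w) + (drift t i w - gs t i (y t i w) w \<bullet> (y t i w - xs)) +
    \<alpha> t / (2 * \<sigma>) * (norm (gs t i (y t i w) w) + Gh)\<^sup>2 +
    (D xs (y t i w) - D xs (x (Suc t) i w)) / \<alpha> t"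
proof -
  define s where "s = gs t i (y t i w) w"
  define q where "q = y t i w"
  define u where "u = x (Suc t) i w"
  define b where "b = x t l w"
  have mem: "u \<in> X" "b \<in> X"
    using x_in_X[OF w] by (simp_all add: u_def b_def)
  have 1: "f i b - f i q \<le> Gf * norm (b - q)"
    by (rule f_diff_le[OF mem(2)])
  have 2: "f i q - f i xs \<le> drift t i w"
  proof -
    have "f i q - f i xs \<le> g i q \<bullet> (q - xs)"
      using sub unfolding subdifferential_def q_def by (auto simp: inner_diff_right algebra_simps)
    then show ?thesis
      by (simp add: drift_def mean q_def inner_vec_def mult.commute)
  qed
  have 3: "h i b - h i u \<le> Gh * norm (b - q) + Gh * norm (q - u)"
  proof -
    have "h i b - h i u \<le> Gh * norm (b - u)"
      by (rule h_diff_le[OF mem(2)])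
    also have "\<dots> \<le> Gh * (norm (b - q) + norm (q - u))"
      using Gh_nonneg norm_triangle_ineq[of "b - q" "q - u"] by (intro mult_left_mono) auto
    finally show ?thesis
      by (simp add: distrib_left)
  qed
  have 4: "h i u - h i xs \<le> s \<bullet> (xs - u) + 1 / \<alpha> t * (D xs q - D xs u - D u q)"
    unfolding s_def q_def u_def by (rule prox_optimality[OF X(2) convex_h \<alpha>(1) prox[OF w] xs_in_X])
  have 5: "s \<bullet> (xs - u) \<le> - (s \<bullet> (q - xs)) + norm s * norm (q - u)"
    using norm_cauchy_schwarz[of s "q - u"] by (simp add: inner_diff_right)
  have 6: "1 / \<alpha> t * (\<sigma> / 2 * (norm (q - u))\<^sup>2) \<le> 1 / \<alpha> t * D u q"
    using bregman_ge[of u q] \<alpha>(1)[of t] by (intro mult_left_mono) (auto simp: norm_minus_commute)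
  have 7: "(norm s + Gh) * norm (q - u) \<le> \<alpha> t / (2 * \<sigma>) * (norm s + Gh)\<^sup>2 + 1 / \<alpha> t * (\<sigma> / 2 * (norm (q - u))\<^sup>2)"
  proof -
    have "0 \<le> (\<alpha> t * (norm s + Gh) - \<sigma> * norm (q - u))\<^sup>2 / (2 * \<sigma> * \<alpha> t)"
      using sigma_pos \<alpha>(1)[of t] by simp
    also have "\<dots> = \<alpha> t / (2 * \<sigma>) * (norm s + Gh)\<^sup>2 - (norm s + Gh) * norm (q - u) + 1 / \<alpha> t * (\<sigma> / 2 * (norm (q - u))\<^sup>2)"
      using sigma_pos \<alpha>(1)[of t]
      by (simp add: power2_diff power_mult_distrib add_divide_distrib diff_divide_distrib) (simp add: power2_eq_square)
    finally show ?thesis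
      by simp
  qed
  have "f i b + h i b - (f i xs + h i xs) \<le> G * norm (b - q) + (drift t i w - s \<bullet> (q - xs)) +
      \<alpha> t / (2 * \<sigma>) * (norm s + Gh)\<^sup>2 + 1 / \<alpha> t * (D xs q - D xs u)"
    using 1 2 3 4 5 6 7 unfolding G_def distrib_right right_diff_distrib by linarith
  then show ?thesis
    by (simp add: s_def q_def u_def b_def)
qed

text \<open>The distance to a mixed point is at most the row average of the distances. Summed over
  the rows, the column sums are 1, so mixing adds no factor to that of
  \<open>sum_dist_le_dispersion\<close>.\<close>

lemma sum_dist_le:
  assumes "w \<in> space M"
  shows "(\<Sum>i\<in>UNIV. norm (x t l w - y t i w)) \<le>
    real CARD('v) * sqrt (dispersion (\<lambda>i. x t i w)) + (\<Sum>i\<in>UNIV. norm (v t i w))"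
proof -
  have "norm (x t l w - p t i w) \<le> (\<Sum>j\<in>UNIV. P t $ i $ j * norm (x t l w - x t j w))" for i
  proof -
    have "x t l w - p t i w = (\<Sum>j\<in>UNIV. P t $ i $ j *\<^sub>R (x t l w - x t j w))"
      by (simp add: p_def mix_def scaleR_diff_right sum_subtractf scaleR_sum_left[symmetric]
          doubly_stochasticD[OF doubly_stochastic_P])
    then show ?thesis
      using norm_sum[of "\<lambda>j. P t $ i $ j *\<^sub>R (x t l w - x t j w)" UNIV]
      by (simp add: doubly_stochasticD[OF doubly_stochastic_P])
  qed
  then have "(\<Sum>i\<in>UNIV. norm (x t l w - p t i w)) \<le> (\<Sum>i\<in>UNIV. \<Sum>j\<in>UNIV. P t $ i $ j * norm (x t l w - x t j w))"
    by (rule sum_mono)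
  also have "\<dots> \<le> real CARD('v) * sqrt (dispersion (\<lambda>i. x t i w))"
    unfolding sum_mix_rows[OF doubly_stochastic_P] by (rule sum_dist_le_dispersion)
  finally have "(\<Sum>i\<in>UNIV. norm (x t l w - p t i w)) \<le> real CARD('v) * sqrt (dispersion (\<lambda>i. x t i w))" .
  moreover have "norm (x t l w - y t i w) \<le> norm (x t l w - p t i w) + norm (v t i w)" for i
    using norm_triangle_ineq4[of "x t l w - p t i w" "v t i w"] by (simp add: v_def)
  then have "(\<Sum>i\<in>UNIV. norm (x t l w - y t i w)) \<le> (\<Sum>i\<in>UNIV. norm (x t l w - p t i w) + norm (v t i w))"
    by (rule sum_mono)
  ultimately show ?thesis
    by (simp add: sum.distrib)
qed

text \<open>With two or more agents, symmetry gives both the variance term and the small noise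
  coefficient. Mixing is the identity for a single agent, so its drop is 0, and the Lipschitz
  perturbation bound with \<open>c = L * d\<close> is enough.\<close>

lemma sum_bregman_y_le:
  assumes w: "w \<in> space M"
  shows "(\<Sum>i\<in>UNIV. D xs (y t i w)) \<le> (\<Sum>i\<in>UNIV. D xs (x t i w)) -
    \<sigma> / 2 * energy_drop (P t) (\<lambda>i. x t i w) + (\<Sum>i\<in>UNIV. c * norm (v t i w) + L * (norm (v t i w))\<^sup>2)"
proof -
  have y: "y t i w = p t i w + v t i w" for i
    by (simp add: v_def)
  have "(\<Sum>i\<in>UNIV. D xs (p t i w)) \<le> (\<Sum>i\<in>UNIV. D xs (x t i w)) - \<sigma> / 2 * energy_drop (P t) (\<lambda>i. x t i w)
    \<and> (\<forall>i. D xs (y t i w) \<le> D xs (p t i w) + c * norm (v t i w) + L * (norm (v t i w))\<^sup>2)"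
  proof (cases "CARD('v) \<ge> 2")
    case True
    note sym = bregman_commute[OF mirror_assumption True]
    have "D xs (p t i w) + \<sigma> / 2 * (\<Sum>j\<in>UNIV. P t $ i $ j * (norm (x t j w - p t i w))\<^sup>2) \<le>
        (\<Sum>j\<in>UNIV. P t $ i $ j * D xs (x t j w))" for i
      unfolding p_def mix_def
      by (intro bregman_average_le sym doubly_stochasticD[OF doubly_stochastic_P]) auto
    then have "(\<Sum>i\<in>UNIV. D xs (p t i w) + \<sigma> / 2 * (\<Sum>j\<in>UNIV. P t $ i $ j * (norm (x t j w - p t i w))\<^sup>2)) \<le>
        (\<Sum>i\<in>UNIV. \<Sum>j\<in>UNIV. P t $ i $ j * D xs (x t j w))"
      by (intro sum_mono)
    then have "(\<Sum>i\<in>UNIV. D xs (p t i w)) \<le> (\<Sum>i\<in>UNIV. D xs (x t i w)) - \<sigma> / 2 * energy_drop (P t) (\<lambda>i. x t i w)"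
      unfolding sum_mix_rows[OF doubly_stochastic_P] energy_drop_eq[OF doubly_stochastic_P]
      by (simp add: sum.distrib sum_distrib_left p_def)
    moreover have "D xs (y t i w) \<le> D xs (p t i w) + c * norm (v t i w) + L * (norm (v t i w))\<^sup>2" for i
      unfolding y c_def using True
      by (simp add: bregman_perturb_le_sqrt[OF sym bregman_le_R(1)[OF xs_in_X p_in_X[OF w]] R_nonneg])
    ultimately show ?thesis
      by blast
  next
    case False
    then have "CARD('v) \<le> Suc 0"
      by simp
    then have eq: "i = j" for i j :: 'v
      using card_le_Suc0_iff_eq[of "UNIV :: 'v set"] by auto
    have p: "mix (P t) (\<lambda>j. x t j w) = (\<lambda>i. x t i w)"
    proof
      fix i
      have "(\<lambda>j. x t j w) = (\<lambda>_. x t i w)"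
        using eq by metis
      then show "mix (P t) (\<lambda>j. x t j w) i = x t i w"
        using mix_const[OF doubly_stochastic_P] by metis
    qed
    have "D xs (y t i w) \<le> D xs (p t i w) + c * norm (v t i w) + L * (norm (v t i w))\<^sup>2" for i
    proof -
      have "L * norm (v t i w) * norm (xs - p t i w) \<le> L * norm (v t i w) * d"
        using dist_le_d[OF xs_in_X p_in_X[OF w]] L_pos by (intro mult_left_mono) auto
      then show ?thesis
        using bregman_perturb_le[of xs "p t i w" "v t i w"] False by (simp add: y c_def mult_ac)
    qed
    then show ?thesis
      by (simp add: p p_def energy_drop_def)
  qed
  then have "(\<Sum>i\<in>UNIV. D xs (p t i w)) \<le> (\<Sum>i\<in>UNIV. D xs (x t i w)) - \<sigma> / 2 * energy_drop (P t) (\<lambda>i. x t i w)"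
    and "(\<Sum>i\<in>UNIV. D xs (y t i w)) \<le> (\<Sum>i\<in>UNIV. D xs (p t i w) + c * norm (v t i w) + L * (norm (v t i w))\<^sup>2)"
    by (auto intro: sum_mono)
  then show ?thesis
    by (simp add: sum.distrib)
qed

definition "W t w = (\<Sum>i\<in>UNIV. D xs (x t i w))"
definition "err t w = (\<Sum>i\<in>UNIV. norm (x (Suc t) i w - mix (P t) (\<lambda>j. x t j w) i))"

text \<open>The sum that involves \<open>drift\<close> has mean zero.\<close>

lemma step_pathwise:
  "AE w in M. Fsum (x t l w) - Fsum xs \<le>
    G * (real CARD('v) * sqrt (dispersion (\<lambda>i. x t i w)) + (\<Sum>i\<in>UNIV. norm (v t i w))) +
    (\<Sum>i\<in>UNIV. drift t i w - gs t i (y t i w) w \<bullet> (y t i w - xs)) +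
    (\<Sum>i\<in>UNIV. \<alpha> t / (2 * \<sigma>) * (norm (gs t i (y t i w) w) + Gh)\<^sup>2) +
    (W t w - W (Suc t) w - \<sigma> / 2 * energy_drop (P t) (\<lambda>i. x t i w) +
      (\<Sum>i\<in>UNIV. c * norm (v t i w) + L * (norm (v t i w))\<^sup>2)) / \<alpha> t"
proof -
  have "AE w in M. g i (y t i w) \<in> subdifferential (f i) (y t i w)" for i
    using oracles unfolding stochastic_subgradient_assumption_def by blast
  moreover have "AE w in M. real_cond_exp M (H t) (\<lambda>w. gs t i (y t i w) w $ k) w = g i (y t i w) $ k" for i k
    using oracles unfolding stochastic_subgradient_assumption_def cond_mean_is_def by blast
  ultimately have "AE w in M. (\<forall>i\<in>UNIV. g i (y t i w) \<in> subdifferential (f i) (y t i w)) \<and>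
      (\<forall>i\<in>UNIV. \<forall>k\<in>UNIV. real_cond_exp M (H t) (\<lambda>w. gs t i (y t i w) w $ k) w = g i (y t i w) $ k)"
    by (intro AE_conjI AE_finite_allI) auto
  then show ?thesis
    using AE_space
  proof eventually_elim
    case (elim w)
    let ?s = "\<lambda>i. gs t i (y t i w) w"
    have "f i (x t l w) + h i (x t l w) - (f i xs + h i xs) \<le>
        G * norm (x t l w - y t i w) + (drift t i w - ?s i \<bullet> (y t i w - xs)) +
        \<alpha> t / (2 * \<sigma>) * (norm (?s i) + Gh)\<^sup>2 + (D xs (y t i w) - D xs (x (Suc t) i w)) / \<alpha> t" for i
      using elim by (intro step_agent) auto
    then have "(\<Sum>i\<in>UNIV. f i (x t l w) + h i (x t l w) - (f i xs + h i xs)) \<le>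
        (\<Sum>i\<in>UNIV. G * norm (x t l w - y t i w) + (drift t i w - ?s i \<bullet> (y t i w - xs)) +
        \<alpha> t / (2 * \<sigma>) * (norm (?s i) + Gh)\<^sup>2 + (D xs (y t i w) - D xs (x (Suc t) i w)) / \<alpha> t)"
      by (rule sum_mono)
    then have "Fsum (x t l w) - Fsum xs \<le> G * (\<Sum>i\<in>UNIV. norm (x t l w - y t i w)) +
        (\<Sum>i\<in>UNIV. drift t i w - ?s i \<bullet> (y t i w - xs)) +
        (\<Sum>i\<in>UNIV. \<alpha> t / (2 * \<sigma>) * (norm (?s i) + Gh)\<^sup>2) + ((\<Sum>i\<in>UNIV. D xs (y t i w)) - W (Suc t) w) / \<alpha> t"
      unfolding sum_subtractf sum.distrib
      by (simp add: Fsum_def W_def sum.distrib sum_subtractf sum_distrib_left sum_divide_distrib[symmetric])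
    moreover have "G * (\<Sum>i\<in>UNIV. norm (x t l w - y t i w)) \<le>
        G * (real CARD('v) * sqrt (dispersion (\<lambda>i. x t i w)) + (\<Sum>i\<in>UNIV. norm (v t i w)))"
      using elim by (intro mult_left_mono sum_dist_le G_nonneg) auto
    moreover have "((\<Sum>i\<in>UNIV. D xs (y t i w)) - W (Suc t) w) / \<alpha> t \<le>
        (W t w - W (Suc t) w - \<sigma> / 2 * energy_drop (P t) (\<lambda>i. x t i w) +
        (\<Sum>i\<in>UNIV. c * norm (v t i w) + L * (norm (v t i w))\<^sup>2)) / \<alpha> t"
      using elim sum_bregman_y_le[of w t] \<alpha>(1)[of t] by (intro divide_right_mono) (auto simp: W_def)
    ultimately show ?case
      by linarith
  qed
qed

section \<open>Integrability and moments\<close>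

lemma integrable_bounded:
  fixes Z :: "'w \<Rightarrow> real"
  assumes "Z \<in> borel_measurable M" and "\<And>w. w \<in> space M \<Longrightarrow> 0 \<le> Z w \<and> Z w \<le> K"
  shows "integrable M Z"
  using assms by (intro integrable_const_bound[where B = K] AE_I2) auto

lemma dispersion_le:
  assumes "w \<in> space M"
  shows "dispersion (\<lambda>i. x t i w) \<le> real CARD('v) * d\<^sup>2"
proof -
  have "dispersion (\<lambda>i. x t i w) \<le> energy (\<lambda>i. x t i w - xs)"
    by (rule dispersion_le_energy_shift)
  also have "\<dots> \<le> (\<Sum>i\<in>(UNIV :: 'v set). d\<^sup>2)"
    unfolding energy_def using dist_le_d x_in_X[OF assms] xs_in_X by (intro sum_mono power_mono) auto
  finally show ?thesis
    by simp
qed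

lemma measurable_dispersion: "(\<lambda>w. dispersion (\<lambda>i. x t i w)) \<in> borel_measurable M"
proof -
  note [measurable] = measurable_x
  show ?thesis
    unfolding dispersion_def energy_def average_def by measurable
qed

lemma integrable_sqrt_dispersion: "integrable M (\<lambda>w. sqrt (dispersion (\<lambda>i. x t i w)))"
  using measurable_dispersion dispersion_le
  by (intro integrable_bounded[where K = "sqrt (real CARD('v) * d\<^sup>2)"]) (auto simp: dispersion_nonneg)

lemma integrable_energy_drop: "integrable M (\<lambda>w. energy_drop (P t) (\<lambda>i. x t i w))"
proof (rule integrable_bounded[where K = "real CARD('v) * d\<^sup>2"])
  note [measurable] = measurable_x
  show "(\<lambda>w. energy_drop (P t) (\<lambda>i. x t i w)) \<in> borel_measurable M"
    unfolding energy_drop_def energy_def mix_def by measurable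
  show "0 \<le> energy_drop (P t) (\<lambda>i. x t i w) \<and> energy_drop (P t) (\<lambda>i. x t i w) \<le> real CARD('v) * d\<^sup>2"
    if "w \<in> space M" for w
    using dispersion_le[OF that, of t] energy_drop_nonneg[OF doubly_stochastic_P]
      dispersion_mix[OF doubly_stochastic_P, of t "\<lambda>i. x t i w"] dispersion_nonneg[of "mix (P t) (\<lambda>i. x t i w)"]
    by simp
qed

lemma W_bounds:
  assumes "w \<in> space M"
  shows "0 \<le> W t w" and "W t w \<le> real CARD('v) * R\<^sup>2"
proof -
  show "0 \<le> W t w"
    by (simp add: W_def sum_nonneg bregman_nonneg)
  have "W t w \<le> (\<Sum>i\<in>(UNIV :: 'v set). R\<^sup>2)"
    unfolding W_def using bregman_le_R(1) xs_in_X x_in_X[OF assms] by (intro sum_mono) auto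
  then show "W t w \<le> real CARD('v) * R\<^sup>2"
    by simp
qed

lemma integrable_W: "integrable M (W t)"
proof (rule integrable_bounded)
  have "continuous_on UNIV (\<lambda>z. D xs z)"
    unfolding bregman_def by (intro continuous_intros continuous_mirror continuous_gradient)
  from measurable_continuous[OF this measurable_x] show "W t \<in> borel_measurable M"
    unfolding W_def by (intro borel_measurable_sum) auto
qed (use W_bounds in blast)

lemma integrable_err: "integrable M (err t)"
proof (rule integrable_bounded)
  note [measurable] = measurable_x
  show "err t \<in> borel_measurable M"
    unfolding err_def mix_def by measurable
  fix w
  assume w: "w \<in> space M"
  have "err t w \<le> (\<Sum>i\<in>(UNIV :: 'v set). d)"
    unfolding err_def using dist_le_d x_in_X[OF w] p_in_X[OF w] by (intro sum_mono) (auto simp: p_def)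
  then show "0 \<le> err t w \<and> err t w \<le> real CARD('v) * d"
    by (simp add: err_def sum_nonneg)
qed

text \<open>The weights of a row sum to 1, so by convexity of the norm and of its square the
  averaged noise inherits the moment bounds of a single link, scaled by \<open>r t\<close>.\<close>

lemma noise_moments:
  shows "integrable M (\<lambda>w. norm (v t i w))" and "integrable M (\<lambda>w. (norm (v t i w))\<^sup>2)"
    and "expectation (\<lambda>w. norm (v t i w)) \<le> r t * sqrt \<nu>"
    and "expectation (\<lambda>w. (norm (v t i w))\<^sup>2) \<le> (r t)\<^sup>2 * \<nu>"
proof -
  note [measurable] = measurable_v measurable_\<xi>
  have "cond_second_moment_le M (past M F t) (\<xi> t i j) \<nu>" for j
    using noise by (simp add: noise_assumption_def)
  note moments = cond_second_moment_bounds[OF subalgebra_past measurable_\<xi> this \<nu>_nonneg]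
  let ?a = "\<lambda>j. P t $ i $ j"
  have a: "?a j \<ge> 0" "sum ?a UNIV = 1" for j
    using doubly_stochasticD[OF doubly_stochastic_P] by auto
  have 1: "norm (v t i w) \<le> r t * (\<Sum>j\<in>UNIV. ?a j * norm (\<xi> t i j w))" if "w \<in> space M" for w
    using norm_sum[of "\<lambda>j. ?a j *\<^sub>R \<xi> t i j w" UNIV] r(1)[of t] a
    by (simp add: v_eq[OF that] mult_left_mono less_imp_le)
  have 2: "(norm (v t i w))\<^sup>2 \<le> (r t)\<^sup>2 * (\<Sum>j\<in>UNIV. ?a j * (norm (\<xi> t i j w))\<^sup>2)" if "w \<in> space M" for w
  proof -
    have "0 \<le> (\<Sum>j\<in>UNIV. ?a j * (norm (\<xi> t i j w - mix (P t) (\<lambda>j. \<xi> t i j w) i))\<^sup>2)"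
      by (intro sum_nonneg mult_nonneg_nonneg a) auto
    then have "(norm (mix (P t) (\<lambda>j. \<xi> t i j w) i))\<^sup>2 \<le> (\<Sum>j\<in>UNIV. ?a j * (norm (\<xi> t i j w))\<^sup>2)"
      unfolding row_variance[OF doubly_stochastic_P] by simp
    then show ?thesis
      by (simp add: v_eq[OF that] mix_def power_mult_distrib mult_left_mono)
  qed
  have int1: "integrable M (\<lambda>w. r t * (\<Sum>j\<in>UNIV. ?a j * norm (\<xi> t i j w)))"
    and int2: "integrable M (\<lambda>w. (r t)\<^sup>2 * (\<Sum>j\<in>UNIV. ?a j * (norm (\<xi> t i j w))\<^sup>2))"
    using moments by auto
  show I1: "integrable M (\<lambda>w. norm (v t i w))"
    using order_trans[OF 1 abs_ge_self] by (intro Bochner_Integration.integrable_bound[OF int1] AE_I2) auto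
  show I2: "integrable M (\<lambda>w. (norm (v t i w))\<^sup>2)"
    using order_trans[OF 2 abs_ge_self] by (intro Bochner_Integration.integrable_bound[OF int2] AE_I2) auto
  have "expectation (\<lambda>w. norm (v t i w)) \<le> expectation (\<lambda>w. r t * (\<Sum>j\<in>UNIV. ?a j * norm (\<xi> t i j w)))"
    using 1 by (intro integral_mono I1 int1) auto
  also have "\<dots> = r t * (\<Sum>j\<in>UNIV. ?a j * expectation (\<lambda>w. norm (\<xi> t i j w)))"
    using moments by simp
  also have "\<dots> \<le> r t * (\<Sum>j\<in>UNIV. ?a j * sqrt \<nu>)"
    using moments a r(1)[of t] by (intro mult_left_mono sum_mono) auto
  finally show "expectation (\<lambda>w. norm (v t i w)) \<le> r t * sqrt \<nu>"
    using a by (simp add: sum_distrib_right[symmetric])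
  have "expectation (\<lambda>w. (norm (v t i w))\<^sup>2) \<le> expectation (\<lambda>w. (r t)\<^sup>2 * (\<Sum>j\<in>UNIV. ?a j * (norm (\<xi> t i j w))\<^sup>2))"
    using 2 by (intro integral_mono I2 int2) auto
  also have "\<dots> = (r t)\<^sup>2 * (\<Sum>j\<in>UNIV. ?a j * expectation (\<lambda>w. (norm (\<xi> t i j w))\<^sup>2))"
    using moments by simp
  also have "\<dots> \<le> (r t)\<^sup>2 * (\<Sum>j\<in>UNIV. ?a j * \<nu>)"
    using moments a by (intro mult_left_mono sum_mono) auto
  finally show "expectation (\<lambda>w. (norm (v t i w))\<^sup>2) \<le> (r t)\<^sup>2 * \<nu>"
    using a by (simp add: sum_distrib_right[symmetric])
qed

lemma oracle_moments:
  shows "integrable M (\<lambda>w. norm (gs t i (y t i w) w))" and "integrable M (\<lambda>w. (norm (gs t i (y t i w) w))\<^sup>2)"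
    and "expectation (\<lambda>w. norm (gs t i (y t i w) w)) \<le> Gf"
    and "expectation (\<lambda>w. (norm (gs t i (y t i w) w))\<^sup>2) \<le> Gf\<^sup>2"
proof -
  have "cond_second_moment_le M (H t) (\<lambda>w. gs t i (y t i w) w) (Gf\<^sup>2)"
    using oracles unfolding stochastic_subgradient_assumption_def by blast
  note * = cond_second_moment_bounds[OF subalgebra_H measurable_gs this zero_le_power2]
  show "integrable M (\<lambda>w. norm (gs t i (y t i w) w))" "integrable M (\<lambda>w. (norm (gs t i (y t i w) w))\<^sup>2)"
    "expectation (\<lambda>w. (norm (gs t i (y t i w) w))\<^sup>2) \<le> Gf\<^sup>2"
    using * by auto
  show "expectation (\<lambda>w. norm (gs t i (y t i w) w)) \<le> Gf"
    using *(4) Gf_nonneg by simp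
qed

text \<open>The vector \<open>y - xs\<close> is known given the past and the current noise, so each
  of its coordinates can be pulled out of the conditional expectation. It need not be bounded; the
  products are integrable because both factors are square integrable.\<close>

lemma drift_moments:
  shows "integrable M (drift t i)" and "integrable M (\<lambda>w. gs t i (y t i w) w \<bullet> (y t i w - xs))"
    and "expectation (drift t i) = expectation (\<lambda>w. gs t i (y t i w) w \<bullet> (y t i w - xs))"
proof -
  note [measurable] = measurable_y measurable_gs measurable_y_H measurable_v
  interpret sub: finite_measure_subalgebra M "H t"
    by unfold_locales (rule subalgebra_H)
  let ?s = "\<lambda>w. gs t i (y t i w) w"
  have comp_sq: "integrable M (\<lambda>w. (Z w $ k)\<^sup>2)"
    if "integrable M (\<lambda>w. (norm (Z w))\<^sup>2)" "Z \<in> borel_measurable M" for Z :: "'w \<Rightarrow> real ^ 'n" and k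
  proof (rule Bochner_Integration.integrable_bound[OF that(1)])
    note [measurable] = that(2)
    show "(\<lambda>w. (Z w $ k)\<^sup>2) \<in> borel_measurable M"
      by measurable
    have "(Z w $ k)\<^sup>2 \<le> (norm (Z w))\<^sup>2" for w
      using power_mono[OF component_le_norm_cart[of "Z w" k], of 2] by simp
    then show "AE w in M. norm ((Z w $ k)\<^sup>2) \<le> norm ((norm (Z w))\<^sup>2)"
      by simp
  qed
  have "integrable M (\<lambda>w. (norm (y t i w - xs))\<^sup>2)"
  proof (rule Bochner_Integration.integrable_bound)
    show "integrable M (\<lambda>w. d\<^sup>2 + 2 * d * norm (v t i w) + (norm (v t i w))\<^sup>2)"
      using noise_moments by simp
    show "AE w in M. norm ((norm (y t i w - xs))\<^sup>2) \<le> norm (d\<^sup>2 + 2 * d * norm (v t i w) + (norm (v t i w))\<^sup>2)"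
    proof (rule AE_I2)
      fix w
      assume w: "w \<in> space M"
      have "norm (y t i w - xs) \<le> norm (p t i w - xs) + norm (v t i w)"
        using norm_triangle_ineq[of "p t i w - xs" "v t i w"] by (simp add: v_def)
      also have "\<dots> \<le> d + norm (v t i w)"
        using dist_le_d[OF p_in_X[OF w] xs_in_X] by simp
      finally have "(norm (y t i w - xs))\<^sup>2 \<le> (d + norm (v t i w))\<^sup>2"
        by (intro power_mono) auto
      then show "norm ((norm (y t i w - xs))\<^sup>2) \<le> norm (d\<^sup>2 + 2 * d * norm (v t i w) + (norm (v t i w))\<^sup>2)"
        by (simp add: power2_sum algebra_simps)
    qed
  qed simp
  from comp_sq[OF this] have sq_y: "integrable M (\<lambda>w. (y t i w $ k - xs $ k)\<^sup>2)" for k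
    by simp
  have sq_s: "integrable M (\<lambda>w. (?s w $ k)\<^sup>2)" for k
    by (rule comp_sq[OF oracle_moments(2) measurable_gs])
  have prod: "integrable M (\<lambda>w. (y t i w $ k - xs $ k) * ?s w $ k)" for k
    by (rule integrable_mult_of_squares[OF _ _ sq_y sq_s]) measurable
  have meas: "(\<lambda>w. y t i w $ k - xs $ k) \<in> borel_measurable (H t)" "(\<lambda>w. ?s w $ k) \<in> borel_measurable M" for k
    by measurable
  note * = sub.real_cond_exp_intg[OF prod meas]
  show "integrable M (drift t i)"
    unfolding drift_def using *(1) by simp
  show "integrable M (\<lambda>w. ?s w \<bullet> (y t i w - xs))"
    using prod by (simp add: inner_vec_def mult.commute)
  show "expectation (drift t i) = expectation (\<lambda>w. ?s w \<bullet> (y t i w - xs))"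
    unfolding drift_def inner_vec_def using * prod by (simp add: mult.commute)
qed

end

text \<open>Write \<gamma> for \<open>\<rho> powr (1 / B)\<close>. As \<gamma>^B = \<rho> and
  \<gamma>^k \<ge> \<rho> for k < B, the geometric sum gives (1 - \<gamma>) B \<rho> \<le> 1 -
  \<rho> = \<theta> / (4 N^2). A further factor \<rho> < 1 on the left produces the exponent
  -2.\<close>

lemma spectral_constant_ge:
  fixes N \<theta> :: real and B :: nat
  assumes "N \<ge> 1" and "0 < \<theta>" "\<theta> < 1" and "B \<ge> 1"
  defines "\<rho> \<equiv> 1 - \<theta> / (4 * N\<^sup>2)"
  shows "\<rho> powr (1 / B) < 1" and "4 * N\<^sup>2 * B / \<theta> \<le> \<rho> powi (-2) / (1 - \<rho> powr (1 / B))"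
proof -
  let ?\<gamma> = "\<rho> powr (1 / B)"
  have "1 \<le> N\<^sup>2"
    using assms(1) by (simp add: one_le_power)
  then have "\<theta> < 4 * N\<^sup>2"
    using assms(3) by linarith
  then have \<rho>: "0 < \<rho>" "\<rho> < 1"
    using assms(1,2) \<open>1 \<le> N\<^sup>2\<close> by (auto simp: \<rho>_def divide_simps)
  have power: "?\<gamma> ^ B = \<rho>"
    using \<rho> \<open>B \<ge> 1\<close> by (simp add: powr_power)
  show \<gamma>: "?\<gamma> < 1"
    using one_le_power[of ?\<gamma> B] power \<rho>(2) by linarith
  have "?\<gamma> > 0"
    using \<rho> by simp
  have "\<rho> \<le> ?\<gamma> ^ k" if "k < B" for k
    using power_decreasing[of k B ?\<gamma>] that \<gamma> \<open>?\<gamma> > 0\<close> unfolding power by simp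
  then have "(\<Sum>k<B. \<rho>) \<le> (\<Sum>k<B. ?\<gamma> ^ k)"
    by (intro sum_mono) auto
  then have "(1 - ?\<gamma>) * (B * \<rho>) \<le> (1 - ?\<gamma>) * (\<Sum>k<B. ?\<gamma> ^ k)"
    using \<gamma> by (intro mult_left_mono) auto
  also have "\<dots> = 1 - \<rho>"
    using one_diff_power_eq[of ?\<gamma> B] power by simp
  finally have "(1 - ?\<gamma>) * (B * \<rho>) \<le> \<theta> / (4 * N\<^sup>2)"
    by (simp add: \<rho>_def)
  then have "4 * N\<^sup>2 / \<theta> * ((1 - ?\<gamma>) * (B * \<rho>)) \<le> 4 * N\<^sup>2 / \<theta> * (\<theta> / (4 * N\<^sup>2))"
    using assms(2) by (intro mult_left_mono) auto
  then have "4 * N\<^sup>2 / \<theta> * ((1 - ?\<gamma>) * (B * \<rho>)) \<le> 1"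
    using assms(1,2) by simp
  then have "4 * N\<^sup>2 / \<theta> * ((1 - ?\<gamma>) * (B * \<rho>)) * \<rho> \<le> 1 * 1"
    using \<rho> by (intro mult_mono) auto
  then have "4 * N\<^sup>2 * B / \<theta> * (1 - ?\<gamma>) * \<rho>\<^sup>2 \<le> 1"
    by (simp add: power2_eq_square mult_ac)
  then have "4 * N\<^sup>2 * B / \<theta> * (1 - ?\<gamma>) \<le> 1 / \<rho>\<^sup>2"
    using \<rho> by (simp add: pos_le_divide_eq)
  moreover have "1 - ?\<gamma> > 0"
    using \<gamma> by simp
  ultimately have "4 * N\<^sup>2 * B / \<theta> \<le> 1 / \<rho>\<^sup>2 / (1 - ?\<gamma>)"
    by (simp only: pos_le_divide_eq)
  moreover have "\<rho> powi (-2) = 1 / \<rho>\<^sup>2"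
    by (simp add: power_int_def divide_inverse power_inverse)
  ultimately show "4 * N\<^sup>2 * B / \<theta> \<le> \<rho> powi (-2) / (1 - ?\<gamma>)"
    by simp
qed

section \<open>The expected gap and the claimed constants\<close>

context dscmd_run
begin

definition "gap t l = expectation (\<lambda>w. Fsum (x t l w) - Fsum xs)"

lemma Fsum_ge:
  assumes "z \<in> X"
  shows "Fsum xs \<le> Fsum z"
  using xs assms by (auto simp: is_arg_min_linorder Fsum_def)

lemma continuous_Fsum: "continuous_on UNIV Fsum"
  unfolding Fsum_def using convex_f convex_h
  by (intro continuous_on_sum continuous_on_add convex_on_continuous) auto

lemma integrable_Fsum:
  assumes "Z \<in> borel_measurable M" and "\<And>w. w \<in> space M \<Longrightarrow> Z w \<in> X"
  shows "integrable M (\<lambda>w. Fsum (Z w) - Fsum xs)"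
proof (rule integrable_bounded)
  show "(\<lambda>w. Fsum (Z w) - Fsum xs) \<in> borel_measurable M"
    using measurable_continuous[OF continuous_Fsum assms(1)] by simp
qed (use assms(2) Fsum_ge Fsum_diff_le xs_in_X in auto)

lemma gap_le: "gap t l \<le> real CARD('v) * G * d"
proof -
  have "gap t l \<le> expectation (\<lambda>_. real CARD('v) * G * d)"
    unfolding gap_def using x_in_X xs_in_X
    by (intro integral_mono integrable_Fsum measurable_x Fsum_diff_le) auto
  then show ?thesis
    by (simp add: prob_space)
qed

text \<open>Under the expectation of \<open>step_pathwise\<close> the drift cancels against the
  oracle term. The squared sum of the oracle norm and \<open>Gh\<close> has mean at most
  \<open>G\<^sup>2\<close>, since the first moment of that norm is at most
  \<open>Gf\<close>.\<close>

lemma expected_step: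
  "gap t l \<le> real CARD('v) * G * expectation (\<lambda>w. sqrt (dispersion (\<lambda>i. x t i w))) +
    real CARD('v) * G * (r t * sqrt \<nu>) +
    (expectation (W t) - expectation (W (Suc t)) -
      \<sigma> / 2 * expectation (\<lambda>w. energy_drop (P t) (\<lambda>i. x t i w)) +
      real CARD('v) * c * (r t * sqrt \<nu>) + real CARD('v) * L * (r t * sqrt \<nu>)\<^sup>2) / \<alpha> t +
    \<alpha> t * (real CARD('v) * G\<^sup>2 / (2 * \<sigma>))"
proof -
  let ?N = "real CARD('v)"
  let ?s = "\<lambda>i w. gs t i (y t i w) w"
  let ?S = "\<lambda>w. sqrt (dispersion (\<lambda>i. x t i w))"
  let ?\<Delta> = "\<lambda>w. energy_drop (P t) (\<lambda>i. x t i w)"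
  let ?m = "\<lambda>i w. drift t i w - ?s i w \<bullet> (y t i w - xs)"
  let ?q = "\<lambda>i w. (norm (?s i w) + Gh)\<^sup>2"
  note int = integrable_sqrt_dispersion noise_moments(1,2) integrable_W integrable_energy_drop
  have int_m: "integrable M (?m i)" and m: "expectation (?m i) = 0" for i
    using drift_moments by auto
  have sq: "?q i = (\<lambda>w. (norm (?s i w))\<^sup>2 + 2 * Gh * norm (?s i w) + Gh\<^sup>2)" for i
    by (simp add: power2_sum fun_eq_iff)
  have int_q: "integrable M (?q i)" for i
    unfolding sq using oracle_moments by simp
  have q: "expectation (?q i) \<le> G\<^sup>2" for i
  proof -
    have "expectation (?q i) = expectation (\<lambda>w. (norm (?s i w))\<^sup>2) + 2 * Gh * expectation (\<lambda>w. norm (?s i w)) + Gh\<^sup>2"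
      unfolding sq using oracle_moments by (simp add: prob_space)
    also have "\<dots> \<le> Gf\<^sup>2 + 2 * Gh * Gf + Gh\<^sup>2"
      using oracle_moments Gh_nonneg by (intro add_mono mult_left_mono) auto
    finally show ?thesis
      by (simp add: G_def power2_sum mult_ac)
  qed
  have "gap t l \<le> expectation (\<lambda>w. G * (?N * ?S w + (\<Sum>i\<in>UNIV. norm (v t i w))) + (\<Sum>i\<in>UNIV. ?m i w) +
      (\<Sum>i\<in>UNIV. \<alpha> t / (2 * \<sigma>) * ?q i w) + (W t w - W (Suc t) w - \<sigma> / 2 * ?\<Delta> w +
      (\<Sum>i\<in>UNIV. c * norm (v t i w) + L * (norm (v t i w))\<^sup>2)) / \<alpha> t)"
    unfolding gap_def using int drift_moments(1,2) int_m int_q x_in_X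
    by (intro integral_mono_AE step_pathwise integrable_Fsum measurable_x Bochner_Integration.integrable_add Bochner_Integration.integrable_diff
        Bochner_Integration.integrable_sum integrable_mult_right integrable_divide) auto
  also have "\<dots> = G * (?N * expectation ?S + (\<Sum>i\<in>UNIV. expectation (\<lambda>w. norm (v t i w)))) +
      (\<Sum>i\<in>UNIV. \<alpha> t / (2 * \<sigma>) * expectation (?q i)) +
      (expectation (W t) - expectation (W (Suc t)) - \<sigma> / 2 * expectation ?\<Delta> +
      (\<Sum>i\<in>UNIV. c * expectation (\<lambda>w. norm (v t i w)) + L * expectation (\<lambda>w. (norm (v t i w))\<^sup>2))) / \<alpha> t"
    using int int_m int_q m by simp
  also have "\<dots> \<le> G * (?N * expectation ?S + (\<Sum>i\<in>(UNIV :: 'v set). r t * sqrt \<nu>)) +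
      (\<Sum>i\<in>(UNIV :: 'v set). \<alpha> t / (2 * \<sigma>) * G\<^sup>2) +
      (expectation (W t) - expectation (W (Suc t)) - \<sigma> / 2 * expectation ?\<Delta> +
      (\<Sum>i\<in>(UNIV :: 'v set). c * (r t * sqrt \<nu>) + L * ((r t)\<^sup>2 * \<nu>))) / \<alpha> t"
    using q noise_moments(3,4) G_nonneg \<alpha>(1)[of t] sigma_pos c_bounds(1) L_pos
    by (intro add_mono mult_left_mono sum_mono divide_right_mono order_refl) (auto simp: less_imp_le)
  also have "\<dots> = ?N * G * expectation ?S + ?N * G * (r t * sqrt \<nu>) +
      (expectation (W t) - expectation (W (Suc t)) - \<sigma> / 2 * expectation ?\<Delta> +
      ?N * c * (r t * sqrt \<nu>) + ?N * L * (r t * sqrt \<nu>)\<^sup>2) / \<alpha> t + \<alpha> t * (?N * G\<^sup>2 / (2 * \<sigma>))"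
    using \<nu>_nonneg by (simp add: power_mult_distrib distrib_left mult_ac)
  finally show ?thesis .
qed

lemma expected_W: "0 \<le> expectation (W t)" "expectation (W t) \<le> real CARD('v) * (\<sigma> * d\<^sup>2 / 2)"
proof -
  show "0 \<le> expectation (W t)"
    using W_bounds by (intro integral_nonneg_AE AE_I2) auto
  have "expectation (W t) \<le> expectation (\<lambda>_. real CARD('v) * R\<^sup>2)"
    using W_bounds integrable_W by (intro integral_mono) auto
  then show "expectation (W t) \<le> real CARD('v) * (\<sigma> * d\<^sup>2 / 2)"
    by (simp add: prob_space R_square)
qed

lemma expected_err: "expectation (err t) \<le> real CARD('v) * (\<alpha> t * G + L * (r t * sqrt \<nu>)) / \<sigma>"
proof -
  let ?s = "\<lambda>i w. gs t i (y t i w) w"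
  let ?b = "\<lambda>w. \<Sum>i\<in>UNIV. (\<alpha> t * (norm (?s i w) + Gh) + L * norm (v t i w)) / \<sigma>"
  note moments = oracle_moments(1,3)[of t] noise_moments(1,3)[of t]
  have int: "integrable M ?b"
    using moments by simp
  have "expectation (err t) \<le> expectation ?b"
  proof (intro integral_mono integrable_err int)
    fix w
    assume w: "w \<in> space M"
    have "norm (x (Suc t) i w - mix (P t) (\<lambda>j. x t j w) i) \<le>
        (\<alpha> t * (norm (?s i w) + Gh) + L * norm (v t i w)) / \<sigma>" for i
      using prox_displacement_le[OF X(2) convex_h \<alpha>(1) prox[OF w] p_in_X[OF w] h_diff_le[OF p_in_X[OF w]] Gh_nonneg]
        sigma_pos by (simp add: p_def v_def pos_le_divide_eq mult.commute)
    then show "err t w \<le> ?b w"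
      unfolding err_def by (rule sum_mono)
  qed
  also have "\<dots> = (\<Sum>i\<in>UNIV. (\<alpha> t * (expectation (\<lambda>w. norm (?s i w)) + Gh) + L * expectation (\<lambda>w. norm (v t i w))) / \<sigma>)"
    using moments by (simp add: prob_space)
  also have "\<dots> \<le> (\<Sum>i\<in>(UNIV :: 'v set). (\<alpha> t * (Gf + Gh) + L * (r t * sqrt \<nu>)) / \<sigma>)"
    using moments \<alpha>(1)[of t] sigma_pos L_pos
    by (intro sum_mono divide_right_mono add_mono mult_left_mono) (auto simp: less_imp_le)
  finally show ?thesis
    by (simp add: G_def)
qed

lemma network_constants: "0 < \<theta>" "\<theta> < 1" "B \<ge> 1"
  using network by (auto simp: network_assumption_def)

lemma rate_recursion_gap:
  assumes "CARD('v) \<ge> 2"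
  shows "rate_recursion (\<lambda>t. gap t l) (\<lambda>t. expectation (\<lambda>w. sqrt (dispersion (\<lambda>i. x t i w))))
    (\<lambda>t. r t * sqrt \<nu>) (\<lambda>t. expectation (\<lambda>w. energy_drop (P t) (\<lambda>i. x t i w)))
    (\<lambda>t. expectation (W t)) (\<lambda>t. expectation (err t)) \<alpha> (real CARD('v)) \<sigma> L \<theta> G d c B"
proof
  let ?N = "real CARD('v)"
  have N: "?N \<ge> 2"
    using assms by simp
  show "?N \<ge> 2"
    by (rule N)
  show "\<theta> \<le> 1"
    using network_constants by simp
  show "r t * sqrt \<nu> \<ge> 0" for t
    using r(1)[of t] \<nu>_nonneg by simp
  show "4 * \<sigma> < L \<Longrightarrow> c \<le> d * L / 2"
    using c_bounds(3)[OF assms] .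
  show "expectation (\<lambda>w. sqrt (dispersion (\<lambda>i. x t i w))) \<ge> 0" for t
    by (simp add: dispersion_nonneg)
  show "expectation (\<lambda>w. energy_drop (P t) (\<lambda>i. x t i w)) \<ge> 0" for t
    by (simp add: energy_drop_nonneg[OF doubly_stochastic_P])
  show "expectation (err t) \<ge> 0" for t
    by (intro integral_nonneg_AE) (simp add: err_def sum_nonneg)
  have conn: "strongly_connected_graph (\<Union>t\<in>{s * B + 1..(s + 1) * B}. edges (P t))" for s
    using network by (simp add: network_assumption_def)
  \<comment> \<open>With at least two agents this ratio is below 1, as the window bound
    requires.\<close>
  have small: "2 * \<theta> / ?N\<^sup>2 \<le> 1"
  proof -
    have "2\<^sup>2 \<le> ?N\<^sup>2"
      using N by (intro power_mono) auto
    then show ?thesis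
      using network_constants by (simp add: pos_divide_le_eq)
  qed
  show "?N * G * expectation (\<lambda>w. sqrt (dispersion (\<lambda>i. x t i w))) \<le>
      \<mu> * (\<Sum>k<2 * B. expectation (\<lambda>w. energy_drop (P (t + k)) (\<lambda>i. x (t + k) i w))) +
      (?N * G)\<^sup>2 * ?N\<^sup>2 / (4 * \<theta> * \<mu>) + ?N * G * (?N / \<theta>) * (\<Sum>k<2 * B. expectation (err (t + k)))"
    if "1 \<le> t" "\<mu> > 0" for t \<mu>
  proof -
    have "?N * G * sqrt (dispersion (\<lambda>i. x t i w)) \<le>
        \<mu> * (\<Sum>k<2 * B. energy_drop (P (t + k)) (\<lambda>i. x (t + k) i w)) +
        (?N * G)\<^sup>2 * ?N\<^sup>2 / (4 * \<theta> * \<mu>) + ?N * G * (?N / \<theta>) * (\<Sum>k<2 * B. err (t + k) w)" for w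
      unfolding err_def using network_constants G_nonneg that small
      by (intro window_sqrt_dispersion_le[where x = "\<lambda>t i. x t i w"] weighted_network_P conn) auto
    then have "expectation (\<lambda>w. ?N * G * sqrt (dispersion (\<lambda>i. x t i w))) \<le>
        expectation (\<lambda>w. \<mu> * (\<Sum>k<2 * B. energy_drop (P (t + k)) (\<lambda>i. x (t + k) i w)) +
        (?N * G)\<^sup>2 * ?N\<^sup>2 / (4 * \<theta> * \<mu>) + ?N * G * (?N / \<theta>) * (\<Sum>k<2 * B. err (t + k) w))"
      by (intro integral_mono Bochner_Integration.integrable_add integrable_mult_right Bochner_Integration.integrable_sum
          integrable_sqrt_dispersion integrable_energy_drop integrable_err) auto
    then show ?thesis
      by (simp add: integrable_sqrt_dispersion integrable_energy_drop integrable_err prob_space)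
  qed
  show "expectation (\<lambda>w. sqrt (dispersion (\<lambda>i. x (t + 2 * B) i w))) \<le>
      expectation (\<lambda>w. sqrt (dispersion (\<lambda>i. x t i w))) + (\<Sum>k<2 * B. expectation (err (t + k)))" for t
  proof -
    have "sqrt (dispersion (\<lambda>i. x (t + 2 * B) i w)) \<le> sqrt (dispersion (\<lambda>i. x t i w)) + (\<Sum>k<2 * B. err (t + k) w)" for w
      unfolding err_def by (rule sqrt_dispersion_shift_le[where x = "\<lambda>t i. x t i w", OF weighted_network_P])
    then have "expectation (\<lambda>w. sqrt (dispersion (\<lambda>i. x (t + 2 * B) i w))) \<le>
        expectation (\<lambda>w. sqrt (dispersion (\<lambda>i. x t i w)) + (\<Sum>k<2 * B. err (t + k) w))"
      by (intro integral_mono Bochner_Integration.integrable_add Bochner_Integration.integrable_sum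
          integrable_sqrt_dispersion integrable_err) auto
    then show ?thesis
      by (simp add: integrable_sqrt_dispersion integrable_err)
  qed
qed (use sigma_pos sigma_le_L network_constants G_nonneg d_nonneg \<alpha> c_bounds(2) expected_W gap_le expected_step
    expected_err in auto)

text \<open>Without disagreement no windows are needed: the step inequality telescopes by itself,
  and the nonnegative drop is discarded.\<close>

lemma sum_gap_le_single:
  assumes "CARD('v) < 2" and "T \<ge> 1"
  shows "(\<Sum>t\<in>{1..T}. gap t l) \<le> \<sigma> * d\<^sup>2 / 2 / \<alpha> T + (\<Sum>t\<in>{1..T}. G * (r t * sqrt \<nu>) +
    d * L * (r t * sqrt \<nu>) / \<alpha> t + L * (r t * sqrt \<nu>)\<^sup>2 / \<alpha> t + \<alpha> t * (G\<^sup>2 / (2 * \<sigma>)))"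
proof -
  have N: "real CARD('v) = 1"
    using assms(1) N_ge_1 by linarith
  have eq: "i = j" for i j :: 'v
    using card_le_Suc0_iff_eq[of "UNIV :: 'v set"] assms(1) by auto
  have zero: "dispersion (\<lambda>i. x t i w) = 0" for t w
  proof -
    have "(norm (x t i w - x t l w))\<^sup>2 = 0" for i
      using eq[of i l] by simp
    then have "energy (\<lambda>i. x t i w - x t l w) = 0"
      by (simp only: energy_def sum.neutral_const)
    then show ?thesis
      using dispersion_le_energy_shift[of "\<lambda>i. x t i w" "x t l w"] dispersion_nonneg[of "\<lambda>i. x t i w"] by simp
  qed
  have "gap t l \<le> (expectation (W t) - expectation (W (Suc t))) / \<alpha> t + (G * (r t * sqrt \<nu>) +
    d * L * (r t * sqrt \<nu>) / \<alpha> t + L * (r t * sqrt \<nu>)\<^sup>2 / \<alpha> t + \<alpha> t * (G\<^sup>2 / (2 * \<sigma>)))" for t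
  proof -
    have "expectation (\<lambda>w. energy_drop (P t) (\<lambda>i. x t i w)) \<ge> 0"
      by (simp add: energy_drop_nonneg[OF doubly_stochastic_P])
    then have "\<sigma> * expectation (\<lambda>w. energy_drop (P t) (\<lambda>i. x t i w)) / (2 * \<alpha> t) \<ge> 0"
      using sigma_pos \<alpha>(1)[of t] by simp
    then show ?thesis
      using expected_step[of t l] assms(1) unfolding N zero c_def
      by (simp add: add_divide_distrib diff_divide_distrib mult_ac)
  qed
  then have "(\<Sum>t\<in>{1..T}. gap t l) \<le> (\<Sum>t\<in>{1..T}. (expectation (W t) - expectation (W (Suc t))) / \<alpha> t + (G * (r t * sqrt \<nu>) +
    d * L * (r t * sqrt \<nu>) / \<alpha> t + L * (r t * sqrt \<nu>)\<^sup>2 / \<alpha> t + \<alpha> t * (G\<^sup>2 / (2 * \<sigma>))))"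
    by (rule sum_mono)
  also have "\<dots> = (\<Sum>t\<in>{1..T}. (expectation (W t) - expectation (W (Suc t))) / \<alpha> t) + (\<Sum>t\<in>{1..T}. G * (r t * sqrt \<nu>) +
    d * L * (r t * sqrt \<nu>) / \<alpha> t + L * (r t * sqrt \<nu>)\<^sup>2 / \<alpha> t + \<alpha> t * (G\<^sup>2 / (2 * \<sigma>)))"
    by (rule sum.distrib)
  also have "(\<Sum>t\<in>{1..T}. (expectation (W t) - expectation (W (Suc t))) / \<alpha> t) \<le> \<sigma> * d\<^sup>2 / 2 / \<alpha> T"
    using expected_W unfolding N by (intro weighted_telescope_le \<alpha> assms(2)) auto
  finally show ?thesis
    by simp
qed

lemma expected_gap_average_le:
  assumes "T \<ge> 1"
  shows "expectation (\<lambda>w. Fsum ((1 / real T) *\<^sub>R (\<Sum>t=1..T. x t l w))) - Fsum xs \<le> (\<Sum>t\<in>{1..T}. gap t l) / T"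
proof -
  let ?a = "\<lambda>w. (1 / real T) *\<^sub>R (\<Sum>t=1..T. x t l w)"
  note [measurable] = measurable_x
  have a: "?a w = (\<Sum>t\<in>{1..T}. (1 / real T) *\<^sub>R x t l w)" for w
    by (simp add: scaleR_sum_right)
  have weights: "(\<Sum>t\<in>{1..T}. 1 / real T) = 1"
    using assms by simp
  have aX: "?a w \<in> X" if "w \<in> space M" for w
    unfolding a using X(2) x_in_X[OF that] weights by (intro convex_sum) auto
  have jensen: "k (?a w) \<le> (\<Sum>t\<in>{1..T}. (1 / real T) * k (x t l w))" if "convex_on UNIV k" for k w
    unfolding a using that weights assms by (intro convex_on_sum) auto
  have "Fsum (?a w) - Fsum xs \<le> (\<Sum>t\<in>{1..T}. (1 / real T) * (Fsum (x t l w) - Fsum xs))" for w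
  proof -
    have "Fsum (?a w) \<le> (\<Sum>i\<in>UNIV. (\<Sum>t\<in>{1..T}. (1 / real T) * f i (x t l w)) + (\<Sum>t\<in>{1..T}. (1 / real T) * h i (x t l w)))"
      unfolding Fsum_def by (intro sum_mono add_mono jensen convex_f convex_h)
    also have "\<dots> = (\<Sum>t\<in>{1..T}. (1 / real T) * Fsum (x t l w))"
      unfolding sum.distrib[symmetric] distrib_left[symmetric]
      by (subst sum.swap) (simp only: Fsum_def sum_distrib_left)
    finally show ?thesis
      using assms by (simp add: right_diff_distrib sum_subtractf)
  qed
  then have "expectation (\<lambda>w. Fsum (?a w) - Fsum xs) \<le> expectation (\<lambda>w. \<Sum>t\<in>{1..T}. (1 / real T) * (Fsum (x t l w) - Fsum xs))"
    using aX x_in_X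
    by (intro integral_mono integrable_Fsum Bochner_Integration.integrable_sum integrable_mult_right) measurable
  also have "\<dots> = (\<Sum>t\<in>{1..T}. gap t l) / T"
    unfolding gap_def sum_divide_distrib using integrable_Fsum[OF measurable_x x_in_X] by simp
  finally have "expectation (\<lambda>w. Fsum (?a w) - Fsum xs) \<le> (\<Sum>t\<in>{1..T}. gap t l) / T" .
  moreover have "integrable M (\<lambda>w. Fsum (?a w))"
  proof -
    have "integrable M (\<lambda>w. Fsum (?a w) - Fsum xs)"
      using aX by (intro integrable_Fsum) measurable
    then have "integrable M (\<lambda>w. (Fsum (?a w) - Fsum xs) + Fsum xs)"
      by (intro Bochner_Integration.integrable_add) auto
    then show ?thesis
      by simp
  qed
  ultimately show ?thesis
    by (simp add: prob_space)
qed

text \<open>\<open>K\<close> abstracts the claimed network factor. The budget fits because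
  \<open>(N + 1) * Gf + N * Gh\<close> is at least \<open>N * G\<close>; the case of a single agent
  needs no network factor.\<close>

lemma sum_gap_le:
  fixes K :: real
  assumes "T \<ge> 1" and K: "K \<ge> 8 * real CARD('v) ^ 4 * B / \<theta>"
  defines "N \<equiv> real CARD('v)"
  shows "(\<Sum>t\<in>{1..T}. gap t l) \<le> N * R\<^sup>2 / \<alpha> T + (\<Sum>t\<in>{1..T}.
    ((K * ((N + 1) * Gf + N * Gh) + N * Gh) * ((Gf + Gh) / \<sigma>) + N * Gf\<^sup>2 / (2 * \<sigma>)) * \<alpha> t +
    (K * ((N + 1) * Gf + N * Gh) * N * sqrt \<nu> + (Gf + Gh) * N\<^sup>2 * sqrt \<nu>) * r t +
    sqrt (2 / \<sigma>) * R * L * N * sqrt \<nu> * (r t / \<alpha> t) + N * L * \<nu> * ((r t)\<^sup>2 / \<alpha> t))"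
    (is "_ \<le> _ + (\<Sum>t\<in>{1..T}. ?b t)")
proof -
  have N: "N \<ge> 1"
    using N_ge_1 by (simp add: N_def)
  have "K \<ge> 0"
    using K network_constants by (smt (verit) divide_nonneg_pos mult_nonneg_nonneg of_nat_0_le_iff zero_le_power)
  have ge: "K * ((N + 1) * Gf + N * Gh) \<ge> K * (N * G)"
    using \<open>K \<ge> 0\<close> Gf_nonneg by (intro mult_left_mono) (auto simp: G_def algebra_simps)
  have KG: "8 * N ^ 5 * B * G / \<theta> \<le> K * (N * G)"
  proof -
    have "8 * N ^ 4 * B / \<theta> * (N * G) \<le> K * (N * G)"
      using K N G_nonneg by (intro mult_right_mono) (auto simp: N_def)
    then show ?thesis
      by (simp add: numeral_eq_Suc mult_ac)
  qed
  have KG0: "K * (N * G) \<ge> 0"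
    using \<open>K \<ge> 0\<close> N G_nonneg by simp
  \<comment> \<open>\<open>G\<^sup>2\<close> exceeds \<open>Gf\<^sup>2\<close> by
    \<open>Gh * (2 * Gf + Gh)\<close>, which is at most \<open>2 * Gh * G\<close>. This matches the
    two summands of \<open>C3\<close> outside the network factor.\<close>
  have half: "N * G\<^sup>2 / (2 * \<sigma>) \<le> N * Gh * (G / \<sigma>) + N * Gf\<^sup>2 / (2 * \<sigma>)"
  proof -
    have "N * G\<^sup>2 \<le> N * (2 * Gh * G + Gf\<^sup>2)"
      using N by (intro mult_left_mono) (simp_all add: G_def power2_eq_square algebra_simps)
    then have "N * G\<^sup>2 / (2 * \<sigma>) \<le> N * (2 * Gh * G + Gf\<^sup>2) / (2 * \<sigma>)"
      using sigma_pos by (intro divide_right_mono) auto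
    also have "\<dots> = N * Gh * (G / \<sigma>) + N * Gf\<^sup>2 / (2 * \<sigma>)"
      by (simp add: distrib_left add_divide_distrib)
    finally show ?thesis .
  qed
  have b: "K * (N * G) * (G / \<sigma>) * \<alpha> t + N * G\<^sup>2 / (2 * \<sigma>) * \<alpha> t + K * (N * G) * (r t * sqrt \<nu>) +
      N * G * (r t * sqrt \<nu>) + N * d * L * (r t * sqrt \<nu>) / \<alpha> t + N * L * (r t * sqrt \<nu>)\<^sup>2 / \<alpha> t \<le> ?b t" for t
  proof -
    have "K * (N * G) * (G / \<sigma>) + N * G\<^sup>2 / (2 * \<sigma>) \<le>
        (K * ((N + 1) * Gf + N * Gh) + N * Gh) * (G / \<sigma>) + N * Gf\<^sup>2 / (2 * \<sigma>)"
      using half mult_right_mono[OF ge, of "G / \<sigma>"] G_nonneg sigma_pos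
      unfolding distrib_right[of "K * ((N + 1) * Gf + N * Gh)"] by simp
    from mult_right_mono[OF this, of "\<alpha> t"] \<alpha>(1)[of t]
    have 1: "K * (N * G) * (G / \<sigma>) * \<alpha> t + N * G\<^sup>2 / (2 * \<sigma>) * \<alpha> t \<le>
        ((K * ((N + 1) * Gf + N * Gh) + N * Gh) * (G / \<sigma>) + N * Gf\<^sup>2 / (2 * \<sigma>)) * \<alpha> t"
      by (simp only: distrib_right[of _ _ "\<alpha> t"] less_imp_le)
    have "K * (N * G) * 1 \<le> K * ((N + 1) * Gf + N * Gh) * N"
      by (rule mult_mono[OF ge N]) (use ge KG0 in linarith, simp)
    moreover have "G * N \<le> G * N\<^sup>2"
      using N G_nonneg by (intro mult_left_mono) (auto simp: power2_eq_square)
    ultimately have "(K * (N * G) + N * G) * (r t * sqrt \<nu>) \<le>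
        (K * ((N + 1) * Gf + N * Gh) * N + G * N\<^sup>2) * (r t * sqrt \<nu>)"
      using r(1)[of t] \<nu>_nonneg by (intro mult_right_mono) (auto simp: mult.commute)
    moreover have "(a * q + b * q) * p = (a + b) * (p * q)" for a b p q :: real
      by (simp add: algebra_simps)
    ultimately have 2: "K * (N * G) * (r t * sqrt \<nu>) + N * G * (r t * sqrt \<nu>) \<le>
        (K * ((N + 1) * Gf + N * Gh) * N * sqrt \<nu> + G * N\<^sup>2 * sqrt \<nu>) * r t"
      by (simp only: distrib_right[of "K * (N * G)" "N * G"])
    have 3: "N * d * L * (r t * sqrt \<nu>) / \<alpha> t = sqrt (2 / \<sigma>) * R * L * N * sqrt \<nu> * (r t / \<alpha> t)"
      by (simp add: d_def)
    have 4: "N * L * (r t * sqrt \<nu>)\<^sup>2 / \<alpha> t = N * L * \<nu> * ((r t)\<^sup>2 / \<alpha> t)"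
      using \<nu>_nonneg by (simp add: power_mult_distrib)
    show ?thesis
      using 1 2 3 4 unfolding G_def[symmetric] by linarith
  qed
  show ?thesis
  proof (cases "CARD('v) \<ge> 2")
    case True
    interpret rate: rate_recursion "\<lambda>t. gap t l" "\<lambda>t. expectation (\<lambda>w. sqrt (dispersion (\<lambda>i. x t i w)))"
      "\<lambda>t. r t * sqrt \<nu>" "\<lambda>t. expectation (\<lambda>w. energy_drop (P t) (\<lambda>i. x t i w))"
      "\<lambda>t. expectation (W t)" "\<lambda>t. expectation (err t)" \<alpha> "real CARD('v)" \<sigma> L \<theta> G d c B
      by (rule rate_recursion_gap[OF True])
    have "rate.budget t \<le> ?b t" for t
    proof -
      have "8 * N ^ 5 * B * G / \<theta> * (G / \<sigma>) * \<alpha> t \<le> K * (N * G) * (G / \<sigma>) * \<alpha> t"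
        using KG G_nonneg sigma_pos \<alpha>(1)[of t] by (intro mult_right_mono) auto
      moreover have "8 * N ^ 5 * B * G / \<theta> * (G / \<sigma>) * \<alpha> t = 8 * N ^ 5 * B * G\<^sup>2 / (\<theta> * \<sigma>) * \<alpha> t"
        by (simp add: power2_eq_square)
      moreover have "8 * N ^ 5 * B * G / \<theta> * (r t * sqrt \<nu>) \<le> K * (N * G) * (r t * sqrt \<nu>)"
        using KG r(1)[of t] \<nu>_nonneg by (intro mult_right_mono) auto
      ultimately show ?thesis
        using b[of t] unfolding rate.budget_def unfolding N_def[symmetric] by linarith
    qed
    then have "(\<Sum>t\<in>{1..T}. rate.budget t) \<le> (\<Sum>t\<in>{1..T}. ?b t)"
      by (rule sum_mono)
    then show ?thesis
      using rate.sum_le_budget[of T] by (simp add: N_def R_square)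
  next
    case False
    then have "CARD('v) < 2"
      by simp
    then have N1: "N = 1"
      using N unfolding N_def by linarith
    have "G * (r t * sqrt \<nu>) + d * L * (r t * sqrt \<nu>) / \<alpha> t + L * (r t * sqrt \<nu>)\<^sup>2 / \<alpha> t +
        \<alpha> t * (G\<^sup>2 / (2 * \<sigma>)) \<le> ?b t" for t
    proof -
      have "K * (N * G) * (G / \<sigma>) * \<alpha> t \<ge> 0" "K * (N * G) * (r t * sqrt \<nu>) \<ge> 0"
        using mult_nonneg_nonneg[OF mult_nonneg_nonneg[OF KG0, of "G / \<sigma>"], of "\<alpha> t"]
          mult_nonneg_nonneg[OF KG0, of "r t * sqrt \<nu>"]
          G_nonneg sigma_pos \<alpha>(1)[of t] r(1)[of t] \<nu>_nonneg by simp_all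
      then show ?thesis
        using b[of t] unfolding N1 by (simp add: mult.commute)
    qed
    then have "(\<Sum>t\<in>{1..T}. G * (r t * sqrt \<nu>) + d * L * (r t * sqrt \<nu>) / \<alpha> t + L * (r t * sqrt \<nu>)\<^sup>2 / \<alpha> t +
        \<alpha> t * (G\<^sup>2 / (2 * \<sigma>))) \<le> (\<Sum>t\<in>{1..T}. ?b t)"
      by (rule sum_mono)
    moreover have "\<sigma> * d\<^sup>2 / 2 / \<alpha> T = N * R\<^sup>2 / \<alpha> T"
      by (simp add: R_square N1)
    ultimately show ?thesis
      using sum_gap_le_single[OF \<open>CARD('v) < 2\<close> assms(1), of l] by linarith
  qed
qed

end

theorem theorem1:
  fixes M :: "'w measure"
    and F :: "nat \<Rightarrow> 'w measure"
    and X :: "(real ^ 'n) set"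
    and f h :: "'v::finite \<Rightarrow> real ^ 'n \<Rightarrow> real"
    and \<Phi> :: "real ^ 'n \<Rightarrow> real"
    and d\<Phi> :: "real ^ 'n \<Rightarrow> real ^ 'n"
    and \<sigma> L \<theta> Gf \<nu> :: real
    and B T :: nat
    and P :: "nat \<Rightarrow> real ^ 'v ^ 'v"
    and \<alpha> r :: "nat \<Rightarrow> real"
    and \<xi> :: "nat \<Rightarrow> 'v \<Rightarrow> 'v \<Rightarrow> 'w \<Rightarrow> real ^ 'n"
    and gs :: "nat \<Rightarrow> 'v \<Rightarrow> real ^ 'n \<Rightarrow> 'w \<Rightarrow> real ^ 'n"
    and g :: "'v \<Rightarrow> real ^ 'n \<Rightarrow> real ^ 'n"
    and x0 :: "'v \<Rightarrow> real ^ 'n"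
    and x y :: "nat \<Rightarrow> 'v \<Rightarrow> 'w \<Rightarrow> real ^ 'n"
    and xs :: "real ^ 'n"
    and l :: 'v
  assumes "prob_space M"
    and "X \<noteq> {}" and "convex X" and "compact X"
    and "\<And>i. convex_on UNIV (f i)" and "\<And>i. convex_on UNIV (h i)"
    and "is_arg_min (\<lambda>z. \<Sum>i\<in>UNIV. f i z + h i z) (\<lambda>z. z \<in> X) xs"
    and "mirror_map \<Phi> d\<Phi> \<sigma>"
    and "dscmd_n M X \<Phi> d\<Phi> h P \<alpha> r \<xi> gs x0 x y"
    and "adapted_history M F X \<xi> gs x y"
    and "network_assumption P B \<theta>"
    and "stochastic_subgradient_assumption M F X f \<xi> gs y g Gf"
    and "noise_assumption M F \<xi> \<nu>"
    and "mirror_map_assumption \<Phi> d\<Phi> L TYPE('v)"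
    and "\<And>t. \<alpha> t > 0" and "decseq \<alpha>"
    and "\<And>t. r t > 0" and "decseq r"
    and "T \<ge> 1"
  shows "let
      N = real CARD('v);
      Gh = subgradient_bound h X;
      D = bregman_diameter \<Phi> d\<Phi> X;
      \<omega> = (1 - \<theta> / (4 * N\<^sup>2)) powi (-2);
      \<gamma> = (1 - \<theta> / (4 * N\<^sup>2)) powr (1 / real B);
      C1 = 2 * N * \<omega> / (1 - \<gamma>) * ((N + 1) * Gf + N * Gh) * (\<Sum>j\<in>UNIV. norm (x0 j));
      C2 = N * D\<^sup>2;
      C3 = ((4 * N + 2 * N\<^sup>2 * \<omega> / (1 - \<gamma>)) * ((N + 1) * Gf + N * Gh) + N * Gh) * ((Gf + Gh) / \<sigma>)
           + N * Gf\<^sup>2 / (2 * \<sigma>);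
      C4 = (4 * N + 2 * N\<^sup>2 * \<omega> / (1 - \<gamma>)) * ((N + 1) * Gf + N * Gh) * N * sqrt \<nu>
           + (Gf + Gh) * N\<^sup>2 * sqrt \<nu>;
      C5 = sqrt (2 / \<sigma>) * D * L * N * sqrt \<nu>;
      C6 = N * L * \<nu>;
      Fsum = (\<lambda>z. \<Sum>i\<in>UNIV. f i z + h i z);
      xhat = (\<lambda>w. (1 / real T) *\<^sub>R (\<Sum>t=1..T. x t l w))
    in
      prob_space.expectation M (\<lambda>w. Fsum (xhat w)) - Fsum xs
        \<le> C1 / T + C2 / (T * \<alpha> T) + C3 / T * (\<Sum>t=0..T. \<alpha> t) + C4 / T * (\<Sum>t=0..T. r t)
          + C5 / T * (\<Sum>t=0..T. r t / \<alpha> t) + C6 / T * (\<Sum>t=0..T. (r t)\<^sup>2 / \<alpha> t)"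
proof -
  interpret dscmd_run M \<Phi> d\<Phi> \<sigma> L F X f h \<theta> Gf \<nu> B P \<alpha> r \<xi> gs g x0 x y xs
    using assms(1-18)
    by (intro dscmd_run.intro dscmd_run_axioms.intro smooth_mirror_map.intro)
      (auto simp: mirror_map_assumption_def)
  define N where "N = real CARD('v)"
  define \<omega> where "\<omega> = (1 - \<theta> / (4 * N\<^sup>2)) powi (-2)"
  define \<gamma> where "\<gamma> = (1 - \<theta> / (4 * N\<^sup>2)) powr (1 / real B)"
  define C1 where "C1 = 2 * N * \<omega> / (1 - \<gamma>) * ((N + 1) * Gf + N * Gh) * (\<Sum>j\<in>UNIV. norm (x0 j))"
  define C3 where "C3 = ((4 * N + 2 * N\<^sup>2 * \<omega> / (1 - \<gamma>)) * ((N + 1) * Gf + N * Gh) + N * Gh) * ((Gf + Gh) / \<sigma>)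
    + N * Gf\<^sup>2 / (2 * \<sigma>)"
  define C4 where "C4 = (4 * N + 2 * N\<^sup>2 * \<omega> / (1 - \<gamma>)) * ((N + 1) * Gf + N * Gh) * N * sqrt \<nu>
    + (Gf + Gh) * N\<^sup>2 * sqrt \<nu>"
  define C5 where "C5 = sqrt (2 / \<sigma>) * R * L * N * sqrt \<nu>"
  define b where "b t = C3 * \<alpha> t + C4 * r t + C5 * (r t / \<alpha> t) + N * L * \<nu> * ((r t)\<^sup>2 / \<alpha> t)" for t
  have N: "N \<ge> 1"
    using N_ge_1 by (simp add: N_def)
  have \<gamma>: "\<gamma> < 1" and rate: "4 * N\<^sup>2 * B / \<theta> \<le> \<omega> / (1 - \<gamma>)"
    unfolding \<gamma>_def \<omega>_def using N network_constants by (intro spectral_constant_ge; simp)+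
  have "\<omega> \<ge> 0"
    by (simp add: \<omega>_def power_int_def)
  \<comment> \<open>The spectral bound multiplied by \<open>2 * N\<^sup>2\<close>; the summand
    \<open>4 * N\<close> is nonnegative slack.\<close>
  have K: "8 * N ^ 4 * B / \<theta> \<le> 4 * N + 2 * N\<^sup>2 * \<omega> / (1 - \<gamma>)"
  proof -
    have "2 * N\<^sup>2 * (4 * N\<^sup>2 * B / \<theta>) \<le> 2 * N\<^sup>2 * (\<omega> / (1 - \<gamma>))"
      using rate by (intro mult_left_mono) auto
    then show ?thesis
      using N by (simp add: numeral_eq_Suc mult_ac)
  qed
  have nonneg: "C1 \<ge> 0" "C3 \<ge> 0" "C4 \<ge> 0" "C5 \<ge> 0"
    unfolding C1_def C3_def C4_def C5_def
    using N \<gamma> \<open>\<omega> \<ge> 0\<close> Gf_nonneg Gh_nonneg R_nonneg sigma_pos L_pos \<nu>_nonneg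
    by (intro mult_nonneg_nonneg add_nonneg_nonneg divide_nonneg_nonneg sum_nonneg; simp)+
  have b_nonneg: "b t \<ge> 0" for t
    unfolding b_def using nonneg N L_pos \<nu>_nonneg \<alpha>(1)[of t] r(1)[of t]
    by (intro mult_nonneg_nonneg add_nonneg_nonneg divide_nonneg_nonneg) (auto simp: less_imp_le)
  have "(\<Sum>t\<in>{1..T}. gap t l) \<le> N * R\<^sup>2 / \<alpha> T + (\<Sum>t\<in>{1..T}. b t)"
    using sum_gap_le[OF \<open>T \<ge> 1\<close> K[unfolded N_def], of l]
    unfolding b_def C3_def C4_def C5_def N_def .
  \<comment> \<open>The gap is summed from 1, where the averaged iterates and the connectivity
    blocks begin; the terms at 0 are nonnegative.\<close>
  also have "(\<Sum>t\<in>{1..T}. b t) \<le> (\<Sum>t=0..T. b t)"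
    using b_nonneg by (intro sum_mono2) auto
  also have "\<dots> = C3 * (\<Sum>t=0..T. \<alpha> t) + C4 * (\<Sum>t=0..T. r t) + C5 * (\<Sum>t=0..T. r t / \<alpha> t) +
      N * L * \<nu> * (\<Sum>t=0..T. (r t)\<^sup>2 / \<alpha> t)"
    unfolding b_def sum.distrib sum_distrib_left ..
  finally have "(\<Sum>t\<in>{1..T}. gap t l) / T \<le> (C1 + (N * R\<^sup>2 / \<alpha> T + (C3 * (\<Sum>t=0..T. \<alpha> t) +
      C4 * (\<Sum>t=0..T. r t) + C5 * (\<Sum>t=0..T. r t / \<alpha> t) + N * L * \<nu> * (\<Sum>t=0..T. (r t)\<^sup>2 / \<alpha> t)))) / T"
    using nonneg(1) by (intro divide_right_mono) auto
  also have "\<dots> = C1 / T + N * R\<^sup>2 / (T * \<alpha> T) + C3 / T * (\<Sum>t=0..T. \<alpha> t) + C4 / T * (\<Sum>t=0..T. r t)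
      + C5 / T * (\<Sum>t=0..T. r t / \<alpha> t) + N * L * \<nu> / T * (\<Sum>t=0..T. (r t)\<^sup>2 / \<alpha> t)"
    by (simp add: add_divide_distrib mult.commute)
  finally have "expectation (\<lambda>w. Fsum ((1 / real T) *\<^sub>R (\<Sum>t=1..T. x t l w))) - Fsum xs \<le> \<dots>"
    using expected_gap_average_le[OF \<open>T \<ge> 1\<close>, of l] by linarith
  then show ?thesis
    unfolding Let_def Fsum_def C1_def C3_def C4_def C5_def \<omega>_def \<gamma>_def N_def .
qed

end
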